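(* Let $k$ be a field of characteristic zero, $\bar k$ an algebraic closure of $k$, and $H^0$ a $k$-group. Assume that $H^0$ is isomorphic to the multiplicative group $G_m$ over $\bar k$, but not over $k$. Then there is an action of $H^0$ on the affine space $\mathbb{A}^4$, defined over $k$, which is not linearizable over $k$.
   Context: A $k$-group is an algebraic group defined over $k$; $G_m$ is the multiplicative group and $\mathbb{A}^n$ is affine $n$-space over $k$. An action of a $k$-group $H^0$ on $\mathbb{A}^n$ defined over $k$ is a group action given by a morphism of $k$-varieties $\mu: H^0\times\mathbb{A}^n\to\mathbb{A}^n$. Such an action is called linearizable over $k$ if and only if there exists an automorphism $\phi$ of $\mathbb{A}^n$ as a $k$-variety such that $v\mapsto \phi(\mu(g,\phi^{-1}(v)))$ is a linear map for every $g\in H^0$ (here points of $H^0$ and $\mathbb{A}^n$ may be taken over $\bar k$). *)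

theory Defs
  imports
    "HOL-Algebra.Group_Action"
    "HOL-Algebra.Algebraic_Closure_Type"
    "HOL-Analysis.Cartesian_Space"
begin

no_notation fps_nth (infixl "$" 75)

text \<open>
  Varieties are treated in the classical language: a variety is identified with its set of points
  over an algebraically closed field \<open>'K\<close>, and a \<open>k\<close>-structure is given by a finite atlas of affine
  charts for which all data are defined over the subfield \<open>k\<close>. The field of definition is the
  parameter \<open>F\<close>, a subfield of \<open>'K\<close>; \<open>F = UNIV\<close> means "over the algebraically closed field", so
  that base change leaves the atlas unchanged and only enlarges \<open>F\<close>. This is adequate in
  characteristic 0: there, a set is defined over \<open>F\<close> iff it is the zero set of polynomials over \<open>F\<close>,
  and group schemes of finite type are reduced. Varieties need not be irreducible or affine.
\<close>

abbreviation ground_field :: "'k::field alg_closure set" where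
  "ground_field \<equiv> range to_ac"

text \<open>
  Polynomials with coefficients in \<open>F\<close> in the coordinates indexed by \<open>'n\<close>, as functions; since an
  algebraically closed field is infinite, they may be identified with formal polynomials.
\<close>

inductive_set poly_fun :: "'K::field set \<Rightarrow> ('K ^ 'n \<Rightarrow> 'K) set" for F where
  const: "c \<in> F \<Longrightarrow> (\<lambda>_. c) \<in> poly_fun F"
| coord: "(\<lambda>x. x $ i) \<in> poly_fun F"
| add: "p \<in> poly_fun F \<Longrightarrow> q \<in> poly_fun F \<Longrightarrow> (\<lambda>x. p x + q x) \<in> poly_fun F"
| mult: "p \<in> poly_fun F \<Longrightarrow> q \<in> poly_fun F \<Longrightarrow> (\<lambda>x. p x * q x) \<in> poly_fun F"

definition zariski_closed :: "'K::field set \<Rightarrow> ('K ^ 'n) set \<Rightarrow> bool" where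
  "zariski_closed F V \<longleftrightarrow> (\<exists>S \<subseteq> poly_fun F. V = {x. \<forall>p \<in> S. p x = 0})"

definition zariski_open_in :: "'K::field set \<Rightarrow> ('K ^ 'n) set \<Rightarrow> ('K ^ 'n) set \<Rightarrow> bool" where
  "zariski_open_in F V D \<longleftrightarrow> (\<exists>Z. zariski_closed F Z \<and> D = V - Z)"

definition regular_on :: "'K::field set \<Rightarrow> ('K ^ 'n) set \<Rightarrow> ('K ^ 'n \<Rightarrow> 'K) \<Rightarrow> bool" where
  "regular_on F D f \<longleftrightarrow>
     (\<forall>x \<in> D. \<exists>p \<in> poly_fun F. \<exists>q \<in> poly_fun F.
        q x \<noteq> 0 \<and> (\<forall>y \<in> D. q y \<noteq> 0 \<longrightarrow> f y = p y / q y))"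

definition regular_map_on ::
  "'K::field set \<Rightarrow> ('K ^ 'n) set \<Rightarrow> ('K ^ 'n \<Rightarrow> 'K ^ 'm) \<Rightarrow> bool" where
  "regular_map_on F D f \<longleftrightarrow> (\<forall>j. regular_on F D (\<lambda>x. f x $ j))"

text \<open>
  A chart is a subset of the space of points together with a map from it to an affine space.
  Allowing only one index type \<open>'n\<close> for all charts of an atlas is no restriction, since affine
  spaces may be embedded into larger ones.
\<close>

type_synonym ('a, 'K, 'n) atlas = "('a set \<times> ('a \<Rightarrow> 'K ^ 'n)) set"

definition points :: "('a, 'K, 'n) atlas \<Rightarrow> 'a set" where
  "points A = (\<Union>(U, c) \<in> A. U)"

definition vec_pair :: "'K ^ 'n::finite \<Rightarrow> 'K ^ 'm::finite \<Rightarrow> 'K ^ ('n + 'm)" where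
  "vec_pair u v = (\<chi> i. case i of Inl a \<Rightarrow> u $ a | Inr b \<Rightarrow> v $ b)"

text \<open>
  In the last clause of each of the following two definitions, \<open>c ` (U \<inter> W)\<close> resp.
  \<open>c ` {x \<in> U. f x \<in> W}\<close> is the part of the chart image on which the other chart makes sense. The
  third clause of \<open>variety\<close> says that the diagonal is closed (separatedness).
\<close>

definition variety :: "'K::field set \<Rightarrow> ('a, 'K, 'n::finite) atlas \<Rightarrow> bool" where
  "variety F A \<longleftrightarrow>
     finite A \<and>
     (\<forall>(U, c) \<in> A. inj_on c U \<and> zariski_closed F (c ` U)) \<and>
     (\<forall>(U, c) \<in> A. \<forall>(W, d) \<in> A.
        zariski_closed F ((\<lambda>x. vec_pair (c x) (d x)) ` (U \<inter> W))) \<and>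
     (\<forall>(U, c) \<in> A. \<forall>(W, d) \<in> A.
        zariski_open_in F (c ` U) (c ` (U \<inter> W)) \<and>
        regular_map_on F (c ` (U \<inter> W)) (d \<circ> inv_into U c))"

definition morphism ::
  "'K::field set \<Rightarrow> ('a, 'K, 'n::finite) atlas \<Rightarrow> ('b, 'K, 'm::finite) atlas \<Rightarrow> ('a \<Rightarrow> 'b) \<Rightarrow> bool" where
  "morphism F A B f \<longleftrightarrow>
     f ` points A \<subseteq> points B \<and>
     (\<forall>(U, c) \<in> A. \<forall>(W, d) \<in> B.
        zariski_open_in F (c ` U) (c ` {x \<in> U. f x \<in> W}) \<and>
        regular_map_on F (c ` {x \<in> U. f x \<in> W}) (d \<circ> f \<circ> inv_into U c))"

definition isomorphism ::
  "'K::field set \<Rightarrow> ('a, 'K, 'n::finite) atlas \<Rightarrow> ('b, 'K, 'm::finite) atlas \<Rightarrow> ('a \<Rightarrow> 'b) \<Rightarrow> bool" where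
  "isomorphism F A B f \<longleftrightarrow>
     bij_betw f (points A) (points B) \<and> morphism F A B f \<and>
     morphism F B A (inv_into (points A) f)"

definition prod_variety ::
  "('a, 'K, 'n::finite) atlas \<Rightarrow> ('b, 'K, 'm::finite) atlas \<Rightarrow> ('a \<times> 'b, 'K, 'n + 'm) atlas" where
  "prod_variety A B =
     {(U \<times> W, \<lambda>(x, y). vec_pair (c x) (d y)) | U c W d. (U, c) \<in> A \<and> (W, d) \<in> B}"

definition affine_space :: "('K ^ 'n, 'K, 'n) atlas" where
  "affine_space = {(UNIV, id)}"

definition algebraic_group ::
  "'K::field set \<Rightarrow> ('a, 'K, 'n::finite) atlas \<Rightarrow> 'a monoid \<Rightarrow> bool" where
  "algebraic_group F A G \<longleftrightarrow>
     variety F A \<and> group G \<and> carrier G = points A \<and>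
     morphism F (prod_variety A A) A (\<lambda>(x, y). x \<otimes>\<^bsub>G\<^esub> y) \<and>
     morphism F A A (\<lambda>x. inv\<^bsub>G\<^esub> x) \<and>
     (\<forall>(U, c) \<in> A. \<one>\<^bsub>G\<^esub> \<in> U \<longrightarrow> (\<forall>i. c \<one>\<^bsub>G\<^esub> $ i \<in> F))"

definition algebraic_groups_isomorphic ::
  "'K::field set \<Rightarrow> ('a, 'K, 'n::finite) atlas \<Rightarrow> 'a monoid \<Rightarrow>
   ('b, 'K, 'm::finite) atlas \<Rightarrow> 'b monoid \<Rightarrow> bool" where
  "algebraic_groups_isomorphic F A G B H \<longleftrightarrow> (\<exists>\<phi> \<in> iso G H. isomorphism F A B \<phi>)"

text \<open>The multiplicative group, with the hyperbola \<open>x * y = 1\<close> as its only chart.\<close>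

definition Gm_atlas :: "('K::field, 'K, 2) atlas" where
  "Gm_atlas = {({x. x \<noteq> 0}, \<lambda>x. vector [x, inverse x])}"

definition Gm :: "'K::field monoid" where
  "Gm = \<lparr>carrier = {x. x \<noteq> 0}, monoid.mult = (*), one = 1\<rparr>"

definition algebraic_action ::
  "'K::field set \<Rightarrow> ('a, 'K, 'n::finite) atlas \<Rightarrow> 'a monoid \<Rightarrow>
   ('b, 'K, 'm::finite) atlas \<Rightarrow> ('a \<Rightarrow> 'b \<Rightarrow> 'b) \<Rightarrow> bool" where
  "algebraic_action F A G B \<rho> \<longleftrightarrow>
     group_action G (points B) \<rho> \<and> morphism F (prod_variety A B) B (\<lambda>(g, x). \<rho> g x)"

definition linearizable ::
  "'K::field set \<Rightarrow> 'a monoid \<Rightarrow> ('a \<Rightarrow> 'K ^ 'm \<Rightarrow> 'K ^ 'm::finite) \<Rightarrow> bool" where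
  "linearizable F G \<rho> \<longleftrightarrow>
     (\<exists>\<phi> :: 'K ^ 'm \<Rightarrow> 'K ^ 'm. isomorphism F affine_space affine_space \<phi> \<and>
        (\<forall>g \<in> carrier G. Vector_Spaces.linear (*s) (*s) (\<lambda>v. \<phi> (\<rho> g (inv_into UNIV \<phi> v)))))"

end

theory Submission
  imports Defs
begin

text \<open>
  Write \<open>F\<close> for the ground field and \<open>K\<close> for its algebraic closure. An isomorphism \<open>\<phi>\<close> from \<open>H\<close> to the
  multiplicative group over \<open>K\<close> is a character of \<open>H\<close>. Its conjugate under an automorphism \<open>\<sigma>\<close> of \<open>K\<close> over
  \<open>F\<close> is again an isomorphism, and the only algebraic automorphisms of the multiplicative group are the
  identity and the inversion, so the conjugate is \<open>\<phi>\<close> or \<open>1 / \<phi>\<close>. If it were always \<open>\<phi>\<close>, then \<open>\<phi>\<close> would be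
  defined over \<open>F\<close>. Hence both signs occur, and they are recorded by an element \<open>\<delta>\<close> of \<open>K\<close> with
  \<open>\<sigma> \<delta> = \<plusminus> \<delta>\<close>: the group \<open>H\<close> is the norm-one torus of the quadratic extension \<open>F(\<delta>)\<close>
  (\<open>anisotropic_character\<close>).

  An \<open>F\<close>-form of an affine space over \<open>F(\<delta>)\<close> with an action of \<open>H\<close> is therefore an action of the
  multiplicative group over \<open>F(\<delta>)\<close>, together with a semilinear involution that inverts the group. Take the
  weights \<open>(2, -2, 3, -3)\<close> on coordinates \<open>(a, b, u, v)\<close>. One such involution composes the conjugation \<open>\<sigma>\<close>
  with the linear map \<open>swap_pairs\<close>. Another one composes \<open>\<sigma>\<close> with the polynomial map \<open>reflection\<close>, which
  goes back to the non-linearizable actions of the orthogonal group \<open>O_2\<close> found by Schwarz. The form of affine space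
  defined by the second one is again the affine space over \<open>F\<close>, by means of the explicit polynomial change
  of coordinates \<open>straighten\<close>. In the new coordinates the torus acts by \<open>twisted_act\<close>. This action
  commutes with the automorphisms of \<open>K\<close> over \<open>F\<close>, so by Galois descent it is defined over \<open>F\<close>
  (\<open>algebraic_action_twisted\<close>).

  A linearization over \<open>F\<close> would give a polynomial automorphism of \<open>K ^ 4\<close> that commutes with the weights
  and carries \<open>reflection\<close> to \<open>swap_pairs\<close>. The element \<open>-1\<close> of the torus fixes exactly the plane
  \<open>u = v = 0\<close>, so the automorphism has a normal derivative along this plane. By the weights it is a matrix
  with rows \<open>(\<alpha>(t), a^3 \<beta>(t))\<close> and \<open>(b^3 \<gamma>(t), \<epsilon>(t))\<close>, where \<open>t = a b\<close>, and its determinant is a nonzero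
  constant \<open>c\<close>. Compatibility with the involutions forces \<open>\<alpha> \<alpha>\<^sup>\<sigma> - t^3 \<gamma> \<gamma>\<^sup>\<sigma> = c (1 - t)\<close>. The first product has
  even degree and the second one has odd degree at least 3, so they cannot cancel down to degree 1
  (\<open>norm_identity_impossible\<close>, \<open>no_equivariant_trivialization\<close>).
\<close>

section \<open>Polynomial functions\<close>

lemma poly_fun_mono:
  assumes "F \<subseteq> F'" shows "poly_fun F \<subseteq> poly_fun F'"
proof
  fix p :: "'a ^ 'b \<Rightarrow> 'a" assume "p \<in> poly_fun F"
  then show "p \<in> poly_fun F'"
    by induction (use assms in \<open>auto intro: poly_fun.intros\<close>)
qed

lemma poly_fun_sum:
  assumes "0 \<in> F" "\<And>i. i \<in> I \<Longrightarrow> f i \<in> poly_fun F"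
  shows "(\<lambda>x. \<Sum>i\<in>I. f i x) \<in> poly_fun F"
  using assms(2)
proof (induction I rule: infinite_finite_induct)
  case (insert i I)
  then have "(\<lambda>x. f i x + (\<Sum>i\<in>I. f i x)) \<in> poly_fun F"
    by (intro poly_fun.add) auto
  then show ?case using insert by simp
qed (use assms(1) in \<open>auto intro: poly_fun.const\<close>)

lemma poly_fun_diff:
  assumes "-1 \<in> F" "p \<in> poly_fun F" "q \<in> poly_fun F"
  shows "(\<lambda>x. p x - q x) \<in> poly_fun F"
proof -
  have "(\<lambda>x. p x + (- 1) * q x) \<in> poly_fun F"
    by (intro poly_fun.intros assms)
  then show ?thesis by simp
qed

lemma poly_fun_uminus: "- 1 \<in> F \<Longrightarrow> p \<in> poly_fun F \<Longrightarrow> (\<lambda>x. - p x) \<in> poly_fun F"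
  using poly_fun.mult[OF poly_fun.const, of "- 1" F p] by simp

lemma poly_fun_power:
  assumes "1 \<in> F" "p \<in> poly_fun F"
  shows "(\<lambda>x. p x ^ k) \<in> poly_fun F"
proof (induction k)
  case (Suc k)
  then have "(\<lambda>x. p x * p x ^ k) \<in> poly_fun F"
    by (intro poly_fun.mult assms)
  then show ?case by simp
qed (use assms(1) in \<open>auto intro: poly_fun.const\<close>)

lemma poly_fun_poly:
  assumes "p \<in> poly_fun UNIV"
  shows "(\<lambda>x. poly P (p x)) \<in> poly_fun UNIV"
  by (induction P) (auto intro!: poly_fun.intros assms)

lemma poly_fun_compose:
  assumes "p \<in> poly_fun F" "\<And>j. (\<lambda>x. g x $ j) \<in> poly_fun F"
  shows "(\<lambda>x. p (g x)) \<in> poly_fun F"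
  using assms(1) by induction (auto intro: poly_fun.intros assms(2))

lemma poly_fun_curve:
  fixes c :: "'K::field \<Rightarrow> 'K ^ 'n"
  assumes "p \<in> poly_fun F" "\<And>j. \<exists>P. \<forall>t. c t $ j = poly P t"
  shows "\<exists>P. \<forall>t. p (c t) = poly P t"
  using assms(1)
proof induction
  case (const a)
  show ?case by (rule exI[of _ "[:a:]"]) simp
next
  case (add p q)
  then obtain P Q where "\<forall>t. p (c t) = poly P t" "\<forall>t. q (c t) = poly Q t" by blast
  then show ?case by (intro exI[of _ "P + Q"]) simp
next
  case (mult p q)
  then obtain P Q where "\<forall>t. p (c t) = poly P t" "\<forall>t. q (c t) = poly Q t" by blast
  then show ?case by (intro exI[of _ "P * Q"]) simp
qed (rule assms(2))

lemma poly_fun_line: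
  fixes x h :: "'K::field ^ 'n"
  assumes "p \<in> poly_fun F"
  shows "\<exists>P. \<forall>t. p (x + t *s h) = poly P t"
  by (rule poly_fun_curve[OF assms]) (auto intro!: exI[of _ "[:x $ j, h $ j:]" for j])

lemma poly_fun_mult_eq_0:
  fixes p q :: "'K::field_char_0 ^ 'n \<Rightarrow> 'K"
  assumes p: "p \<in> poly_fun UNIV" and q: "q \<in> poly_fun UNIV"
    and pq: "\<And>x. p x * q x = 0" and y: "q y \<noteq> 0"
  shows "p x = 0"
proof -
  obtain P where P: "\<And>t. p (x + t *s (y - x)) = poly P t"
    using poly_fun_line[OF p] by blast
  obtain Q where Q: "\<And>t. q (x + t *s (y - x)) = poly Q t"
    using poly_fun_line[OF q] by blast
  have "poly (P * Q) t = poly 0 t" for t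
    using pq[of "x + t *s (y - x)"] by (simp add: P Q)
  then have "P * Q = 0"
    using poly_eq_poly_eq_iff[of "P * Q" 0] by (simp add: fun_eq_iff)
  moreover have "Q \<noteq> 0"
  proof -
    have "poly Q 1 = q y" using Q[of 1] by simp
    with y show ?thesis by auto
  qed
  ultimately have "P = 0" by simp
  then show ?thesis using P[of 0] by simp
qed

text \<open>
  The point is that the bound is uniform in the other coordinates: it fixes in advance how many
  interpolation nodes suffice in the \<open>i\<close>-th direction.
\<close>

lemma poly_fun_degree_bound:
  assumes "p \<in> poly_fun (UNIV :: 'K::field set)"
  shows "\<exists>N. \<forall>y. \<exists>P. degree P \<le> N \<and> (\<forall>t. p (\<chi> j. if j = i then t else y $ j) = poly P t)"
  using assms
proof induction
  case (const a)
  show ?case by (intro exI[of _ 0] allI exI[of _ "[:a:]"]) simp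
next
  case (coord k)
  have "\<exists>P. degree P \<le> 1 \<and> (\<forall>t. (\<chi> j. if j = i then t else y $ j) $ k = poly P t)" for y :: "'K ^ 'a"
    by (intro exI[of _ "if k = i then [:0, 1:] else [:y $ k:]"]) simp
  then show ?case by blast
next
  case (add p q)
  from add.IH(1) obtain N where N: "\<forall>y. \<exists>P. degree P \<le> N \<and> (\<forall>t. p (\<chi> j. if j = i then t else y $ j) = poly P t)"
    by blast
  from add.IH(2) obtain M where M: "\<forall>y. \<exists>P. degree P \<le> M \<and> (\<forall>t. q (\<chi> j. if j = i then t else y $ j) = poly P t)"
    by blast
  show ?case
  proof (intro exI[of _ "max N M"] allI)
    fix y
    from N obtain P where P: "degree P \<le> N" "\<forall>t. p (\<chi> j. if j = i then t else y $ j) = poly P t" by blast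
    from M obtain Q where Q: "degree Q \<le> M" "\<forall>t. q (\<chi> j. if j = i then t else y $ j) = poly Q t" by blast
    show "\<exists>P. degree P \<le> max N M \<and> (\<forall>t. p (\<chi> j. if j = i then t else y $ j) + q (\<chi> j. if j = i then t else y $ j) = poly P t)"
      using P Q by (intro exI[of _ "P + Q"]) (auto intro!: degree_add_le)
  qed
next
  case (mult p q)
  from mult.IH(1) obtain N where N: "\<forall>y. \<exists>P. degree P \<le> N \<and> (\<forall>t. p (\<chi> j. if j = i then t else y $ j) = poly P t)"
    by blast
  from mult.IH(2) obtain M where M: "\<forall>y. \<exists>P. degree P \<le> M \<and> (\<forall>t. q (\<chi> j. if j = i then t else y $ j) = poly P t)"
    by blast
  show ?case
  proof (intro exI[of _ "N + M"] allI)
    fix y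
    from N obtain P where P: "degree P \<le> N" "\<forall>t. p (\<chi> j. if j = i then t else y $ j) = poly P t" by blast
    from M obtain Q where Q: "degree Q \<le> M" "\<forall>t. q (\<chi> j. if j = i then t else y $ j) = poly Q t" by blast
    have "degree (P * Q) \<le> N + M"
      using degree_mult_le[of P Q] P(1) Q(1) by linarith
    then show "\<exists>P. degree P \<le> N + M \<and> (\<forall>t. p (\<chi> j. if j = i then t else y $ j) * q (\<chi> j. if j = i then t else y $ j) = poly P t)"
      using P Q by (intro exI[of _ "P * Q"]) auto
  qed
qed

section \<open>Regular functions on affine space\<close>

text \<open>
  Take a fraction that represents \<open>f\<close> and has a denominator of least degree. At a root of the denominator,
  comparison with a fraction that is valid there shows that the numerator vanishes too, and cancelling the
  common factor contradicts minimality. So the denominator is constant.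
\<close>

lemma regular_function_on_line:
  fixes f :: "'K::{alg_closed_field,field_char_0} \<Rightarrow> 'K"
  assumes loc: "\<And>x. \<exists>P Q. poly Q x \<noteq> 0 \<and> (\<forall>y. poly Q y \<noteq> 0 \<longrightarrow> f y = poly P y / poly Q y)"
  shows "\<exists>R. \<forall>y. f y = poly R y"
proof -
  define E where "E = (\<lambda>(P, Q). Q \<noteq> 0 \<and> (\<forall>y. poly Q y \<noteq> 0 \<longrightarrow> f y = poly P y / poly Q y))"
  obtain P0 Q0 where "E (P0, Q0)"
  proof -
    from loc[of 0] obtain P Q where "poly Q 0 \<noteq> 0" "\<forall>y. poly Q y \<noteq> 0 \<longrightarrow> f y = poly P y / poly Q y"
      by blast
    then have "E (P, Q)" by (auto simp: E_def)
    then show ?thesis by (rule that)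
  qed
  then obtain P Q where PQ: "E (P, Q)" and min: "\<And>P' Q'. E (P', Q') \<Longrightarrow> degree Q \<le> degree Q'"
    using ex_has_least_nat[of E "(P0, Q0)" "\<lambda>(P, Q). degree Q"] by auto
  have "degree Q = 0"
  proof (rule ccontr)
    assume "degree Q \<noteq> 0"
    then obtain r where r: "poly Q r = 0"
      using alg_closed_imp_poly_has_root by blast
    obtain P' Q' where loc': "poly Q' r \<noteq> 0" "\<And>y. poly Q' y \<noteq> 0 \<Longrightarrow> f y = poly P' y / poly Q' y"
      using loc[of r] by blast
    have agree: "P * Q' = P' * Q"
    proof -
      have "poly ((P * Q' - P' * Q) * (Q * Q')) y = poly 0 y" for y
      proof (cases "poly Q y = 0 \<or> poly Q' y = 0")
        case False
        then show ?thesis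
        proof -
          from False have "poly P y / poly Q y = poly P' y / poly Q' y"
            using PQ loc'(2)[of y] by (simp add: E_def)
          with False show ?thesis by (simp add: frac_eq_eq)
        qed
      qed auto
      then have "(P * Q' - P' * Q) * (Q * Q') = 0"
        using poly_eq_poly_eq_iff[of "(P * Q' - P' * Q) * (Q * Q')" 0] by (simp add: fun_eq_iff)
      then show ?thesis
        using PQ loc'(1) by (auto simp: E_def)
    qed
    from agree have "poly P r * poly Q' r = poly P' r * poly Q r"
      by (metis poly_mult)
    then have "poly P r = 0" using r loc'(1) by simp
    then obtain P1 where P1: "P = [:-r, 1:] * P1" using poly_eq_0_iff_dvd by blast
    from r obtain Q1 where Q1: "Q = [:-r, 1:] * Q1" using poly_eq_0_iff_dvd by blast
    have Q1_nz: "Q1 \<noteq> 0" using PQ Q1 by (auto simp: E_def)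
    from agree have "[:-r, 1:] * (P1 * Q') = [:-r, 1:] * (P' * Q1)"
      by (simp only: P1 Q1 mult.assoc mult.left_commute[of P'])
    then have "P1 * Q' = P' * Q1"
      using mult_left_cancel[of "[:-r, 1:]" "P1 * Q'" "P' * Q1"] by simp
    then have agree1: "poly P1 r * poly Q' r = poly P' r * poly Q1 r"
      by (metis poly_mult)
    have "E (P1, Q1)"
      unfolding E_def
    proof (clarsimp simp: Q1_nz)
      fix y assume y: "poly Q1 y \<noteq> 0"
      show "f y = poly P1 y / poly Q1 y"
      proof (cases "y = r")
        case True
        moreover have "f r = poly P' r / poly Q' r" using loc' by blast
        ultimately show ?thesis using agree1 loc'(1) y by (simp add: frac_eq_eq)
      next
        case False
        then have "f y = poly P y / poly Q y" using PQ y by (auto simp: E_def Q1)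
        then have "f y = ((y - r) * poly P1 y) / ((y - r) * poly Q1 y)" by (simp add: P1 Q1 algebra_simps)
        then show ?thesis using False y by simp
      qed
    qed
    then have "degree Q \<le> degree Q1" by (rule min)
    moreover have "degree Q = Suc (degree Q1)"
      unfolding Q1 using Q1_nz by (subst degree_mult_eq) auto
    ultimately show False by simp
  qed
  then obtain c where c: "Q = [:c:]" by (rule degree_eq_zeroE)
  with PQ have "c \<noteq> 0" "\<And>y. f y = poly P y / c" by (auto simp: E_def)
  then have "\<forall>y. f y = poly (smult (1 / c) P) y" by simp
  then show ?thesis by blast
qed

text \<open>
  Lagrange interpolation at the nodes \<open>0, \<dots>, N\<close>.
\<close>

lemma lagrange_basis:
  fixes P :: "'K::field_char_0 poly"
  assumes "degree P \<le> N"
  shows "poly P t = (\<Sum>j\<le>N. poly (\<Prod>i\<in>{..N} - {j}. smult (1 / (of_nat j - of_nat i)) [:- of_nat i, 1:]) t * poly P (of_nat j))"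
proof -
  define L where "L j = (\<Prod>i\<in>{..N} - {j}. smult (1 / (of_nat j - of_nat i)) [:- of_nat i, 1::'K:])" for j :: nat
  have L: "poly (L j) (of_nat k) = (if k = j then 1 else 0)" if "j \<le> N" "k \<le> N" for j k
  proof (cases "k = j")
    case True
    have "of_nat j / (of_nat j - of_nat i) - of_nat i / (of_nat j - of_nat i) = (1 :: 'K)" if "i \<noteq> j" for i
      using that by (subst diff_divide_distrib[symmetric]) simp
    with True show ?thesis by (auto simp: L_def poly_prod intro!: prod.neutral)
  next
    case False
    then show ?thesis using that by (auto simp: L_def poly_prod intro!: prod_zero)
  qed
  have degL: "degree (L j) \<le> N" if "j \<le> N" for j
  proof -
    have "degree (L j) \<le> (\<Sum>i\<in>{..N} - {j}. degree (smult (1 / (of_nat j - of_nat i)) [:- of_nat i, 1::'K:]))"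
      unfolding L_def by (rule order.trans[OF degree_prod_sum_le]) (auto simp: o_def)
    also have "\<dots> \<le> (\<Sum>i\<in>{..N} - {j}. 1)"
      by (intro sum_mono) auto
    also have "\<dots> \<le> N" using that by simp
    finally show ?thesis .
  qed
  have "P = (\<Sum>j\<le>N. smult (poly P (of_nat j)) (L j))"
  proof (rule poly_eqI_degree[of "of_nat ` {..N}"])
    show "card (of_nat ` {..N} :: 'K set) > degree P"
      using assms by (subst card_image) (auto simp: inj_on_def)
    have "degree (\<Sum>j\<le>N. smult (poly P (of_nat j)) (L j)) \<le> N"
      by (intro degree_sum_le) (auto intro: order.trans[OF degree_smult_le] degL)
    then show "card (of_nat ` {..N} :: 'K set) > degree (\<Sum>j\<le>N. smult (poly P (of_nat j)) (L j))"
      by (subst card_image) (auto simp: inj_on_def)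
    fix x :: 'K assume "x \<in> of_nat ` {..N}"
    then obtain k where k: "k \<le> N" "x = of_nat k" by auto
    have "poly (\<Sum>j\<le>N. smult (poly P (of_nat j)) (L j)) x = (\<Sum>j\<le>N. if k = j then poly P (of_nat j) else 0)"
      unfolding poly_sum k(2) by (intro sum.cong) (auto simp: L k)
    then show "poly P x = poly (\<Sum>j\<le>N. smult (poly P (of_nat j)) (L j)) x"
      using k by simp
  qed
  then have "poly P t = poly (\<Sum>j\<le>N. smult (poly P (of_nat j)) (L j)) t" by simp
  then show ?thesis by (simp add: poly_sum L_def mult.commute)
qed

text \<open>
  The coordinates are set free one at a time. In the direction of a new coordinate the function is a
  polynomial, by \<open>regular_function_on_line\<close>. Where one fixed local denominator is not identically zero on
  the line, the degree of this polynomial is bounded by that of the numerator, so the function is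
  interpolated from finitely many slices, which are polynomial by induction. For a fixed value of the new
  coordinate, both sides of the interpolation formula are polynomial in the old ones, so the formula
  extends to the remaining lines.
\<close>

lemma regular_on_UNIV_imp_poly_fun:
  fixes f :: "'K::{alg_closed_field,field_char_0} ^ 'n::finite \<Rightarrow> 'K"
  assumes reg: "regular_on UNIV UNIV f"
  shows "f \<in> poly_fun UNIV"
proof -
  \<comment> \<open>the coordinates in \<open>I\<close> are free and taken from \<open>y\<close>, the others are frozen at \<open>z\<close>\<close>
  define ov :: "'n set \<Rightarrow> 'K ^ 'n \<Rightarrow> 'K ^ 'n \<Rightarrow> 'K ^ 'n"
    where "ov I y z = (\<chi> j. if j \<in> I then y $ j else z $ j)" for I y z
  have "\<forall>z. (\<lambda>y. f (ov I y z)) \<in> poly_fun UNIV" if "finite I" for I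
    using that
  proof induction
    case empty
    show ?case by (auto simp: ov_def intro: poly_fun.const)
  next
    case (insert i I)
    show ?case
    proof
      fix z :: "'K ^ 'n"
      define w where "w t y = (\<chi> j. if j = i then t else ov I y z $ j)" for t y
      have w_ov: "w t y = ov I y (\<chi> j. if j = i then t else z $ j)" for t y
        using insert.hyps by (auto simp: w_def ov_def vec_eq_iff)
      have poly_y: "(\<lambda>y. f (w t y)) \<in> poly_fun UNIV" for t
        unfolding w_ov using insert.IH by blast
      have poly_t: "\<exists>R. \<forall>t. f (w t y) = poly R t" for y
      proof (rule regular_function_on_line)
        fix t
        obtain p q where pq: "p \<in> poly_fun UNIV" "q \<in> poly_fun UNIV" "q (w t y) \<noteq> 0"
          "\<And>x. q x \<noteq> 0 \<Longrightarrow> f x = p x / q x"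
          using reg unfolding regular_on_def by blast
        have c: "\<exists>P. \<forall>t. w t y $ j = poly P t" for j
          by (rule exI[of _ "if j = i then [:0, 1:] else [:ov I y z $ j:]"]) (simp add: w_def)
        obtain P where P: "\<And>t. p (w t y) = poly P t" using poly_fun_curve[OF pq(1) c] by blast
        obtain Q where Q: "\<And>t. q (w t y) = poly Q t" using poly_fun_curve[OF pq(2) c] by blast
        show "\<exists>P Q. poly Q t \<noteq> 0 \<and> (\<forall>s. poly Q s \<noteq> 0 \<longrightarrow> f (w s y) = poly P s / poly Q s)"
          using pq(3,4) by (intro exI[of _ P] exI[of _ Q]) (simp flip: P Q)
      qed
      obtain p q where pq: "p \<in> poly_fun UNIV" "q \<in> poly_fun UNIV" "q z \<noteq> 0"
          "\<And>x. q x \<noteq> 0 \<Longrightarrow> f x = p x / q x"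
          using reg unfolding regular_on_def by blast
      obtain N where N: "\<And>y. \<exists>P. degree P \<le> N \<and> (\<forall>t. p (\<chi> j. if j = i then t else y $ j) = poly P t)"
        using poly_fun_degree_bound[OF pq(1), of i] by blast
      define L where "L j = (\<Prod>i\<in>{..N} - {j}. smult (1 / (of_nat j - of_nat i)) [:- of_nat i, 1::'K:])" for j :: nat
      define G where "G t y = (\<Sum>j\<le>N. poly (L j) t * f (w (of_nat j) y))" for t y
      have poly_G: "(\<lambda>y. G t y) \<in> poly_fun UNIV" for t
        unfolding G_def by (intro poly_fun_sum poly_fun.mult poly_fun.const poly_y) auto
      have q_w: "(\<lambda>y. q (w t y)) \<in> poly_fun UNIV" for t
      proof (rule poly_fun_compose[OF pq(2)])
        show "(\<lambda>y. w t y $ j) \<in> poly_fun UNIV" for j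
          by (cases "j = i"; cases "j \<in> I") (simp_all add: w_def ov_def poly_fun.const poly_fun.coord)
      qed
      \<comment> \<open>the slice of \<open>q\<close> at \<open>z $ i\<close> is not identically zero, so its zeros may be ignored below\<close>
      have zw: "q (w (z $ i) z) \<noteq> 0"
      proof -
        have "w (z $ i) z = z" by (auto simp: w_def ov_def vec_eq_iff)
        then show ?thesis using pq(3) by simp
      qed
      have eq: "f (w t y) = G t y" for t y
      proof -
        have "f (w t y) - G t y = 0"
        proof (rule poly_fun_mult_eq_0[OF _ q_w _ zw])
          show "(\<lambda>y. f (w t y) - G t y) \<in> poly_fun UNIV"
            by (intro poly_fun_diff poly_y poly_G) simp
        next
          fix y
          show "(f (w t y) - G t y) * q (w (z $ i) y) = 0"
          proof (cases "q (w (z $ i) y) = 0")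
            case False
            obtain R where R: "\<And>t. f (w t y) = poly R t" using poly_t by blast
            obtain P where P: "degree P \<le> N" "\<And>t. p (w t y) = poly P t"
              using N[of "ov I y z"] unfolding w_def by blast
            have c: "\<exists>P. \<forall>t. w t y $ j = poly P t" for j
              by (rule exI[of _ "if j = i then [:0, 1:] else [:ov I y z $ j:]"]) (simp add: w_def)
            obtain Q where Q: "\<And>t. q (w t y) = poly Q t" using poly_fun_curve[OF pq(2) c] by blast
            have "Q \<noteq> 0" using False unfolding Q by auto
            have "poly ((R * Q - P) * Q) s = poly 0 s" for s
              using pq(4)[of "w s y"] unfolding R P Q by (cases "poly Q s = 0") auto
            then have "(R * Q - P) * Q = 0"
              using poly_eq_poly_eq_iff[of "(R * Q - P) * Q" 0] by (simp add: fun_eq_iff)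
            with \<open>Q \<noteq> 0\<close> have RQ: "R * Q = P" by simp
            have "degree R \<le> N"
            proof (cases "R = 0")
              case False
              then have "degree R \<le> degree P"
                using \<open>Q \<noteq> 0\<close> by (simp flip: RQ add: degree_mult_eq)
              then show ?thesis using P(1) by simp
            qed simp
            then show ?thesis
              using lagrange_basis[OF \<open>degree R \<le> N\<close>, of t] unfolding G_def R L_def by simp
          qed simp
        qed
        then show ?thesis by simp
      qed
      have "(\<lambda>y. \<Sum>j\<le>N. poly (L j) (y $ i) * f (w (of_nat j) y)) \<in> poly_fun UNIV"
        by (intro poly_fun_sum poly_fun.mult poly_fun_poly poly_fun.coord poly_y) auto
      moreover have "ov (insert i I) y z = w (y $ i) y" for y
        using insert.hyps by (auto simp: w_def ov_def vec_eq_iff)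
      ultimately show "(\<lambda>y. f (ov (insert i I) y z)) \<in> poly_fun UNIV"
        by (simp only: eq[unfolded G_def, of "y $ i" y for y])
    qed
  qed
  from this[of UNIV] have "(\<lambda>y. f (ov UNIV y 0)) \<in> poly_fun UNIV" by simp
  moreover have "ov UNIV y 0 = y" for y by (simp add: ov_def vec_eq_iff)
  ultimately show ?thesis by simp
qed

section \<open>Automorphisms of an algebraically closed field\<close>

definition is_subfield :: "'K::field set \<Rightarrow> bool" where
  "is_subfield F \<longleftrightarrow>
     1 \<in> F \<and> (\<forall>x\<in>F. \<forall>y\<in>F. x - y \<in> F \<and> x * y \<in> F) \<and> (\<forall>x\<in>F. inverse x \<in> F)"

lemma is_subfieldD:
  assumes "is_subfield F"
  shows "0 \<in> F" "1 \<in> F" "x \<in> F \<Longrightarrow> y \<in> F \<Longrightarrow> x - y \<in> F" "x \<in> F \<Longrightarrow> y \<in> F \<Longrightarrow> x * y \<in> F"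
    "x \<in> F \<Longrightarrow> inverse x \<in> F" "x \<in> F \<Longrightarrow> - x \<in> F" "x \<in> F \<Longrightarrow> y \<in> F \<Longrightarrow> x + y \<in> F"
    "x \<in> F \<Longrightarrow> y \<in> F \<Longrightarrow> x / y \<in> F"
proof -
  show 1: "1 \<in> F" and diff: "\<And>x y. x \<in> F \<Longrightarrow> y \<in> F \<Longrightarrow> x - y \<in> F"
    and mult: "\<And>x y. x \<in> F \<Longrightarrow> y \<in> F \<Longrightarrow> x * y \<in> F" and inv: "\<And>x. x \<in> F \<Longrightarrow> inverse x \<in> F"
    using assms by (auto simp: is_subfield_def)
  show 0: "0 \<in> F" using diff[OF 1 1] by simp
  show minus: "- x \<in> F" if "x \<in> F" for x using diff[OF 0 that] by simp
  show "x + y \<in> F" if "x \<in> F" "y \<in> F" for x y using diff[OF that(1) minus[OF that(2)]] by simp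
  show "x / y \<in> F" if "x \<in> F" "y \<in> F" for x y
    using mult[OF that(1) inv[OF that(2)]] by (simp add: divide_inverse)
qed

lemma is_subfield_of_nat: "is_subfield F \<Longrightarrow> of_nat n \<in> F"
  by (induction n) (auto intro: is_subfieldD)

lemma is_subfield_ground_field: "is_subfield ground_field"
  unfolding is_subfield_def
  by (auto simp flip: to_ac_diff to_ac_mult to_ac_inverse to_ac_1)

definition algebraic_over :: "'K::field set \<Rightarrow> 'K \<Rightarrow> bool" where
  "algebraic_over F x \<longleftrightarrow> (\<exists>p. p \<noteq> 0 \<and> (\<forall>i. poly.coeff p i \<in> F) \<and> poly p x = 0)"

lemma algebraic_over_ground_field: "algebraic_over ground_field x"
proof -
  obtain p where p: "p \<noteq> 0" "poly (map_poly to_ac p) x = 0"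
    by (rule alg_closure_algebraic)
  have "map_poly to_ac p \<noteq> 0" using p(1) by (simp add: map_poly_eq_0_iff)
  then show ?thesis
    using p(2) unfolding algebraic_over_def by (intro exI[of _ "map_poly to_ac p"]) (auto simp: coeff_map_poly)
qed

definition field_aut :: "('K::field \<Rightarrow> 'K) \<Rightarrow> bool" where
  "field_aut \<sigma> \<longleftrightarrow> bij \<sigma> \<and> (\<forall>x y. \<sigma> (x + y) = \<sigma> x + \<sigma> y) \<and> (\<forall>x y. \<sigma> (x * y) = \<sigma> x * \<sigma> y)"

text \<open>
  The graph of a ring homomorphism over \<open>F\<close> from a subring of \<open>K\<close> to \<open>K\<close>. Graphs are convenient for Zorn's
  lemma, since the union of a chain is again one. Being single-valued is only required at \<open>0\<close>, which is
  enough for an additive relation.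
\<close>

definition partial_hom :: "'K::field set \<Rightarrow> ('K \<times> 'K) set \<Rightarrow> bool" where
  "partial_hom F r \<longleftrightarrow>
     (\<forall>c\<in>F. (c, c) \<in> r) \<and>
     (\<forall>x x' y y'. (x, x') \<in> r \<longrightarrow> (y, y') \<in> r \<longrightarrow> (x + y, x' + y') \<in> r \<and> (x * y, x' * y') \<in> r) \<and>
     (\<forall>y. (0, y) \<in> r \<longrightarrow> y = 0)"

text \<open>
  The polynomial \<open>p'\<close> arises from \<open>p\<close> by applying the partial homomorphism to the coefficients.
\<close>

definition coeffs_related :: "('K::field \<times> 'K) set \<Rightarrow> 'K poly \<Rightarrow> 'K poly \<Rightarrow> bool" where
  "coeffs_related r p p' \<longleftrightarrow> (\<forall>i. (poly.coeff p i, poly.coeff p' i) \<in> r)"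

context
  fixes F :: "'K::{alg_closed_field,field_char_0} set"
  assumes F: "is_subfield F" and alg: "\<And>x. algebraic_over F x"
begin

lemma partial_homD:
  assumes "partial_hom F r"
  shows "c \<in> F \<Longrightarrow> (c, c) \<in> r" "(x, x') \<in> r \<Longrightarrow> (y, y') \<in> r \<Longrightarrow> (x + y, x' + y') \<in> r"
    "(x, x') \<in> r \<Longrightarrow> (y, y') \<in> r \<Longrightarrow> (x * y, x' * y') \<in> r" "(0, y) \<in> r \<Longrightarrow> y = 0"
    "(0, 0) \<in> r" "(1, 1) \<in> r" "(x, x') \<in> r \<Longrightarrow> (- x, - x') \<in> r"
    "(x, x') \<in> r \<Longrightarrow> (y, y') \<in> r \<Longrightarrow> (x - y, x' - y') \<in> r"
proof -
  show c: "\<And>c. c \<in> F \<Longrightarrow> (c, c) \<in> r"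
    and add: "\<And>x x' y y'. (x, x') \<in> r \<Longrightarrow> (y, y') \<in> r \<Longrightarrow> (x + y, x' + y') \<in> r"
    and mult: "\<And>x x' y y'. (x, x') \<in> r \<Longrightarrow> (y, y') \<in> r \<Longrightarrow> (x * y, x' * y') \<in> r"
    and "(0, y) \<in> r \<Longrightarrow> y = 0" for y
    using assms by (auto simp: partial_hom_def)
  show "(0, 0) \<in> r" "(1, 1) \<in> r" using c is_subfieldD[OF F] by auto
  have m1: "(- 1, - 1) \<in> r" using c is_subfieldD[OF F] by auto
  show minus: "(- x, - x') \<in> r" if "(x, x') \<in> r" for x x' using mult[OF m1 that] by simp
  show "(x - y, x' - y') \<in> r" if "(x, x') \<in> r" "(y, y') \<in> r" for x x' y y'
    using add[OF that(1) minus[OF that(2)]] by simp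
qed

lemma coeffs_relatedD: "coeffs_related r p p' \<Longrightarrow> (poly.coeff p i, poly.coeff p' i) \<in> r"
  by (simp add: coeffs_related_def)

lemma coeffs_related_ops:
  assumes r: "partial_hom F r" and p: "coeffs_related r p p'"
  shows "coeffs_related r q q' \<Longrightarrow> coeffs_related r (p + q) (p' + q')"
    "coeffs_related r q q' \<Longrightarrow> coeffs_related r (p - q) (p' - q')"
    "coeffs_related r q q' \<Longrightarrow> coeffs_related r (p * q) (p' * q')"
    "(c, c') \<in> r \<Longrightarrow> coeffs_related r (smult c p) (smult c' p')"
    "coeffs_related r (monom 1 k * p) (monom 1 k * p')"
proof -
  have sum: "(\<Sum>i\<le>n. f i, \<Sum>i\<le>n. f' i) \<in> r" if "\<And>i. (f i, f' i) \<in> r" for n and f f' :: "nat \<Rightarrow> 'K"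
    using that by (induction n) (auto intro: partial_homD[OF r])
  show "coeffs_related r q q' \<Longrightarrow> coeffs_related r (p * q) (p' * q')" for q q'
    using p unfolding coeffs_related_def coeff_mult by (auto intro!: sum partial_homD[OF r])
qed (use p in \<open>auto simp: coeffs_related_def coeff_monom_mult intro: partial_homD[OF r]\<close>)

lemma coeffs_related_pCons:
  "coeffs_related r (pCons a p) (pCons b q) \<longleftrightarrow> (a, b) \<in> r \<and> coeffs_related r p q"
  by (auto simp: coeffs_related_def coeff_pCons split: nat.splits)

lemma coeffs_related_const:
  "partial_hom F r \<Longrightarrow> (a, b) \<in> r \<Longrightarrow> coeffs_related r [:a:] [:b:]"
  by (auto simp: coeffs_related_def coeff_pCons partial_homD split: nat.splits)

lemma partial_hom_poly:
  assumes r: "partial_hom F r" and xy: "(x, y) \<in> r" and "coeffs_related r q q'"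
  shows "(poly q x, poly q' y) \<in> r"
  using assms(3)
proof (induction q arbitrary: q')
  case 0
  have "poly.coeff q' i = 0" for i
    using coeffs_relatedD[OF 0, of i] partial_homD(4)[OF r] by simp
  then have "q' = 0" by (simp add: poly_eq_iff)
  then show ?case using partial_homD(5)[OF r] by simp
next
  case (pCons a q)
  obtain b q1 where q': "q' = pCons b q1" by (cases q')
  then show ?case using pCons.prems pCons.IH[of q1]
    by (auto simp: coeffs_related_pCons intro!: partial_homD[OF r] xy)
qed

lemma coeffs_related_refl:
  "partial_hom F r \<Longrightarrow> (\<And>i. poly.coeff p i \<in> F) \<Longrightarrow> coeffs_related r p p"
  by (auto simp: coeffs_related_def partial_homD)

text \<open>
  If \<open>x\<close> is not \<open>0\<close>, then it is a root of a polynomial over \<open>F\<close> with nonzero constant term. Evaluating this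
  polynomial at the related elements \<open>x\<close> and \<open>0\<close> shows that \<open>0\<close> is related to the constant term,
  which a homomorphism excludes.
\<close>

lemma partial_hom_inj:
  assumes r: "partial_hom F r" and x0: "(x, 0) \<in> r"
  shows "x = 0"
proof (rule ccontr)
  assume x: "x \<noteq> 0"
  define E where "E p \<longleftrightarrow> p \<noteq> 0 \<and> (\<forall>i. poly.coeff p i \<in> F) \<and> poly p x = 0" for p
  obtain p0 where "E p0" using alg[of x] by (auto simp: algebraic_over_def E_def)
  then obtain p where p: "E p" and min: "\<And>q. E q \<Longrightarrow> degree p \<le> degree q"
    using ex_has_least_nat[of E p0 degree] by blast
  have "(poly p x, poly p 0) \<in> r"
    using p by (intro partial_hom_poly[OF r x0] coeffs_related_refl[OF r]) (auto simp: E_def)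
  then have "poly p 0 = 0" using p partial_homD(4)[OF r] by (simp add: E_def)
  then obtain q where q: "p = pCons 0 q"
    by (metis pCons_cases poly_0_coeff_0 coeff_pCons_0)
  have "poly.coeff q i \<in> F" for i
    using p q unfolding E_def by (metis coeff_pCons_Suc)
  then have "E q" using p x by (auto simp: E_def q)
  then show False using min[of q] by (auto simp: q E_def split: if_splits)
qed

text \<open>
  Adjoining a root: \<open>x\<close> is sent to \<open>y\<close>. This is well defined because pseudo-division by \<open>p\<close>, which has least
  degree among the polynomials that annihilate \<open>x\<close>, shows that the image of every such polynomial
  annihilates \<open>y\<close>.
\<close>

lemma partial_hom_adjoin:
  assumes r: "partial_hom F r"
    and p: "p \<noteq> 0" "coeffs_related r p p'" "poly p x = 0"
    and min: "\<And>q q'. q \<noteq> 0 \<Longrightarrow> coeffs_related r q q' \<Longrightarrow> poly q x = 0 \<Longrightarrow> degree p \<le> degree q"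
    and y: "poly p' y = 0"
  shows "\<exists>r'. partial_hom F r' \<and> r \<subseteq> r' \<and> (x, y) \<in> r'"
proof -
  define r' where "r' = {(poly q x, poly q' y) | q q'. coeffs_related r q q'}"
  define c c' where "c = poly.coeff p (degree p)" and "c' = poly.coeff p' (degree p)"
  have cc': "(c, c') \<in> r" unfolding c_def c'_def by (rule coeffs_relatedD[OF p(2)])
  have "c' \<noteq> 0" using cc' partial_hom_inj[OF r, of c] p(1) by (auto simp: c_def)
  have zero: "poly q' y = 0" if "coeffs_related r q q'" "poly q x = 0" for q q'
    using that
  proof (induction "degree q" arbitrary: q q' rule: less_induct)
    case less
    have zero_case: "poly s' y = 0" if "coeffs_related r s s'" "s = 0" for s s'
    proof -
      have "poly.coeff s' i = 0" for i
        using coeffs_relatedD[OF that(1), of i] partial_homD(4)[OF r] that(2) by simp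
      then have "s' = 0" by (simp add: poly_eq_iff)
      then show ?thesis by simp
    qed
    show ?case
    proof (cases "q = 0")
      case True
      then show ?thesis using zero_case less.prems by blast
    next
      case False
      define a a' where "a = poly.coeff q (degree q)" and "a' = poly.coeff q' (degree q)"
      have aa': "(a, a') \<in> r" unfolding a_def a'_def by (rule coeffs_relatedD[OF less.prems(1)])
      define k where "k = degree q - degree p"
      have deg: "degree q = k + degree p"
        using min[OF False less.prems] by (simp add: k_def)
      \<comment> \<open>pseudo-division step: the leading terms of \<open>q\<close> and of its counterpart \<open>q'\<close> cancel simultaneously\<close>
      define s where "s = smult c q - smult a (monom 1 k * p)"
      define s' where "s' = smult c' q' - smult a' (monom 1 k * p')"
      have ss': "coeffs_related r s s'"
        unfolding s_def s'_def
        using coeffs_related_ops(2,4,5)[OF r] less.prems(1) p(2) cc' aa' by blast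
      have "poly s' y = 0"
      proof (cases "s = 0")
        case True
        then show ?thesis using zero_case ss' by blast
      next
        case False
        have "degree (monom 1 k * p) \<le> degree q"
          using degree_mult_le[of "monom 1 k" p] by (simp add: deg degree_monom_eq)
        then have "degree s \<le> degree q"
          unfolding s_def by (intro degree_diff_le) (auto intro: order.trans[OF degree_smult_le])
        moreover have "poly.coeff s (degree q) = 0"
          by (simp add: s_def a_def c_def coeff_monom_mult deg)
        ultimately have "degree s < degree q"
          using False eq_zero_or_degree_less by blast
        moreover have "poly s x = 0"
          using less.prems(2) p(3) by (simp add: s_def)
        ultimately show ?thesis using less.hyps ss' by blast
      qed
      then have "c' * poly q' y = 0" using y by (simp add: s'_def)
      then show ?thesis using \<open>c' \<noteq> 0\<close> by simp
    qed
  qed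
  have "partial_hom F r'"
    unfolding partial_hom_def
  proof (intro conjI ballI allI impI)
    show "(c, c) \<in> r'" if "c \<in> F" for c
      using coeffs_related_const[OF r partial_homD(1)[OF r that]] unfolding r'_def by force
  next
    fix u u' v v' assume "(u, u') \<in> r'" "(v, v') \<in> r'"
    then obtain f f' g g' where fg: "coeffs_related r f f'" "u = poly f x" "u' = poly f' y"
      "coeffs_related r g g'" "v = poly g x" "v' = poly g' y"
      unfolding r'_def by blast
    have "(poly (f + g) x, poly (f' + g') y) \<in> r'" "(poly (f * g) x, poly (f' * g') y) \<in> r'"
      using coeffs_related_ops[OF r fg(1)] fg(4) unfolding r'_def by blast+
    then show "(u + v, u' + v') \<in> r'" "(u * v, u' * v') \<in> r'" by (simp_all add: fg)
  next
    fix v assume "(0, v) \<in> r'"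
    then show "v = 0" using zero unfolding r'_def by auto
  qed
  moreover have "r \<subseteq> r'"
  proof
    fix z assume "z \<in> r"
    then show "z \<in> r'"
      using coeffs_related_const[OF r, of "fst z" "snd z"] unfolding r'_def
      by (intro CollectI exI[of _ "[:fst z:]"] exI[of _ "[:snd z:]"]) auto
  qed
  moreover have "(x, y) \<in> r'"
  proof -
    have "coeffs_related r [:0, 1:] [:0, 1:]"
      by (rule coeffs_related_refl[OF r])
        (auto simp: coeff_pCons is_subfieldD[OF F] split: nat.splits)
    then show ?thesis
      unfolding r'_def by (intro CollectI exI[of _ "[:0, 1:]"]) auto
  qed
  ultimately show ?thesis by blast
qed

text \<open>
  A maximal extension is total, since otherwise one could adjoin a root. It is surjective because it maps
  the finite set of roots of any polynomial over \<open>F\<close> injectively into itself.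
\<close>

lemma partial_hom_extends_to_aut:
  assumes r0: "partial_hom F r0"
  shows "\<exists>\<sigma>. field_aut \<sigma> \<and> (\<forall>c\<in>F. \<sigma> c = c) \<and> (\<forall>(x, y)\<in>r0. \<sigma> x = y)"
proof -
  define A where "A = {r. partial_hom F r \<and> r0 \<subseteq> r}"
  have "\<exists>m\<in>A. \<forall>r\<in>A. m \<subseteq> r \<longrightarrow> r = m"
  proof (rule subset_Zorn_nonempty)
    show "A \<noteq> {}" using r0 by (auto simp: A_def)
    fix C assume C: "C \<noteq> {}" "subset.chain A C"
    have mem: "partial_hom F r" "r0 \<subseteq> r" if "r \<in> C" for r
      using C(2) that by (auto simp: subset.chain_def A_def)
    have "partial_hom F ((\<Union>C))"
      unfolding partial_hom_def
    proof (intro conjI ballI allI impI)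
      show "(c, c) \<in> (\<Union>C)" if "c \<in> F" for c
        using C(1) mem(1) partial_homD(1) that by blast
    next
      fix x x' y y' assume xy: "(x, x') \<in> (\<Union>C)" "(y, y') \<in> (\<Union>C)"
      then obtain r s where rs: "r \<in> C" "(x, x') \<in> r" "s \<in> C" "(y, y') \<in> s" by blast
      then have "r \<subseteq> s \<or> s \<subseteq> r" using C(2) by (auto simp: subset.chain_def)
      then obtain t where "t \<in> C" "(x, x') \<in> t" "(y, y') \<in> t" using rs by blast
      then show "(x + y, x' + y') \<in> (\<Union>C)" "(x * y, x' * y') \<in> (\<Union>C)"
        using partial_homD(2,3)[OF mem(1)] by blast+
    next
      fix y assume "(0, y) \<in> (\<Union>C)"
      then show "y = 0" using partial_homD(4)[OF mem(1)] by blast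
    qed
    then show "(\<Union>C) \<in> A" using C(1) mem(2) by (auto simp: A_def)
  qed
  then obtain M where M_A: "M \<in> A" and M_max: "\<And>r. r \<in> A \<Longrightarrow> M \<subseteq> r \<Longrightarrow> r = M" by blast
  from M_A have M: "partial_hom F M" "r0 \<subseteq> M" by (simp_all add: A_def)
  have max: "r = M" if "partial_hom F r" "M \<subseteq> r" for r
    using M_max[OF _ that(2)] that M(2) by (simp add: A_def)
  have total: "\<exists>y. (x, y) \<in> M" for x
  proof -
    define E where "E = (\<lambda>(p, p'). p \<noteq> 0 \<and> coeffs_related M p p' \<and> poly p x = 0)"
    obtain p0 where "p0 \<noteq> 0" "\<forall>i. poly.coeff p0 i \<in> F" "poly p0 x = 0"
      using alg[of x] by (auto simp: algebraic_over_def)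
    then have "E (p0, p0)" by (auto simp: E_def intro: coeffs_related_refl[OF M(1)])
    then obtain p p' where p: "E (p, p')" and min: "\<And>q q'. E (q, q') \<Longrightarrow> degree p \<le> degree q"
      using ex_has_least_nat[of E "(p0, p0)" "\<lambda>(p, p'). degree p"] by auto
    have "degree p > 0"
    proof (rule ccontr)
      assume "\<not> degree p > 0"
      then obtain a where "p = [:a:]" by (auto elim: degree_eq_zeroE)
      then show False using p by (auto simp: E_def)
    qed
    moreover have "poly.coeff p' (degree p) \<noteq> 0"
    proof
      assume "poly.coeff p' (degree p) = 0"
      then have "(poly.coeff p (degree p), 0) \<in> M"
        using p coeffs_relatedD[of M p p' "degree p"] by (simp add: E_def)
      from partial_hom_inj[OF M(1) this] show False using p by (simp add: E_def)
    qed
    ultimately have "degree p' > 0" using le_degree[of p' "degree p"] by linarith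
    then obtain y where y: "poly p' y = 0" using alg_closed_imp_poly_has_root by blast
    have "\<exists>r'. partial_hom F r' \<and> M \<subseteq> r' \<and> (x, y) \<in> r'"
      by (rule partial_hom_adjoin[OF M(1) _ _ _ _ y]) (use p min in \<open>auto simp: E_def\<close>)
    then show ?thesis using max by blast
  qed
  have unique: "y = z" if "(x, y) \<in> M" "(x, z) \<in> M" for x y z
    using partial_homD(4)[OF M(1), of "y - z"] partial_homD(8)[OF M(1) that] by (metis diff_self eq_iff_diff_eq_0)
  define \<sigma> where "\<sigma> x = (THE y. (x, y) \<in> M)" for x
  have \<sigma>: "(x, y) \<in> M \<longleftrightarrow> \<sigma> x = y" for x y
  proof -
    obtain z where z: "(x, z) \<in> M" using total by blast
    then have "\<sigma> x = z" unfolding \<sigma>_def using unique by (intro the_equality) blast+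
    then show ?thesis using z unique by blast
  qed
  have add: "\<sigma> (x + y) = \<sigma> x + \<sigma> y" and mult: "\<sigma> (x * y) = \<sigma> x * \<sigma> y" for x y
    using partial_homD(2,3)[OF M(1) iffD2[OF \<sigma> refl] iffD2[OF \<sigma> refl], of x y] by (simp_all only: \<sigma>)
  have fix_F: "\<sigma> c = c" if "c \<in> F" for c
    using partial_homD(1)[OF M(1) that] by (simp only: \<sigma>)
  have inj: "inj \<sigma>"
  proof (rule injI)
    fix x y assume eq: "\<sigma> x = \<sigma> y"
    have "(x, \<sigma> x) \<in> M" "(y, \<sigma> y) \<in> M" by (simp_all add: \<sigma>)
    from partial_homD(8)[OF M(1) this] have "(x - y, 0) \<in> M" by (simp add: eq)
    from partial_hom_inj[OF M(1) this] show "x = y" by simp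
  qed
  have "surj \<sigma>"
    unfolding surj_def
  proof
    fix y
    obtain p where p: "p \<noteq> 0" "\<And>i. poly.coeff p i \<in> F" "poly p y = 0"
      using alg[of y] by (auto simp: algebraic_over_def)
    define R where "R = {x. poly p x = 0}"
    have rel: "(poly p x, poly p (\<sigma> x)) \<in> M" for x
      by (intro partial_hom_poly[OF M(1) iffD2[OF \<sigma> refl]] coeffs_related_refl[OF M(1)] p)
    have "poly p (\<sigma> x) = 0" if "poly p x = 0" for x
      using rel[of x] that partial_homD(4)[OF M(1)] by simp
    then have "\<sigma> ` R \<subseteq> R" by (auto simp: R_def)
    moreover have "finite R" unfolding R_def by (rule poly_roots_finite[OF p(1)])
    ultimately have "\<sigma> ` R = R" by (intro endo_inj_surj inj_on_subset[OF inj subset_UNIV])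
    then show "\<exists>x. y = \<sigma> x" using p(3) unfolding R_def by blast
  qed
  then have "field_aut \<sigma>" unfolding field_aut_def bij_def using inj add mult by blast
  moreover have "\<sigma> x = y" if "(x, y) \<in> r0" for x y
    using M(2) that unfolding \<sigma>[symmetric] by blast
  then have "\<forall>(x, y)\<in>r0. \<sigma> x = y" by blast
  ultimately show ?thesis using fix_F by blast
qed

text \<open>
  In characteristic 0 the minimal polynomial of \<open>x\<close> is separable, so an element outside \<open>F\<close> has a conjugate
  \<open>y\<close> other than \<open>x\<close>, and \<open>x \<mapsto> y\<close> extends to an automorphism.
\<close>

theorem ex_field_aut_moving:
  assumes x: "x \<notin> F"
  shows "\<exists>\<sigma>. field_aut \<sigma> \<and> (\<forall>c\<in>F. \<sigma> c = c) \<and> \<sigma> x \<noteq> x"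
proof -
  define r where "r = {(c, c) | c. c \<in> F}"
  have r: "partial_hom F r"
    using is_subfieldD[OF F] by (auto simp: partial_hom_def r_def)
  define E where "E p \<longleftrightarrow> p \<noteq> 0 \<and> (\<forall>i. poly.coeff p i \<in> F) \<and> poly p x = 0" for p
  obtain p0 where "E p0" using alg[of x] by (auto simp: algebraic_over_def E_def)
  then obtain p where p: "E p" and min: "\<And>q. E q \<Longrightarrow> degree p \<le> degree q"
    using ex_has_least_nat[of E p0 degree] by blast
  from p have "poly p x = 0" by (simp add: E_def)
  then obtain s where s: "p = [:- x, 1:] * s" using poly_eq_0_iff_dvd by blast
  have "s \<noteq> 0" using p by (auto simp: E_def s)
  have "degree s > 0"
  proof (rule ccontr)
    assume "\<not> degree s > 0"
    then obtain a where a: "s = [:a:]" by (auto elim: degree_eq_zeroE)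
    then have "a \<noteq> 0" using \<open>s \<noteq> 0\<close> by auto
    have "poly.coeff p 0 \<in> F" "poly.coeff p 1 \<in> F" using p by (auto simp: E_def)
    then have "- (x * a) \<in> F" "a \<in> F" by (simp_all add: s a mult.commute)
    then have "x * a / a \<in> F" using is_subfieldD[OF F] by (metis add.inverse_inverse)
    then show False using x \<open>a \<noteq> 0\<close> by simp
  qed
  then obtain y where y: "poly s y = 0" using alg_closed_imp_poly_has_root by blast
  have "y \<noteq> x"
  proof
    assume "y = x"
    then have "poly (pderiv p) x = 0" using y unfolding s pderiv_mult by simp
    moreover have deg: "degree p > 0"
      unfolding s using \<open>s \<noteq> 0\<close> by (subst degree_mult_eq) auto
    then have "pderiv p \<noteq> 0" by (simp add: pderiv_eq_0_iff)
    moreover have "poly.coeff (pderiv p) i \<in> F" for i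
      using p is_subfield_of_nat[OF F, of "Suc i"] is_subfieldD[OF F] unfolding E_def coeff_pderiv by blast
    ultimately have "E (pderiv p)" by (auto simp: E_def)
    then show False using min[of "pderiv p"] deg by (simp add: degree_pderiv)
  qed
  have "\<exists>r'. partial_hom F r' \<and> r \<subseteq> r' \<and> (x, y) \<in> r'"
  proof (rule partial_hom_adjoin[OF r, of p p])
    show "coeffs_related r p p" using p by (intro coeffs_related_refl[OF r]) (auto simp: E_def)
    show "degree p \<le> degree q" if "q \<noteq> 0" "coeffs_related r q q'" "poly q x = 0" for q q'
      using that by (intro min) (auto simp: E_def coeffs_related_def r_def)
  qed (use p y in \<open>auto simp: E_def s\<close>)
  then obtain r' where r': "partial_hom F r'" "(x, y) \<in> r'" by blast
  from partial_hom_extends_to_aut[OF r'(1)] obtain \<sigma> where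
    \<sigma>: "field_aut \<sigma>" "\<forall>c\<in>F. \<sigma> c = c" "\<forall>(x, y)\<in>r'. \<sigma> x = y" by blast
  have "\<sigma> x = y" using bspec[OF \<sigma>(3) r'(2)] by simp
  then show ?thesis using \<sigma>(1,2) \<open>y \<noteq> x\<close> by blast
qed

end

section \<open>Galois descent\<close>

lemma field_autD:
  assumes "field_aut \<sigma>"
  shows "\<sigma> (x + y) = \<sigma> x + \<sigma> y" "\<sigma> (x * y) = \<sigma> x * \<sigma> y" "\<sigma> 0 = 0" "\<sigma> 1 = 1"
    "\<sigma> (- x) = - \<sigma> x" "\<sigma> (x - y) = \<sigma> x - \<sigma> y" "\<sigma> (inverse x) = inverse (\<sigma> x)"
    "\<sigma> (x / y) = \<sigma> x / \<sigma> y" "\<sigma> x = \<sigma> y \<longleftrightarrow> x = y" "\<sigma> x = 0 \<longleftrightarrow> x = 0"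
    "\<sigma> (x ^ k) = \<sigma> x ^ k" "\<sigma> (inv_into UNIV \<sigma> x) = x" "inv_into UNIV \<sigma> (\<sigma> x) = x"
proof -
  have bij: "bij \<sigma>" using assms by (simp add: field_aut_def)
  show add: "\<sigma> (x + y) = \<sigma> x + \<sigma> y" and mult: "\<sigma> (x * y) = \<sigma> x * \<sigma> y" for x y
    using assms by (auto simp: field_aut_def)
  show eq: "\<sigma> x = \<sigma> y \<longleftrightarrow> x = y" for x y using bij by (metis bij_pointE)
  show zero: "\<sigma> 0 = 0" using add[of 0 0] unfolding add_0_left by (rule iffD1[OF add_cancel_right_right])
  show zero_iff: "\<sigma> x = 0 \<longleftrightarrow> x = 0" for x using eq[of x 0] zero by simp
  show one: "\<sigma> 1 = 1" using mult[of 1 1] zero_iff[of 1] by simp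
  show minus: "\<sigma> (- x) = - \<sigma> x" for x using add[of x "- x"] zero by (simp add: add_eq_0_iff)
  show "\<sigma> (x - y) = \<sigma> x - \<sigma> y" using add[of x "- y"] minus[of y] by simp
  show inv: "\<sigma> (inverse x) = inverse (\<sigma> x)" for x
  proof (cases "x = 0")
    case False
    then have "\<sigma> x * \<sigma> (inverse x) = 1" using mult[of x "inverse x"] one by simp
    then show ?thesis by (metis inverse_unique)
  qed (simp add: zero)
  show "\<sigma> (x / y) = \<sigma> x / \<sigma> y" by (simp add: divide_inverse mult inv)
  show "\<sigma> (x ^ k) = \<sigma> x ^ k" by (induction k) (auto simp: one mult)
  show "\<sigma> (inv_into UNIV \<sigma> x) = x" "inv_into UNIV \<sigma> (\<sigma> x) = x"
    using bij by (simp_all add: bij_is_surj surj_f_inv_f bij_is_inj)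
qed

lemma field_aut_sum: "field_aut \<sigma> \<Longrightarrow> \<sigma> (\<Sum>i\<in>I. f i) = (\<Sum>i\<in>I. \<sigma> (f i))"
  by (induction I rule: infinite_finite_induct) (auto simp: field_autD)

lemma field_aut_inv: "field_aut \<sigma> \<Longrightarrow> field_aut (inv_into UNIV \<sigma>)"
proof -
  assume \<sigma>: "field_aut \<sigma>"
  have "inv_into UNIV \<sigma> (x + y) = inv_into UNIV \<sigma> x + inv_into UNIV \<sigma> y" "inv_into UNIV \<sigma> (x * y) = inv_into UNIV \<sigma> x * inv_into UNIV \<sigma> y" for x y
    by (metis field_autD(1,12,13)[OF \<sigma>]) (metis field_autD(2,12,13)[OF \<sigma>])
  then show ?thesis using \<sigma> by (auto simp: field_aut_def bij_imp_bij_inv)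
qed

lemma field_aut_comp: "field_aut \<sigma> \<Longrightarrow> field_aut \<tau> \<Longrightarrow> field_aut (\<sigma> \<circ> \<tau>)"
  by (auto simp: field_aut_def bij_comp)

definition aut_group :: "('K::field \<Rightarrow> 'K) set \<Rightarrow> bool" where
  "aut_group G \<longleftrightarrow> id \<in> G \<and> (\<forall>\<sigma>\<in>G. field_aut \<sigma> \<and> inv_into UNIV \<sigma> \<in> G) \<and> (\<forall>\<sigma>\<in>G. \<forall>\<tau>\<in>G. \<sigma> \<circ> \<tau> \<in> G)"

lemma aut_groupD:
  assumes "aut_group G"
  shows "id \<in> G" "\<sigma> \<in> G \<Longrightarrow> field_aut \<sigma>" "\<sigma> \<in> G \<Longrightarrow> inv_into UNIV \<sigma> \<in> G" "\<sigma> \<in> G \<Longrightarrow> \<tau> \<in> G \<Longrightarrow> \<sigma> \<circ> \<tau> \<in> G"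
  using assms by (auto simp: aut_group_def)

definition fixed_field :: "('K::field \<Rightarrow> 'K) set \<Rightarrow> 'K set" where
  "fixed_field G = {x. \<forall>\<sigma>\<in>G. \<sigma> x = x}"

lemma fixed_fieldD: "x \<in> fixed_field G \<Longrightarrow> \<sigma> \<in> G \<Longrightarrow> \<sigma> x = x"
  by (simp add: fixed_field_def)

lemma is_subfield_fixed_field: "aut_group G \<Longrightarrow> is_subfield (fixed_field G)"
  by (auto simp: is_subfield_def fixed_field_def aut_groupD(2) field_autD(2,4,6,7))

text \<open>
  Artin's argument. Scale one of the \<open>c i\<close> to \<open>1\<close>. Applying an automorphism to the relations and
  subtracting gives relations with this term removed; if they are all trivial, then every \<open>c i\<close> is in the
  fixed field, and the relation for the identity is the desired linear dependence.
\<close>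

lemma artin_independence:
  assumes G: "aut_group G" and "finite I"
    and "\<And>\<sigma>. \<sigma> \<in> G \<Longrightarrow> (\<Sum>i\<in>I. \<sigma> (e i) * c i) = 0" and "j \<in> I" "c j \<noteq> 0"
  shows "\<exists>l. (\<forall>i\<in>I. l i \<in> fixed_field G) \<and> (\<Sum>i\<in>I. l i * e i) = 0 \<and> (\<exists>i\<in>I. l i \<noteq> 0)"
  using assms(2-)
proof (induction I arbitrary: c j rule: finite_induct)
  case (insert k I)
  note F = is_subfieldD[OF is_subfield_fixed_field[OF G]]
  have ext: ?case if l: "\<forall>i\<in>I. l i \<in> fixed_field G" "(\<Sum>i\<in>I. l i * e i) = 0" "\<exists>i\<in>I. l i \<noteq> 0" for l
  proof -
    have "(\<Sum>i\<in>I. (l(k := 0)) i * e i) = (\<Sum>i\<in>I. l i * e i)"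
      using insert.hyps by (intro sum.cong) auto
    then show ?thesis
      using l insert.hyps F(1) by (intro exI[of _ "l(k := 0)"]) auto
  qed
  show ?case
  proof (cases "c k = 0")
    case True
    then have "(\<Sum>i\<in>I. \<sigma> (e i) * c i) = 0" if "\<sigma> \<in> G" for \<sigma>
      using insert.prems(1)[OF that] insert.hyps by simp
    moreover have "j \<in> I" using insert.prems True by auto
    ultimately obtain l where "\<forall>i\<in>I. l i \<in> fixed_field G" "(\<Sum>i\<in>I. l i * e i) = 0" "\<exists>i\<in>I. l i \<noteq> 0"
      using insert.IH[of c j] insert.prems(3) by blast
    then show ?thesis by (rule ext)
  next
    case False
    define d where "d i = c i / c k" for i
    have d: "\<sigma> (e k) + (\<Sum>i\<in>I. \<sigma> (e i) * d i) = 0" if "\<sigma> \<in> G" for \<sigma>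
    proof -
      have "0 = (\<Sum>i\<in>insert k I. \<sigma> (e i) * c i) / c k" using insert.prems(1)[OF that] by simp
      also have "\<dots> = (\<Sum>i\<in>insert k I. \<sigma> (e i) * d i)"
        unfolding d_def sum_divide_distrib by (intro sum.cong) auto
      also have "\<dots> = \<sigma> (e k) + (\<Sum>i\<in>I. \<sigma> (e i) * d i)"
        using insert.hyps False by (simp add: d_def)
      finally show ?thesis by simp
    qed
    show ?thesis
    proof (cases "\<exists>\<tau>\<in>G. \<exists>i\<in>I. \<tau> (d i) \<noteq> d i")
      case True
      then obtain \<tau> i where \<tau>: "\<tau> \<in> G" "i \<in> I" "\<tau> (d i) \<noteq> d i" by blast
      note \<tau>_aut = field_autD[OF aut_groupD(2)[OF G \<tau>(1)]]
      have "(\<Sum>i\<in>I. \<sigma> (e i) * (\<tau> (d i) - d i)) = 0" if "\<sigma> \<in> G" for \<sigma>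
      proof -
        have "inv_into UNIV \<tau> \<circ> \<sigma> \<in> G" using G \<tau>(1) that by (auto intro: aut_groupD)
        from d[OF this] have "\<tau> (inv_into UNIV \<tau> (\<sigma> (e k)) + (\<Sum>i\<in>I. inv_into UNIV \<tau> (\<sigma> (e i)) * d i)) = 0"
          by (simp add: \<tau>_aut)
        then have "\<sigma> (e k) + (\<Sum>i\<in>I. \<sigma> (e i) * \<tau> (d i)) = 0"
          by (simp only: \<tau>_aut field_aut_sum[OF aut_groupD(2)[OF G \<tau>(1)]])
        then have "(\<Sum>i\<in>I. \<sigma> (e i) * \<tau> (d i)) - (\<Sum>i\<in>I. \<sigma> (e i) * d i) = 0"
          using d[OF that] by (metis add_left_imp_eq diff_self)
        then show ?thesis by (simp add: right_diff_distrib sum_subtractf)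
      qed
      moreover have "\<tau> (d i) - d i \<noteq> 0" using \<tau>(3) by simp
      ultimately obtain l where "\<forall>i\<in>I. l i \<in> fixed_field G" "(\<Sum>i\<in>I. l i * e i) = 0" "\<exists>i\<in>I. l i \<noteq> 0"
        using insert.IH[of "\<lambda>i. \<tau> (d i) - d i" i] \<tau>(2) by blast
      then show ?thesis by (rule ext)
    next
      case all_fixed: False
      have "d k = 1" using False by (simp add: d_def)
      have "e k + (\<Sum>i\<in>I. d i * e i) = 0" using d[OF aut_groupD(1)[OF G]] by (simp add: mult.commute)
      moreover have "d i \<in> fixed_field G" if "i \<in> insert k I" for i
        using that all_fixed F(2) \<open>d k = 1\<close> by (cases "i = k") (auto simp: fixed_field_def)
      ultimately show ?thesis
        using insert.hyps \<open>d k = 1\<close> by (intro exI[of _ d]) auto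
    qed
  qed
qed simp

text \<open>
  The set \<open>Q\<close> should be thought of as a space of equations over the fixed field, and \<open>Y\<close> as a stable set of
  points. If the \<open>e i\<close> are independent over the fixed field, then every automorphism may be applied to them
  in the relation at a point of \<open>Y\<close>, so each \<open>T i\<close> vanishes on \<open>Y\<close> by \<open>artin_independence\<close>. If they are
  dependent, then one of them can be eliminated.
\<close>

lemma linear_descent:
  fixes T :: "'i \<Rightarrow> 'b \<Rightarrow> 'K::field"
  assumes G: "aut_group G" and "finite I"
    and add: "\<And>S S'. S \<in> Q \<Longrightarrow> S' \<in> Q \<Longrightarrow> (\<lambda>y. S y + S' y) \<in> Q"
    and scale: "\<And>c S. c \<in> fixed_field G \<Longrightarrow> S \<in> Q \<Longrightarrow> (\<lambda>y. c * S y) \<in> Q"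
    and act: "\<And>\<sigma> y. \<sigma> \<in> G \<Longrightarrow> y \<in> Y \<Longrightarrow> act \<sigma> y \<in> Y"
    and equiv: "\<And>\<sigma> y S. \<sigma> \<in> G \<Longrightarrow> y \<in> Y \<Longrightarrow> S \<in> Q \<Longrightarrow> S (act \<sigma> y) = \<sigma> (S y)"
    and "\<And>i. i \<in> I \<Longrightarrow> T i \<in> Q" "\<And>y. y \<in> Y \<Longrightarrow> (\<Sum>i\<in>I. e i * T i y) = 0" "(\<Sum>i\<in>I. e i * T i b) \<noteq> 0"
  shows "\<exists>S\<in>Q. (\<forall>y\<in>Y. S y = 0) \<and> S b \<noteq> 0"
  using assms(2,7-)
proof (induction "card I" arbitrary: I T rule: less_induct)
  case less
  note F = is_subfieldD[OF is_subfield_fixed_field[OF G]]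
  show ?case
  proof (cases "\<forall>i\<in>I. \<forall>y\<in>Y. T i y = 0")
    case True
    have "\<exists>i\<in>I. e i * T i b \<noteq> 0"
      using less.prems(4) sum.neutral[of I "\<lambda>i. e i * T i b"] by blast
    then obtain i where "i \<in> I" "T i b \<noteq> 0" by auto
    then show ?thesis using True less.prems(2) by blast
  next
    case False
    then obtain j y where j: "j \<in> I" "y \<in> Y" "T j y \<noteq> 0" by blast
    have rel: "(\<Sum>i\<in>I. \<sigma> (e i) * T i y) = 0" if \<sigma>: "\<sigma> \<in> G" for \<sigma>
    proof -
      note \<sigma>_aut = field_autD[OF aut_groupD(2)[OF G \<sigma>]]
      have "0 = \<sigma> (\<Sum>i\<in>I. e i * T i (act (inv_into UNIV \<sigma>) y))"
        using less.prems(3)[OF act[OF aut_groupD(3)[OF G \<sigma>] j(2)]] by (simp add: \<sigma>_aut)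
      also have "\<dots> = (\<Sum>i\<in>I. \<sigma> (e i * T i (act (inv_into UNIV \<sigma>) y)))"
        by (rule field_aut_sum[OF aut_groupD(2)[OF G \<sigma>]])
      also have "\<dots> = (\<Sum>i\<in>I. \<sigma> (e i) * T i y)"
        by (intro sum.cong refl)
          (simp only: equiv[OF aut_groupD(3)[OF G \<sigma>] j(2) less.prems(2)] \<sigma>_aut)
      finally show ?thesis by simp
    qed
    from artin_independence[where e = e and c = "\<lambda>i. T i y", OF G less.prems(1) rel j(1,3)] obtain l k where
      l: "\<And>i. i \<in> I \<Longrightarrow> l i \<in> fixed_field G" "(\<Sum>i\<in>I. l i * e i) = 0" "k \<in> I" "l k \<noteq> 0" by blast
    define T' where "T' i y = T i y + (- l i / l k) * T k y" for i y
    have T'_sum: "(\<Sum>i\<in>I - {k}. e i * T' i y) = (\<Sum>i\<in>I. e i * T i y)" for y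
    proof -
      have "(\<Sum>i\<in>I - {k}. e i * T' i y) = (\<Sum>i\<in>I. e i * T' i y)"
      proof -
        have "T' k y = 0" using l(4) by (simp add: T'_def)
        then show ?thesis
          using sum.remove[OF less.prems(1) l(3), of "\<lambda>i. e i * T' i y"] by simp
      qed
      also have "\<dots> = (\<Sum>i\<in>I. e i * T i y - l i * e i * (T k y / l k))"
        unfolding T'_def by (intro sum.cong refl) (simp add: algebra_simps)
      also have "\<dots> = (\<Sum>i\<in>I. e i * T i y) - (\<Sum>i\<in>I. l i * e i) * (T k y / l k)"
        unfolding sum_distrib_right sum_subtractf ..
      finally show ?thesis by (simp add: l(2))
    qed
    show ?thesis
    proof (rule less.hyps[of "I - {k}" T'])
      show "card (I - {k}) < card I" by (rule card_Diff1_less[OF less.prems(1) l(3)])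
      show "T' i \<in> Q" if "i \<in> I - {k}" for i
      proof -
        have "i \<in> I" using that by simp
        then have "- l i / l k \<in> fixed_field G" by (intro F(8) F(6) l(1,3))
        then show ?thesis unfolding T'_def by (intro add scale less.prems(2) \<open>i \<in> I\<close> l(3))
      qed
    qed (use less.prems in \<open>simp_all add: T'_sum\<close>)
  qed
qed

text \<open>
  The linear span, generated one term at a time so that linear maps on it are treated by induction.
\<close>

inductive_set lin_span :: "('b \<Rightarrow> 'K::field) set \<Rightarrow> ('b \<Rightarrow> 'K) set" for Q where
  zero: "(\<lambda>_. 0) \<in> lin_span Q"
| step: "T \<in> Q \<Longrightarrow> S \<in> lin_span Q \<Longrightarrow> (\<lambda>y. c * T y + S y) \<in> lin_span Q"

lemma lin_span_sum:
  "S \<in> lin_span Q \<Longrightarrow> \<exists>(n::nat) e T. (\<forall>i<n. T i \<in> Q) \<and> (\<forall>y. S y = (\<Sum>i<n. e i * T i y))"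
proof (induction rule: lin_span.induct)
  case zero
  show ?case by (rule exI[of _ "0::nat"]) simp
next
  case (step T S c)
  then obtain n e T' where IH: "\<forall>i<n. T' i \<in> Q" "\<forall>y. S y = (\<Sum>i<n::nat. e i * T' i y)" by blast
  show ?case
    using IH step.hyps(1)
    by (intro exI[of _ "Suc n"] exI[of _ "e(n := c)"] exI[of _ "T'(n := T)"]) (auto simp: less_Suc_eq)
qed

lemma lin_span_add:
  assumes "S \<in> lin_span Q" "S' \<in> lin_span Q" shows "(\<lambda>y. S y + S' y) \<in> lin_span Q"
  using assms(1)
proof induction
  case (step T S c)
  from lin_span.step[OF step.hyps(1) step.IH, of c] show ?case by (simp only: add.assoc)
qed (simp add: assms(2))

lemma lin_span_scale: "S \<in> lin_span Q \<Longrightarrow> (\<lambda>y. a * S y) \<in> lin_span Q"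
proof (induction rule: lin_span.induct)
  case (step T S c)
  from lin_span.step[OF step.hyps(1) step.IH, of "a * c"] show ?case by (simp add: algebra_simps)
qed (simp add: lin_span.zero)

lemma lin_span_base: "T \<in> Q \<Longrightarrow> T \<in> lin_span Q"
  using lin_span.step[OF _ lin_span.zero, of T Q 1] by simp

lemma lin_span_image:
  assumes "S \<in> lin_span Q" and L: "\<And>T. T \<in> Q \<Longrightarrow> L T \<in> lin_span Q'"
    and "L (\<lambda>_. 0) = (\<lambda>_. 0)" and "\<And>c T S. L (\<lambda>y. c * T y + S y) = (\<lambda>y. c * L T y + L S y)"
  shows "L S \<in> lin_span Q'"
  using assms(1)
proof induction
  case (step T S c)
  show ?case
    unfolding assms(4) by (rule lin_span_add[OF lin_span_scale[OF L[OF step.hyps(1)]] step.IH])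
qed (simp add: assms(3) lin_span.zero)

text \<open>
  This is the decomposition of a polynomial over \<open>K\<close> as a combination of polynomials over \<open>F\<close> to which
  descent is applied.
\<close>

lemma poly_fun_lin_span:
  assumes F: "1 \<in> F" and p: "p \<in> poly_fun UNIV"
  shows "p \<in> lin_span (poly_fun F)"
  using p
proof induction
  case (const c)
  have "(\<lambda>_. 1) \<in> poly_fun F" by (intro poly_fun.const F)
  from lin_span.step[OF this lin_span.zero, of c] show ?case by simp
next
  case (coord i)
  show ?case by (intro lin_span_base poly_fun.coord)
next
  case (add p q)
  show ?case by (intro lin_span_add add.IH)
next
  case (mult p q)
  have base: "(\<lambda>x. t x * q x) \<in> lin_span (poly_fun F)" if t: "t \<in> poly_fun F" for t
    by (rule lin_span_image[OF mult.IH(2), of "\<lambda>s x. t x * s x"])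
      (auto intro!: lin_span_base poly_fun.mult t simp: algebra_simps)
  show ?case
    by (rule lin_span_image[OF mult.IH(1), of "\<lambda>s x. s x * q x"])
      (auto intro!: base simp: algebra_simps)
qed

lemma lin_span_descent:
  fixes S :: "'b \<Rightarrow> 'K::field"
  assumes G: "aut_group G"
    and add: "\<And>S S'. S \<in> Q \<Longrightarrow> S' \<in> Q \<Longrightarrow> (\<lambda>y. S y + S' y) \<in> Q"
    and scale: "\<And>c S. c \<in> fixed_field G \<Longrightarrow> S \<in> Q \<Longrightarrow> (\<lambda>y. c * S y) \<in> Q"
    and act: "\<And>\<sigma> y. \<sigma> \<in> G \<Longrightarrow> y \<in> Y \<Longrightarrow> act \<sigma> y \<in> Y"
    and equiv: "\<And>\<sigma> y S. \<sigma> \<in> G \<Longrightarrow> y \<in> Y \<Longrightarrow> S \<in> Q \<Longrightarrow> S (act \<sigma> y) = \<sigma> (S y)"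
    and S: "S \<in> lin_span Q" "\<And>y. y \<in> Y \<Longrightarrow> S y = 0" "S b \<noteq> 0"
  shows "\<exists>S\<in>Q. (\<forall>y\<in>Y. S y = 0) \<and> S b \<noteq> 0"
proof -
  from lin_span_sum[OF S(1)] obtain n :: nat and e T where
    T: "\<And>i. i < n \<Longrightarrow> T i \<in> Q" "\<And>y. S y = (\<Sum>i<n. e i * T i y)" by blast
  show ?thesis
  proof (rule linear_descent[where act = act and T = T and e = e and I = "{..<n}" and Q = Q and Y = Y, OF G])
    show "T i \<in> Q" if "i \<in> {..<n}" for i using T(1) that by simp
    show "(\<Sum>i<n. e i * T i y) = 0" if "y \<in> Y" for y using S(2)[OF that] T(2) by simp
    show "(\<Sum>i<n. e i * T i b) \<noteq> 0" using S(3) T(2) by simp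
    show "(\<lambda>y. S y + S' y) \<in> Q" if "S \<in> Q" "S' \<in> Q" for S S' using that by (rule add)
    show "(\<lambda>y. c * S y) \<in> Q" if "c \<in> fixed_field G" "S \<in> Q" for c S using that by (rule scale)
    show "act \<sigma> y \<in> Y" if "\<sigma> \<in> G" "y \<in> Y" for \<sigma> y using that by (rule act)
    show "S (act \<sigma> y) = \<sigma> (S y)" if "\<sigma> \<in> G" "y \<in> Y" "S \<in> Q" for \<sigma> y S using that by (rule equiv)
  qed simp
qed

definition vec_map :: "('K \<Rightarrow> 'L) \<Rightarrow> 'K ^ 'n \<Rightarrow> 'L ^ 'n" where
  "vec_map \<sigma> x = (\<chi> i. \<sigma> (x $ i))"

lemma vec_map_nth [simp]: "vec_map \<sigma> x $ i = \<sigma> (x $ i)"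
  by (simp add: vec_map_def)

lemma vec_map_inv:
  "field_aut \<sigma> \<Longrightarrow> vec_map \<sigma> (vec_map (inv_into UNIV \<sigma>) x) = x" "field_aut \<sigma> \<Longrightarrow> vec_map (inv_into UNIV \<sigma>) (vec_map \<sigma> x) = x"
  by (simp_all add: vec_eq_iff field_autD)

lemma poly_fun_vec_map:
  assumes "p \<in> poly_fun F" "field_aut \<sigma>" "\<And>c. c \<in> F \<Longrightarrow> \<sigma> c = c"
  shows "p (vec_map \<sigma> x) = \<sigma> (p x)"
  using assms(1) by induction (auto simp: assms(3) field_autD[OF assms(2)])

lemma poly_fun_conjugate:
  assumes "p \<in> poly_fun UNIV" "field_aut \<sigma>"
  shows "(\<lambda>x. \<sigma> (p (vec_map (inv_into UNIV \<sigma>) x))) \<in> poly_fun UNIV"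
  using assms(1) by induction (simp_all add: field_autD[OF assms(2)] poly_fun.intros)

lemma zariski_closed_vec_map:
  assumes "zariski_closed F V" "field_aut \<sigma>" "\<And>c. c \<in> F \<Longrightarrow> \<sigma> c = c" "x \<in> V"
  shows "vec_map \<sigma> x \<in> V"
proof -
  obtain S where S: "S \<subseteq> poly_fun F" "V = {x. \<forall>p\<in>S. p x = 0}"
    using assms(1) by (auto simp: zariski_closed_def)
  have "p (vec_map \<sigma> x) = 0" if "p \<in> S" for p
    using that S assms(4) poly_fun_vec_map[OF _ assms(2,3), of p F x] by (auto simp: field_autD[OF assms(2)])
  then show ?thesis by (simp add: S(2))
qed

lemma regular_on_vec_map:
  assumes "regular_on F D f" "field_aut \<sigma>" "\<And>c. c \<in> F \<Longrightarrow> \<sigma> c = c" "x \<in> D" "vec_map \<sigma> x \<in> D"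
  shows "f (vec_map \<sigma> x) = \<sigma> (f x)"
proof -
  note \<sigma> = field_autD[OF assms(2)]
  obtain p q where pq: "p \<in> poly_fun F" "q \<in> poly_fun F" "q x \<noteq> 0" "\<And>y. y \<in> D \<Longrightarrow> q y \<noteq> 0 \<Longrightarrow> f y = p y / q y"
    using assms(1,4) unfolding regular_on_def by blast
  have pqx: "p (vec_map \<sigma> x) = \<sigma> (p x)" "q (vec_map \<sigma> x) = \<sigma> (q x)"
    using poly_fun_vec_map[OF pq(1) assms(2,3)] poly_fun_vec_map[OF pq(2) assms(2,3)] by auto
  have "f (vec_map \<sigma> x) = p (vec_map \<sigma> x) / q (vec_map \<sigma> x)"
    using pq(3,4) assms(5) pqx \<sigma> by simp
  then show ?thesis using pq(3,4) assms(4) by (simp add: pqx \<sigma>)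
qed

lemma zariski_closed_descent:
  assumes G: "aut_group G" and Z: "zariski_closed UNIV Z"
    and stable: "\<And>\<sigma> x. \<sigma> \<in> G \<Longrightarrow> x \<in> Z \<Longrightarrow> vec_map \<sigma> x \<in> Z"
  shows "zariski_closed (fixed_field G) Z"
  unfolding zariski_closed_def
proof (intro exI conjI)
  let ?F = "fixed_field G"
  note F = is_subfieldD[OF is_subfield_fixed_field[OF G]]
  define S where "S = {P \<in> poly_fun ?F. \<forall>y\<in>Z. P y = 0}"
  show "S \<subseteq> poly_fun ?F" by (auto simp: S_def)
  show "Z = {x. \<forall>P\<in>S. P x = 0}"
  proof (intro equalityI subsetI)
    fix x assume x: "x \<in> {x. \<forall>P\<in>S. P x = 0}"
    show "x \<in> Z"
    proof (rule ccontr)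
      assume "x \<notin> Z"
      then obtain p where p: "p \<in> poly_fun UNIV" "\<And>y. y \<in> Z \<Longrightarrow> p y = 0" "p x \<noteq> 0"
        using Z by (auto simp: zariski_closed_def)
      have "\<exists>P\<in>poly_fun ?F. (\<forall>y\<in>Z. P y = 0) \<and> P x \<noteq> 0"
      proof (rule lin_span_descent[OF G, where act = vec_map])
        show "p \<in> lin_span (poly_fun ?F)" by (rule poly_fun_lin_span[OF F(2) p(1)])
        show "P (vec_map \<sigma> y) = \<sigma> (P y)" if "\<sigma> \<in> G" "P \<in> poly_fun ?F" for \<sigma> y P
          by (rule poly_fun_vec_map[OF that(2) aut_groupD(2)[OF G that(1)] fixed_fieldD[OF _ that(1)]])
        show "(\<lambda>y. c * P y) \<in> poly_fun ?F" if "c \<in> ?F" "P \<in> poly_fun ?F" for c P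
          using that by (intro poly_fun.mult poly_fun.const)
      qed (use p stable in \<open>simp_all add: poly_fun.add\<close>)
      then show False using x by (auto simp: S_def)
    qed
  qed (auto simp: S_def)
qed

text \<open>
  A fraction that represents \<open>f\<close> near \<open>x\<close> can be expanded by its denominator, and then
  \<open>denominator * f = numerator\<close> holds on all of \<open>D\<close>. This condition is linear in numerator and denominator,
  so \<open>lin_span_descent\<close> applies to it. The extra point \<open>None\<close> carries the value of the denominator at \<open>x\<close>,
  which has to stay nonzero.
\<close>

lemma regular_on_descent:
  assumes G: "aut_group G" and f: "regular_on UNIV D f"
    and stable: "\<And>\<sigma> x. \<sigma> \<in> G \<Longrightarrow> x \<in> D \<Longrightarrow> vec_map \<sigma> x \<in> D"
    and equiv: "\<And>\<sigma> x. \<sigma> \<in> G \<Longrightarrow> x \<in> D \<Longrightarrow> f (vec_map \<sigma> x) = \<sigma> (f x)"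
  shows "regular_on (fixed_field G) D f"
  unfolding regular_on_def
proof
  let ?F = "fixed_field G"
  note F = is_subfieldD[OF is_subfield_fixed_field[OF G]]
  fix x assume x: "x \<in> D"
  obtain p q where pq: "p \<in> poly_fun UNIV" "q \<in> poly_fun UNIV" "q x \<noteq> 0" "\<And>y. y \<in> D \<Longrightarrow> q y \<noteq> 0 \<Longrightarrow> f y = p y / q y"
    using f x unfolding regular_on_def by blast
  define eqn where "eqn P Q z = (case z of None \<Rightarrow> Q x | Some y \<Rightarrow> Q y * f y - P y)" for P Q z
  define E where "E = {eqn P Q | P Q. P \<in> poly_fun ?F \<and> Q \<in> poly_fun ?F}"
  have memE: "eqn P Q \<in> E" if "P \<in> poly_fun ?F" "Q \<in> poly_fun ?F" for P Q
    using that by (auto simp: E_def)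
  have zeroF: "(\<lambda>_. 0) \<in> poly_fun ?F" by (intro poly_fun.const F)
  have span_P: "eqn P (\<lambda>_. 0) \<in> lin_span E" if "P \<in> poly_fun UNIV" for P
    by (rule lin_span_image[OF poly_fun_lin_span[OF F(2) that], of "\<lambda>P. eqn P (\<lambda>_. 0)"])
      (auto intro!: lin_span_base memE zeroF simp: eqn_def fun_eq_iff algebra_simps split: option.splits)
  have span_Q: "eqn (\<lambda>_. 0) Q \<in> lin_span E" if "Q \<in> poly_fun UNIV" for Q
    by (rule lin_span_image[OF poly_fun_lin_span[OF F(2) that], of "\<lambda>Q. eqn (\<lambda>_. 0) Q"])
      (auto intro!: lin_span_base memE zeroF simp: eqn_def fun_eq_iff algebra_simps split: option.splits)
  define P0 Q0 where "P0 y = p y * q y" and "Q0 y = q y * q y" for y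
  have P0: "P0 \<in> poly_fun UNIV" and Q0: "Q0 \<in> poly_fun UNIV"
    using pq(1,2) by (simp_all add: P0_def[abs_def] Q0_def[abs_def] poly_fun.mult)
  have "(\<lambda>z. eqn P0 (\<lambda>_. 0) z + eqn (\<lambda>_. 0) Q0 z) \<in> lin_span E"
    by (intro lin_span_add span_P span_Q P0 Q0)
  also have "(\<lambda>z. eqn P0 (\<lambda>_. 0) z + eqn (\<lambda>_. 0) Q0 z) = eqn P0 Q0"
    by (auto simp: eqn_def fun_eq_iff split: option.splits)
  finally have span: "eqn P0 Q0 \<in> lin_span E" .
  have "\<exists>S\<in>E. (\<forall>z\<in>Some ` D. S z = 0) \<and> S None \<noteq> 0"
  proof (rule lin_span_descent[OF G, where act = "\<lambda>\<sigma>. map_option (vec_map \<sigma>)", OF _ _ _ _ span])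
    fix S S' assume "S \<in> E" "S' \<in> E"
    then obtain P Q P' Q' where *: "S = eqn P Q" "S' = eqn P' Q'" "P \<in> poly_fun ?F" "Q \<in> poly_fun ?F"
      "P' \<in> poly_fun ?F" "Q' \<in> poly_fun ?F" unfolding E_def by blast
    have "eqn (\<lambda>x. P x + P' x) (\<lambda>x. Q x + Q' x) \<in> E" by (intro memE poly_fun.add *)
    also have "eqn (\<lambda>x. P x + P' x) (\<lambda>x. Q x + Q' x) = (\<lambda>z. S z + S' z)"
      by (auto simp: *(1,2) eqn_def fun_eq_iff algebra_simps split: option.splits)
    finally show "(\<lambda>z. S z + S' z) \<in> E" .
  next
    fix c S assume "c \<in> ?F" "S \<in> E"
    then obtain P Q where *: "S = eqn P Q" "P \<in> poly_fun ?F" "Q \<in> poly_fun ?F" unfolding E_def by blast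
    have "eqn (\<lambda>x. c * P x) (\<lambda>x. c * Q x) \<in> E" by (intro memE poly_fun.mult poly_fun.const * \<open>c \<in> ?F\<close>)
    also have "eqn (\<lambda>x. c * P x) (\<lambda>x. c * Q x) = (\<lambda>z. c * S z)"
      by (auto simp: *(1) eqn_def fun_eq_iff algebra_simps split: option.splits)
    finally show "(\<lambda>z. c * S z) \<in> E" .
  next
    show "map_option (vec_map \<sigma>) z \<in> Some ` D" if "\<sigma> \<in> G" "z \<in> Some ` D" for \<sigma> z
      using that stable by auto
  next
    fix \<sigma> z S assume \<sigma>: "\<sigma> \<in> G" and z: "z \<in> Some ` D" and "S \<in> E"
    then obtain P Q y where *: "S = eqn P Q" "P \<in> poly_fun ?F" "Q \<in> poly_fun ?F" "z = Some y" "y \<in> D"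
      unfolding E_def by blast
    have "P (vec_map \<sigma> y) = \<sigma> (P y)"
      by (rule poly_fun_vec_map[OF *(2) aut_groupD(2)[OF G \<sigma>] fixed_fieldD[OF _ \<sigma>]])
    moreover have "Q (vec_map \<sigma> y) = \<sigma> (Q y)"
      by (rule poly_fun_vec_map[OF *(3) aut_groupD(2)[OF G \<sigma>] fixed_fieldD[OF _ \<sigma>]])
    ultimately show "S (map_option (vec_map \<sigma>) z) = \<sigma> (S z)"
      using equiv[OF \<sigma> *(5)] by (simp add: *(1,4) eqn_def field_autD[OF aut_groupD(2)[OF G \<sigma>]])
  next
    fix z assume "z \<in> Some ` D"
    then obtain y where y: "z = Some y" "y \<in> D" by auto
    show "eqn P0 Q0 z = 0"
      using pq(4)[OF y(2)] by (cases "q y = 0") (simp_all add: eqn_def y(1) P0_def Q0_def)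
  next
    show "eqn P0 Q0 None \<noteq> 0" using pq(3) by (simp add: eqn_def Q0_def)
  qed
  then obtain P Q where PQ: "P \<in> poly_fun ?F" "Q \<in> poly_fun ?F" "Q x \<noteq> 0" "\<And>y. y \<in> D \<Longrightarrow> Q y * f y - P y = 0"
    unfolding E_def by (auto simp: eqn_def)
  have "f y = P y / Q y" if "y \<in> D" "Q y \<noteq> 0" for y
    using PQ(4)[OF that(1)] that(2) by (simp add: field_simps)
  then show "\<exists>p\<in>poly_fun ?F. \<exists>q\<in>poly_fun ?F. q x \<noteq> 0 \<and> (\<forall>y\<in>D. q y \<noteq> 0 \<longrightarrow> f y = p y / q y)"
    using PQ(1-3) by blast
qed

section \<open>The algebra of regular functions\<close>

lemma regular_on_poly_fun: "p \<in> poly_fun F \<Longrightarrow> 1 \<in> F \<Longrightarrow> regular_on F D p"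
  unfolding regular_on_def by (intro ballI bexI[of _ p] bexI[of _ "\<lambda>_. 1"]) (auto intro: poly_fun.const)

lemma quotient_repI:
  assumes "p \<in> poly_fun F" "q \<in> poly_fun F" "q x \<noteq> 0" "\<And>y. y \<in> D \<Longrightarrow> q y \<noteq> 0 \<Longrightarrow> f y = p y / q y"
  shows "\<exists>p\<in>poly_fun F. \<exists>q\<in>poly_fun F. q x \<noteq> 0 \<and> (\<forall>y\<in>D. q y \<noteq> 0 \<longrightarrow> f y = p y / q y)"
  using assms by blast

lemma regular_on_add:
  assumes "regular_on F D f" "regular_on F D g" shows "regular_on F D (\<lambda>x. f x + g x)"
  unfolding regular_on_def
proof
  fix x assume x: "x \<in> D"
  obtain p q where f: "p \<in> poly_fun F" "q \<in> poly_fun F" "q x \<noteq> 0" "\<And>y. y \<in> D \<Longrightarrow> q y \<noteq> 0 \<Longrightarrow> f y = p y / q y"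
    using assms(1) x unfolding regular_on_def by blast
  obtain r s where g: "r \<in> poly_fun F" "s \<in> poly_fun F" "s x \<noteq> 0" "\<And>y. y \<in> D \<Longrightarrow> s y \<noteq> 0 \<Longrightarrow> g y = r y / s y"
    using assms(2) x unfolding regular_on_def by blast
  show "\<exists>p\<in>poly_fun F. \<exists>q\<in>poly_fun F. q x \<noteq> 0 \<and> (\<forall>y\<in>D. q y \<noteq> 0 \<longrightarrow> f y + g y = p y / q y)"
  proof (rule quotient_repI)
    show "(\<lambda>x. p x * s x + r x * q x) \<in> poly_fun F" "(\<lambda>x. q x * s x) \<in> poly_fun F"
      by (intro poly_fun.add poly_fun.mult f g)+
    fix y assume y: "y \<in> D" "q y * s y \<noteq> 0"
    then have "f y = p y / q y" "g y = r y / s y" using f(4) g(4) by auto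
    then show "f y + g y = (p y * s y + r y * q y) / (q y * s y)"
      using y(2) by (simp add: add_frac_eq)
  qed (use f(3) g(3) in simp)
qed

lemma regular_on_mult:
  assumes "regular_on F D f" "regular_on F D g" shows "regular_on F D (\<lambda>x. f x * g x)"
  unfolding regular_on_def
proof
  fix x assume x: "x \<in> D"
  obtain p q where f: "p \<in> poly_fun F" "q \<in> poly_fun F" "q x \<noteq> 0" "\<And>y. y \<in> D \<Longrightarrow> q y \<noteq> 0 \<Longrightarrow> f y = p y / q y"
    using assms(1) x unfolding regular_on_def by blast
  obtain r s where g: "r \<in> poly_fun F" "s \<in> poly_fun F" "s x \<noteq> 0" "\<And>y. y \<in> D \<Longrightarrow> s y \<noteq> 0 \<Longrightarrow> g y = r y / s y"
    using assms(2) x unfolding regular_on_def by blast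
  show "\<exists>p\<in>poly_fun F. \<exists>q\<in>poly_fun F. q x \<noteq> 0 \<and> (\<forall>y\<in>D. q y \<noteq> 0 \<longrightarrow> f y * g y = p y / q y)"
  proof (rule quotient_repI)
    show "(\<lambda>x. p x * r x) \<in> poly_fun F" "(\<lambda>x. q x * s x) \<in> poly_fun F"
      by (intro poly_fun.mult f g)+
    fix y assume y: "y \<in> D" "q y * s y \<noteq> 0"
    then have "f y = p y / q y" "g y = r y / s y" using f(4) g(4) by auto
    then show "f y * g y = (p y * r y) / (q y * s y)" by simp
  qed (use f(3) g(3) in simp)
qed

lemma regular_on_inverse:
  assumes "regular_on F D f" "\<And>x. x \<in> D \<Longrightarrow> f x \<noteq> 0" shows "regular_on F D (\<lambda>x. inverse (f x))"
  unfolding regular_on_def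
proof
  fix x assume x: "x \<in> D"
  obtain p q where f: "p \<in> poly_fun F" "q \<in> poly_fun F" "q x \<noteq> 0" "\<And>y. y \<in> D \<Longrightarrow> q y \<noteq> 0 \<Longrightarrow> f y = p y / q y"
    using assms(1) x unfolding regular_on_def by blast
  show "\<exists>p\<in>poly_fun F. \<exists>q\<in>poly_fun F. q x \<noteq> 0 \<and> (\<forall>y\<in>D. q y \<noteq> 0 \<longrightarrow> inverse (f y) = p y / q y)"
  proof (rule quotient_repI)
    show "(\<lambda>x. q x * q x) \<in> poly_fun F" "(\<lambda>x. p x * q x) \<in> poly_fun F"
      by (intro poly_fun.mult f)+
    show "p x * q x \<noteq> 0" using f(3) f(4)[OF x f(3)] assms(2)[OF x] by auto
    fix y assume y: "y \<in> D" "p y * q y \<noteq> 0"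
    then have "f y = p y / q y" using f(4) by auto
    then show "inverse (f y) = (q y * q y) / (p y * q y)" using y(2) by simp
  qed
qed

lemma regular_on_mono_field:
  assumes "regular_on F D f" "F \<subseteq> F'" shows "regular_on F' D f"
  unfolding regular_on_def
proof
  fix x assume "x \<in> D"
  then obtain p q where "p \<in> poly_fun F" "q \<in> poly_fun F" "q x \<noteq> 0" "\<And>y. y \<in> D \<Longrightarrow> q y \<noteq> 0 \<Longrightarrow> f y = p y / q y"
    using assms(1) unfolding regular_on_def by blast
  then show "\<exists>p\<in>poly_fun F'. \<exists>q\<in>poly_fun F'. q x \<noteq> 0 \<and> (\<forall>y\<in>D. q y \<noteq> 0 \<longrightarrow> f y = p y / q y)"
    using poly_fun_mono[OF assms(2)] by (intro quotient_repI[of p _ q]) auto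
qed

lemma regular_on_cong:
  "(\<And>x. x \<in> D \<Longrightarrow> f x = g x) \<Longrightarrow> regular_on F D f \<longleftrightarrow> regular_on F D g"
  unfolding regular_on_def by auto

lemma regular_on_poly_fun_compose:
  assumes "p \<in> poly_fun F" "1 \<in> F" "\<And>j. regular_on F D (\<lambda>x. g x $ j)"
  shows "regular_on F D (\<lambda>x. p (g x))"
  using assms(1)
proof induction
  case (const c)
  show ?case by (intro regular_on_poly_fun poly_fun.const const assms(2))
next
  case (coord i)
  show ?case by (rule assms(3))
next
  case (add p q)
  show ?case by (rule regular_on_add[OF add.IH])
next
  case (mult p q)
  show ?case by (rule regular_on_mult[OF mult.IH])
qed

text \<open>
  The numerator and the denominator of \<open>f\<close>, composed with \<open>g\<close>, are themselves regular, and their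
  quotient is cleared of denominators once more.
\<close>

lemma regular_on_compose:
  assumes g: "\<And>j. regular_on F D (\<lambda>x. g x $ j)" and gD: "\<And>x. x \<in> D \<Longrightarrow> g x \<in> E"
    and f: "regular_on F E f" and F: "1 \<in> F"
  shows "regular_on F D (\<lambda>x. f (g x))"
  unfolding regular_on_def
proof
  fix x assume x: "x \<in> D"
  obtain p q where pq: "p \<in> poly_fun F" "q \<in> poly_fun F" "q (g x) \<noteq> 0" "\<And>y. y \<in> E \<Longrightarrow> q y \<noteq> 0 \<Longrightarrow> f y = p y / q y"
    using f gD[OF x] unfolding regular_on_def by blast
  obtain a b where p: "a \<in> poly_fun F" "b \<in> poly_fun F" "b x \<noteq> 0" "\<And>y. y \<in> D \<Longrightarrow> b y \<noteq> 0 \<Longrightarrow> p (g y) = a y / b y"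
    using regular_on_poly_fun_compose[OF pq(1) F g] x unfolding regular_on_def by blast
  obtain r s where q: "r \<in> poly_fun F" "s \<in> poly_fun F" "s x \<noteq> 0" "\<And>y. y \<in> D \<Longrightarrow> s y \<noteq> 0 \<Longrightarrow> q (g y) = r y / s y"
    using regular_on_poly_fun_compose[OF pq(2) F g] x unfolding regular_on_def by blast
  show "\<exists>p\<in>poly_fun F. \<exists>q\<in>poly_fun F. q x \<noteq> 0 \<and> (\<forall>y\<in>D. q y \<noteq> 0 \<longrightarrow> f (g y) = p y / q y)"
  proof (rule quotient_repI)
    show "(\<lambda>x. a x * s x * s x) \<in> poly_fun F" "(\<lambda>x. b x * r x * s x) \<in> poly_fun F"
      by (intro poly_fun.mult p q)+
    have "r x \<noteq> 0" using q(3) q(4)[OF x q(3)] pq(3) by auto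
    then show "b x * r x * s x \<noteq> 0" using p(3) q(3) by simp
    fix y assume y: "y \<in> D" "b y * r y * s y \<noteq> 0"
    then have nz: "b y \<noteq> 0" "r y \<noteq> 0" "s y \<noteq> 0" by auto
    then have "p (g y) = a y / b y" "q (g y) = r y / s y" using p(4) q(4) y(1) by auto
    moreover from this nz have "f (g y) = p (g y) / q (g y)" using pq(4) gD[OF y(1)] by simp
    ultimately have "f (g y) = (a y / b y) / (r y / s y)" by simp
    then show "f (g y) = (a y * s y * s y) / (b y * r y * s y)" using nz by simp
  qed
qed

lemma regular_on_conjugate:
  assumes f: "regular_on UNIV D f" and \<sigma>: "field_aut \<sigma>"
    and D: "\<And>y. y \<in> D \<Longrightarrow> vec_map (inv_into UNIV \<sigma>) y \<in> D"
  shows "regular_on UNIV D (\<lambda>y. \<sigma> (f (vec_map (inv_into UNIV \<sigma>) y)))"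
  unfolding regular_on_def
proof
  fix x assume x: "x \<in> D"
  let ?i = "vec_map (inv_into UNIV \<sigma>)"
  obtain p q where pq: "p \<in> poly_fun UNIV" "q \<in> poly_fun UNIV" "q (?i x) \<noteq> 0" "\<And>y. y \<in> D \<Longrightarrow> q y \<noteq> 0 \<Longrightarrow> f y = p y / q y"
    using f D[OF x] unfolding regular_on_def by blast
  show "\<exists>p\<in>poly_fun UNIV. \<exists>q\<in>poly_fun UNIV. q x \<noteq> 0 \<and> (\<forall>y\<in>D. q y \<noteq> 0 \<longrightarrow> \<sigma> (f (?i y)) = p y / q y)"
  proof (rule quotient_repI)
    show "(\<lambda>y. \<sigma> (p (?i y))) \<in> poly_fun UNIV" "(\<lambda>y. \<sigma> (q (?i y))) \<in> poly_fun UNIV"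
      by (rule poly_fun_conjugate[OF pq(1) \<sigma>], rule poly_fun_conjugate[OF pq(2) \<sigma>])
    show "\<sigma> (q (?i x)) \<noteq> 0" using pq(3) by (simp add: field_autD[OF \<sigma>])
    fix y assume "y \<in> D" "\<sigma> (q (?i y)) \<noteq> 0"
    then have "f (?i y) = p (?i y) / q (?i y)" using pq(4) D by (simp add: field_autD[OF \<sigma>])
    then show "\<sigma> (f (?i y)) = \<sigma> (p (?i y)) / \<sigma> (q (?i y))" by (simp add: field_autD[OF \<sigma>])
  qed
qed

section \<open>Charts and morphisms under field automorphisms\<close>

lemma zariski_closed_mono:
  assumes "zariski_closed F V" "F \<subseteq> F'" shows "zariski_closed F' V"
proof -
  obtain S where "S \<subseteq> poly_fun F" "V = {x. \<forall>p\<in>S. p x = 0}"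
    using assms(1) by (auto simp: zariski_closed_def)
  then show ?thesis
    unfolding zariski_closed_def using poly_fun_mono[OF assms(2)] by (intro exI[of _ S]) auto
qed

lemma zariski_closed_Int:
  assumes "zariski_closed F V" "zariski_closed F W" shows "zariski_closed F (V \<inter> W)"
proof -
  obtain S T where "S \<subseteq> poly_fun F" "V = {x. \<forall>p\<in>S. p x = 0}" "T \<subseteq> poly_fun F" "W = {x. \<forall>p\<in>T. p x = 0}"
    using assms by (auto simp: zariski_closed_def)
  then show ?thesis unfolding zariski_closed_def by (intro exI[of _ "S \<union> T"]) auto
qed

definition affine_charts :: "('a, 'K::field, 'n::finite) atlas \<Rightarrow> bool" where
  "affine_charts A \<longleftrightarrow> (\<forall>(U, c)\<in>A. inj_on c U \<and> zariski_closed UNIV (c ` U))"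

text \<open>
  The map \<open>s\<close> acts on points as \<open>\<sigma>\<close> acts on their coordinates in every chart. For an atlas over a field fixed
  by \<open>\<sigma>\<close> this is the conjugation of points.
\<close>

definition galois_lift :: "('K \<Rightarrow> 'K) \<Rightarrow> ('a, 'K, 'n::finite) atlas \<Rightarrow> ('a \<Rightarrow> 'a) \<Rightarrow> bool" where
  "galois_lift \<sigma> A s \<longleftrightarrow> (\<forall>(U, c)\<in>A. \<forall>x\<in>U. s x \<in> U \<and> c (s x) = vec_map \<sigma> (c x))"

lemma affine_chartsD: "affine_charts A \<Longrightarrow> (U, c) \<in> A \<Longrightarrow> inj_on c U"
  "affine_charts A \<Longrightarrow> (U, c) \<in> A \<Longrightarrow> zariski_closed UNIV (c ` U)"
  by (auto simp: affine_charts_def)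

lemma galois_liftD:
  "galois_lift \<sigma> A s \<Longrightarrow> (U, c) \<in> A \<Longrightarrow> x \<in> U \<Longrightarrow> s x \<in> U"
  "galois_lift \<sigma> A s \<Longrightarrow> (U, c) \<in> A \<Longrightarrow> x \<in> U \<Longrightarrow> c (s x) = vec_map \<sigma> (c x)"
  by (auto simp: galois_lift_def)

lemma in_pointsE:
  assumes "x \<in> points A" obtains U c where "(U, c) \<in> A" "x \<in> U"
  using assms by (auto simp: points_def)

lemma in_pointsI: "(U, c) \<in> A \<Longrightarrow> x \<in> U \<Longrightarrow> x \<in> points A"
  by (auto simp: points_def)

lemma morphismD:
  assumes "morphism F A B f"
  shows "x \<in> points A \<Longrightarrow> f x \<in> points B"
    "(U, c) \<in> A \<Longrightarrow> (W, d) \<in> B \<Longrightarrow> zariski_open_in F (c ` U) (c ` {x \<in> U. f x \<in> W})"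
    "(U, c) \<in> A \<Longrightarrow> (W, d) \<in> B \<Longrightarrow> regular_on F (c ` {x \<in> U. f x \<in> W}) (\<lambda>y. d (f (inv_into U c y)) $ j)"
proof -
  show "x \<in> points A \<Longrightarrow> f x \<in> points B" using assms by (auto simp: morphism_def)
  assume "(U, c) \<in> A" "(W, d) \<in> B"
  then have "zariski_open_in F (c ` U) (c ` {x \<in> U. f x \<in> W}) \<and>
        regular_map_on F (c ` {x \<in> U. f x \<in> W}) (d \<circ> f \<circ> inv_into U c)"
    using assms unfolding morphism_def by blast
  then show "zariski_open_in F (c ` U) (c ` {x \<in> U. f x \<in> W})"
    "regular_on F (c ` {x \<in> U. f x \<in> W}) (\<lambda>y. d (f (inv_into U c y)) $ j)"
    by (simp_all add: regular_map_on_def)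
qed

text \<open>
  In charts, \<open>f\<close> is given by fractions over \<open>F\<close>, which commute with \<open>\<sigma>\<close>. The conjugate point lies in the
  domain of the same fractions, because the complement of the domain is closed over \<open>F\<close> and therefore
  stable under the inverse of \<open>\<sigma>\<close>.
\<close>

lemma morphism_galois_equivariant:
  assumes f: "morphism F A B f" and \<sigma>: "field_aut \<sigma>" and fix_F: "\<And>a. a \<in> F \<Longrightarrow> \<sigma> a = a"
    and A: "affine_charts A" "galois_lift \<sigma> A s" and B: "affine_charts B" "galois_lift \<sigma> B t"
    and h: "h \<in> points A"
  shows "f (s h) = t (f h)"
proof -
  obtain U c where U: "(U, c) \<in> A" "h \<in> U" using h by (rule in_pointsE)
  obtain W d where W: "(W, d) \<in> B" "f h \<in> W" using morphismD(1)[OF f h] by (rule in_pointsE)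
  note inj_c = affine_chartsD(1)[OF A(1) U(1)] and inj_d = affine_chartsD(1)[OF B(1) W(1)]
  note sh = galois_liftD[OF A(2) U] and tfh = galois_liftD[OF B(2) W]
  define D where "D = c ` {x \<in> U. f x \<in> W}"
  obtain Z where Z: "zariski_closed F Z" "D = c ` U - Z"
    using morphismD(2)[OF f U(1) W(1)] unfolding zariski_open_in_def D_def by blast
  have hD: "c h \<in> D" using U(2) W(2) by (auto simp: D_def)
  have inv_fix: "inv_into UNIV \<sigma> a = a" if "a \<in> F" for a
    using field_autD(13)[OF \<sigma>, of a] fix_F[OF that] by simp
  have "c (s h) \<notin> Z"
  proof
    assume "c (s h) \<in> Z"
    then have "vec_map (inv_into UNIV \<sigma>) (c (s h)) \<in> Z"
      using zariski_closed_vec_map[OF Z(1) field_aut_inv[OF \<sigma>] inv_fix] by blast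
    then have "c h \<in> Z" by (simp add: sh(2) vec_map_inv[OF \<sigma>])
    then show False using hD Z(2) by blast
  qed
  then have shD: "c (s h) \<in> D" using sh(1) Z(2) by blast
  then obtain x where "x \<in> U" "f x \<in> W" "c (s h) = c x" by (auto simp: D_def)
  then have fsh: "f (s h) \<in> W" using inj_onD[OF inj_c] sh(1) by metis
  have "d (f (s h)) $ j = \<sigma> (d (f h) $ j)" for j
    using regular_on_vec_map[OF morphismD(3)[OF f U(1) W(1), of j, folded D_def] \<sigma> fix_F hD
        shD[unfolded sh(2)]]
    unfolding inv_into_f_f[OF inj_c sh(1), unfolded sh(2)] inv_into_f_f[OF inj_c U(2)] .
  then have "d (f (s h)) = d (t (f h))" by (simp add: tfh(2) vec_eq_iff)
  then show ?thesis using inj_onD[OF inj_d] fsh tfh(1) by blast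
qed

text \<open>
  The converse of \<open>morphism_galois_equivariant\<close> for a whole group of automorphisms: the domains of \<open>f\<close> in
  the charts are stable under the group, and \<open>f\<close> is equivariant there, so both descend.
\<close>

lemma morphism_descent:
  assumes G: "aut_group G" and f: "morphism UNIV A B f"
    and A: "affine_charts A" "\<And>\<sigma>. \<sigma> \<in> G \<Longrightarrow> galois_lift \<sigma> A (s \<sigma>)"
    and B: "\<And>\<sigma>. \<sigma> \<in> G \<Longrightarrow> galois_lift \<sigma> B (t \<sigma>)"
    and equiv: "\<And>\<sigma> x. \<sigma> \<in> G \<Longrightarrow> x \<in> points A \<Longrightarrow> f (s \<sigma> x) = t \<sigma> (f x)"
  shows "morphism (fixed_field G) A B f"
proof -
  have "zariski_open_in (fixed_field G) (c ` U) (c ` {x \<in> U. f x \<in> W})"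
    and "regular_map_on (fixed_field G) (c ` {x \<in> U. f x \<in> W}) (d \<circ> f \<circ> inv_into U c)"
    if U: "(U, c) \<in> A" and W: "(W, d) \<in> B" for U c W d
  proof -
    define D where "D = c ` {x \<in> U. f x \<in> W}"
    note inj = affine_chartsD(1)[OF A(1) U]
    have stable_U: "vec_map \<sigma> y \<in> c ` U" if \<sigma>: "\<sigma> \<in> G" and y: "y \<in> c ` U" for \<sigma> y
    proof -
      obtain x where x: "x \<in> U" "y = c x" using y by blast
      then show ?thesis using galois_liftD[OF A(2)[OF \<sigma>] U x(1)] by (metis imageI)
    qed
    have stable_D: "vec_map \<sigma> y \<in> D" if \<sigma>: "\<sigma> \<in> G" and y: "y \<in> D" for \<sigma> y
    proof -
      obtain x where x: "x \<in> U" "f x \<in> W" "y = c x" using y by (auto simp: D_def)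
      note sx = galois_liftD[OF A(2)[OF \<sigma>] U x(1)]
      have "f (s \<sigma> x) \<in> W"
        using equiv[OF \<sigma> in_pointsI[OF U x(1)]] galois_liftD(1)[OF B[OF \<sigma>] W x(2)] by simp
      then have "c (s \<sigma> x) \<in> D" using sx(1) by (simp add: D_def)
      then show ?thesis by (simp add: sx(2) x(3))
    qed
    obtain Z where Z: "zariski_closed UNIV Z" "D = c ` U - Z"
      using morphismD(2)[OF f U W] unfolding zariski_open_in_def D_def by blast
    have "zariski_closed (fixed_field G) (c ` U \<inter> Z)"
    proof (rule zariski_closed_descent[OF G])
      show "zariski_closed UNIV (c ` U \<inter> Z)"
        by (intro zariski_closed_Int Z affine_chartsD(2)[OF A(1) U])
      fix \<sigma> y assume \<sigma>: "\<sigma> \<in> G" and y: "y \<in> c ` U \<inter> Z"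
      have "vec_map \<sigma> y \<notin> D"
      proof
        assume "vec_map \<sigma> y \<in> D"
        from stable_D[OF aut_groupD(3)[OF G \<sigma>] this] have "y \<in> D"
          by (simp add: vec_map_inv[OF aut_groupD(2)[OF G \<sigma>]])
        then show False using y Z(2) by blast
      qed
      then show "vec_map \<sigma> y \<in> c ` U \<inter> Z" using stable_U[OF \<sigma>] y Z(2) by blast
    qed
    moreover have "D = c ` U - (c ` U \<inter> Z)" using Z(2) by blast
    ultimately show "zariski_open_in (fixed_field G) (c ` U) (c ` {x \<in> U. f x \<in> W})"
      unfolding zariski_open_in_def D_def by blast
    have "regular_on (fixed_field G) D (\<lambda>y. d (f (inv_into U c y)) $ j)" for j
    proof (rule regular_on_descent[OF G _ stable_D])
      show "regular_on UNIV D (\<lambda>y. d (f (inv_into U c y)) $ j)"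
        unfolding D_def by (rule morphismD(3)[OF f U W])
      fix \<sigma> y assume \<sigma>: "\<sigma> \<in> G" and y: "y \<in> D"
      obtain x where x: "x \<in> U" "f x \<in> W" "y = c x" using y by (auto simp: D_def)
      note sx = galois_liftD[OF A(2)[OF \<sigma>] U x(1)]
      have "d (f (s \<sigma> x)) = vec_map \<sigma> (d (f x))"
        using equiv[OF \<sigma> in_pointsI[OF U x(1)]] galois_liftD(2)[OF B[OF \<sigma>] W x(2)] by simp
      then show "d (f (inv_into U c (vec_map \<sigma> y))) $ j = \<sigma> (d (f (inv_into U c y)) $ j)"
        unfolding x(3) inv_into_f_f[OF inj sx(1), unfolded sx(2)] inv_into_f_f[OF inj x(1)] by simp
    qed
    then show "regular_map_on (fixed_field G) (c ` {x \<in> U. f x \<in> W}) (d \<circ> f \<circ> inv_into U c)"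
      by (simp add: regular_map_on_def o_def D_def)
  qed
  moreover have "f ` points A \<subseteq> points B" using morphismD(1)[OF f] by blast
  ultimately show ?thesis unfolding morphism_def by blast
qed

lemma vec_pair_nth [simp]: "vec_pair u v $ Inl i = u $ i" "vec_pair u v $ Inr j = v $ j"
  by (simp_all add: vec_pair_def)

lemma vec_eq_iff_sum: "x = y \<longleftrightarrow> (\<forall>i. x $ Inl i = y $ Inl i) \<and> (\<forall>j. x $ Inr j = y $ Inr j)"
  unfolding vec_eq_iff by (metis sum.exhaust)

lemma vec_pair_eq_iff [simp]: "vec_pair u v = vec_pair u' v' \<longleftrightarrow> u = u' \<and> v = v'"
  by (simp add: vec_eq_iff_sum vec_eq_iff)

lemma vec_map_vec_pair: "vec_map \<sigma> (vec_pair u v) = vec_pair (vec_map \<sigma> u) (vec_map \<sigma> v)"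
  by (simp add: vec_eq_iff_sum)

lemma variety_affine_charts: "variety F A \<Longrightarrow> affine_charts A"
  unfolding variety_def affine_charts_def
  by (auto intro: zariski_closed_mono[OF _ subset_UNIV])

lemma zariski_closed_vec_pair:
  fixes V :: "('K::field ^ 'n::finite) set" and W :: "('K ^ 'm::finite) set"
  assumes "zariski_closed F V" "zariski_closed F W"
  shows "zariski_closed F {vec_pair u v | u v. u \<in> V \<and> v \<in> W}"
proof -
  obtain S T where S: "S \<subseteq> poly_fun F" "V = {x. \<forall>p\<in>S. p x = 0}"
    and T: "T \<subseteq> poly_fun F" "W = {x. \<forall>p\<in>T. p x = 0}"
    using assms by (auto simp: zariski_closed_def)
  define l :: "'K ^ ('n + 'm) \<Rightarrow> 'K ^ 'n" where "l z = (\<chi> i. z $ Inl i)" for z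
  define r :: "'K ^ ('n + 'm) \<Rightarrow> 'K ^ 'm" where "r z = (\<chi> i. z $ Inr i)" for z
  define R where "R = (\<lambda>p z. p (l z)) ` S \<union> (\<lambda>p z. p (r z)) ` T"
  have "(\<lambda>z. p (l z)) \<in> poly_fun F" if "p \<in> S" for p
    by (rule poly_fun_compose) (use that S in \<open>auto simp: l_def poly_fun.coord\<close>)
  moreover have "(\<lambda>z. p (r z)) \<in> poly_fun F" if "p \<in> T" for p
    by (rule poly_fun_compose) (use that T in \<open>auto simp: r_def poly_fun.coord\<close>)
  ultimately have "R \<subseteq> poly_fun F" by (auto simp: R_def)
  moreover have "{vec_pair u v | u v. u \<in> V \<and> v \<in> W} = {z. \<forall>p\<in>R. p z = 0}"
  proof (intro equalityI subsetI)
    fix z assume "z \<in> {z. \<forall>p\<in>R. p z = 0}"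
    then have "l z \<in> V" "r z \<in> W" by (auto simp: R_def S T)
    moreover have "z = vec_pair (l z) (r z)" by (simp add: vec_eq_iff_sum l_def r_def)
    ultimately show "z \<in> {vec_pair u v | u v. u \<in> V \<and> v \<in> W}" by blast
  next
    fix z assume "z \<in> {vec_pair u v | u v. u \<in> V \<and> v \<in> W}"
    then obtain u v where "z = vec_pair u v" "u \<in> V" "v \<in> W" by blast
    moreover from this have "l z = u" "r z = v" by (simp_all add: l_def r_def vec_eq_iff)
    ultimately show "z \<in> {z. \<forall>p\<in>R. p z = 0}" using S T by (auto simp: R_def)
  qed
  ultimately show ?thesis unfolding zariski_closed_def by blast
qed

lemma in_prod_variety_iff:
  "(U, c) \<in> prod_variety A B \<longleftrightarrow>
    (\<exists>V a W b. (V, a) \<in> A \<and> (W, b) \<in> B \<and> U = V \<times> W \<and> c = (\<lambda>(x, y). vec_pair (a x) (b y)))"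
  by (auto simp: prod_variety_def)

lemma affine_charts_prod:
  assumes "affine_charts A" "affine_charts B"
  shows "affine_charts (prod_variety A B)"
proof -
  have "inj_on c U \<and> zariski_closed UNIV (c ` U)" if Uc: "(U, c) \<in> prod_variety A B" for U c
  proof -
    obtain V a W b where *: "(V, a) \<in> A" "(W, b) \<in> B" "U = V \<times> W" "c = (\<lambda>(x, y). vec_pair (a x) (b y))"
      using Uc unfolding in_prod_variety_iff by (elim exE conjE) (rule that; assumption)
    note a = affine_chartsD[OF assms(1) *(1)] and b = affine_chartsD[OF assms(2) *(2)]
    have "inj_on c U"
      using inj_onD[OF a(1)] inj_onD[OF b(1)] by (intro inj_onI) (auto simp: *)
    moreover have "c ` U = {vec_pair u v | u v. u \<in> a ` V \<and> v \<in> b ` W}" by (force simp: *)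
    ultimately show ?thesis using zariski_closed_vec_pair[OF a(2) b(2)] by simp
  qed
  then show ?thesis unfolding affine_charts_def by blast
qed

lemma galois_lift_prod:
  assumes "galois_lift \<sigma> A s" "galois_lift \<sigma> B t"
  shows "galois_lift \<sigma> (prod_variety A B) (map_prod s t)"
  using assms unfolding galois_lift_def prod_variety_def by (fastforce simp: vec_map_vec_pair)

lemma points_prod: "points (prod_variety A B) = points A \<times> points B"
  unfolding points_def prod_variety_def by blast

lemma affine_charts_affine_space: "affine_charts affine_space"
  by (auto simp: affine_charts_def affine_space_def zariski_closed_def intro!: exI[of _ "{}"])

lemma galois_lift_affine_space: "galois_lift \<sigma> affine_space (vec_map \<sigma>)"
  by (auto simp: galois_lift_def affine_space_def)

lemma points_affine_space [simp]: "points affine_space = UNIV"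
  by (auto simp: points_def affine_space_def)

lemma affine_charts_Gm: "affine_charts (Gm_atlas :: ('K::field, 'K, 2) atlas)"
proof -
  have "(\<lambda>x :: 'K. vector [x, inverse x]) ` {x. x \<noteq> 0} = {v :: 'K ^ 2. v $ 1 * v $ 2 - 1 = 0}"
  proof (intro equalityI subsetI)
    fix v :: "'K ^ 2" assume "v \<in> {v. v $ 1 * v $ 2 - 1 = 0}"
    then have "v $ 1 * v $ 2 = 1" by simp
    then have "v $ 1 \<noteq> 0" "v $ 2 = inverse (v $ 1)" by (auto simp: inverse_unique)
    moreover from this have "v = vector [v $ 1, inverse (v $ 1)]"
      by (simp add: vec_eq_iff forall_2)
    ultimately show "v \<in> (\<lambda>x. vector [x, inverse x]) ` {x. x \<noteq> 0}" by blast
  qed auto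
  moreover have "zariski_closed UNIV {v :: 'K ^ 2. v $ 1 * v $ 2 - 1 = 0}"
    unfolding zariski_closed_def
    by (intro exI[of _ "{\<lambda>v. v $ 1 * v $ 2 - 1}"]) (auto intro!: poly_fun_diff poly_fun.intros)
  moreover have "inj_on (\<lambda>x :: 'K. vector [x, inverse x] :: 'K ^ 2) {x. x \<noteq> 0}"
    by (intro inj_onI) (metis vector_2(1))
  ultimately show ?thesis by (simp add: affine_charts_def Gm_atlas_def)
qed

lemma galois_lift_Gm:
  assumes "field_aut \<sigma>" shows "galois_lift \<sigma> Gm_atlas \<sigma>"
  by (auto simp: galois_lift_def Gm_atlas_def field_autD[OF assms] vec_eq_iff forall_2)

lemma points_Gm [simp]: "points Gm_atlas = {x. x \<noteq> 0}"
  by (auto simp: points_def Gm_atlas_def)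

section \<open>Characters of a form of the multiplicative group\<close>

text \<open>
  In one chart the lift is forced. Another chart gives the same point because the image of the overlap
  under both charts together is closed over \<open>F\<close>, which is the separatedness of the variety, and therefore
  stable under \<open>\<sigma>\<close>.
\<close>

lemma ex_galois_lift:
  assumes A: "variety F A" and \<sigma>: "field_aut \<sigma>" and fix_F: "\<And>a. a \<in> F \<Longrightarrow> \<sigma> a = a"
  shows "\<exists>s. galois_lift \<sigma> A s"
proof -
  note charts = affine_chartsD[OF variety_affine_charts[OF A]]
  have "\<exists>h'. \<forall>(U, c)\<in>A. h \<in> U \<longrightarrow> h' \<in> U \<and> c h' = vec_map \<sigma> (c h)" for h
  proof (cases "h \<in> points A")
    case True
    then obtain U c where U: "(U, c) \<in> A" "h \<in> U" by (rule in_pointsE)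
    have glue: "\<exists>y. y \<in> U \<inter> W \<and> c y = vec_map \<sigma> (c h) \<and> d y = vec_map \<sigma> (d h)"
      if W: "(W, d) \<in> A" "h \<in> W" for W d
    proof -
      have "zariski_closed F ((\<lambda>x. vec_pair (c x) (d x)) ` (U \<inter> W))"
        using A U(1) W(1) unfolding variety_def by fast
      from zariski_closed_vec_map[OF this \<sigma> fix_F, of "vec_pair (c h) (d h)"] U(2) W(2)
      show ?thesis by (auto simp: vec_map_vec_pair)
    qed
    obtain h' where h': "h' \<in> U" "c h' = vec_map \<sigma> (c h)" using glue[OF U] by blast
    have "h' \<in> W \<and> d h' = vec_map \<sigma> (d h)" if W: "(W, d) \<in> A" "h \<in> W" for W d
    proof -
      obtain y where y: "y \<in> U \<inter> W" "c y = vec_map \<sigma> (c h)" "d y = vec_map \<sigma> (d h)"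
        using glue[OF W] by blast
      have "y = h'" using inj_onD[OF charts(1)[OF U(1)], of y h'] y h' by simp
      then show ?thesis using y by simp
    qed
    then show ?thesis by blast
  next
    case False
    then have "h \<notin> U" if "(U, c) \<in> A" for U c using in_pointsI[OF that] by blast
    then show ?thesis by blast
  qed
  then obtain s where "\<forall>h. \<forall>(U, c)\<in>A. h \<in> U \<longrightarrow> s h \<in> U \<and> c (s h) = vec_map \<sigma> (c h)"
    using choice[of "\<lambda>h h'. \<forall>(U, c)\<in>A. h \<in> U \<longrightarrow> h' \<in> U \<and> c h' = vec_map \<sigma> (c h)"] by blast
  then have "galois_lift \<sigma> A s" unfolding galois_lift_def by fast
  then show ?thesis by blast
qed

lemma galois_lift_unique:
  assumes "affine_charts A" "galois_lift \<sigma> A s" "galois_lift \<sigma> A t" "h \<in> points A"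
  shows "s h = t h"
proof -
  obtain U c where U: "(U, c) \<in> A" "h \<in> U" using assms(4) by (rule in_pointsE)
  show ?thesis
    using inj_onD[OF affine_chartsD(1)[OF assms(1) U(1)], of "s h" "t h"]
      galois_liftD[OF assms(2) U] galois_liftD[OF assms(3) U] by simp
qed

lemma galois_lift_comp:
  assumes "galois_lift \<sigma> A s" "galois_lift \<tau> A t" shows "galois_lift (\<sigma> \<circ> \<tau>) A (s \<circ> t)"
  using assms unfolding galois_lift_def by (fastforce simp: vec_eq_iff)

lemma galois_lift_id: "galois_lift id A id"
  by (auto simp: galois_lift_def vec_eq_iff)

lemma galois_lift_points: "galois_lift \<sigma> A s \<Longrightarrow> h \<in> points A \<Longrightarrow> s h \<in> points A"
  by (metis galois_liftD(1) in_pointsE in_pointsI)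

text \<open>
  On the hyperbola that represents the multiplicative group, polynomial functions are Laurent polynomials.
\<close>

lemma laurent_numerator:
  assumes "p \<in> poly_fun (UNIV :: 'K::field set)"
  shows "\<exists>N P. \<forall>x. x \<noteq> 0 \<longrightarrow> x ^ N * p (vector [x, inverse x] :: 'K ^ 2) = poly P x"
  using assms
proof induction
  case (const c)
  show ?case by (intro exI[of _ 0] exI[of _ "[:c:]"]) simp
next
  case (coord i)
  consider "i = 1" | "i = 2" using exhaust_2 by blast
  then show ?case
  proof cases
    case 1
    then show ?thesis by (intro exI[of _ 0] exI[of _ "[:0, 1:]"]) simp
  next
    case 2
    then show ?thesis by (intro exI[of _ 1] exI[of _ "[:1:]"]) simp
  qed
next
  case (add p q)
  then obtain N P M Q where *: "\<And>x. x \<noteq> 0 \<Longrightarrow> x ^ N * p (vector [x, inverse x]) = poly P x"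
    "\<And>x. x \<noteq> 0 \<Longrightarrow> x ^ M * q (vector [x, inverse x]) = poly Q x" by blast
  show ?case
  proof (intro exI allI impI)
    fix x :: 'K assume "x \<noteq> 0"
    from *[OF this] show "x ^ (N + M) * (p (vector [x, inverse x]) + q (vector [x, inverse x])) =
        poly (monom 1 M * P + monom 1 N * Q) x"
      by (simp add: poly_monom power_add algebra_simps flip: *)
  qed
next
  case (mult p q)
  then obtain N P M Q where *: "\<And>x. x \<noteq> 0 \<Longrightarrow> x ^ N * p (vector [x, inverse x]) = poly P x"
    "\<And>x. x \<noteq> 0 \<Longrightarrow> x ^ M * q (vector [x, inverse x]) = poly Q x" by blast
  show ?case
  proof (intro exI allI impI)
    fix x :: 'K assume x: "x \<noteq> 0"
    show "x ^ (N + M) * (p (vector [x, inverse x]) * q (vector [x, inverse x])) = poly (P * Q) x"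
      unfolding poly_mult *[OF x, symmetric] power_add by (simp add: ac_simps)
  qed
qed

lemma ex_nontrivial_root_of_unity:
  assumes "k \<ge> 2"
  shows "\<exists>r :: 'K::{alg_closed_field,field_char_0}. r \<noteq> 0 \<and> r \<noteq> 1 \<and> r ^ k = 1"
proof -
  have "\<exists>r. (\<Sum>i\<le>k - 1. (1 :: 'K) * r ^ i) = 0"
    using assms by (intro alg_closed[of "k - 1" "\<lambda>_. 1"]) auto
  then obtain r :: 'K where r: "(\<Sum>i\<le>k - 1. r ^ i) = 0" by auto
  have "{..k - 1} = {..<k}" using assms by auto
  then have "r ^ k - 1 = (r - 1) * (\<Sum>i\<le>k - 1. r ^ i)"
    using power_diff_1_eq[of r k] assms by simp
  then have "r ^ k = 1" using r by simp
  moreover have "r \<noteq> 1"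
  proof
    assume "r = 1"
    then have "of_nat (Suc (k - 1)) = (0 :: 'K)" using r by simp
    then show False by (simp only: of_nat_eq_0_iff)
  qed
  moreover have "r \<noteq> 0" using \<open>r ^ k = 1\<close> assms by (auto simp: power_0_left)
  ultimately show ?thesis by blast
qed

text \<open>
  Write \<open>f = P / Q\<close> with \<open>Q\<close> of least degree \<open>n\<close>. For \<open>y \<noteq> 0\<close>, multiplicativity gives a second fraction
  \<open>P(y X) / (f(y) Q(y X))\<close> for \<open>f\<close>. Subtracting it, on numerators and denominators, from \<open>y^n P / (y^n Q)\<close>
  cancels the leading term of the denominator, so by minimality both differences vanish. Comparison of one
  coefficient of \<open>P\<close> shows that \<open>f(y) y^n = y^i\<close>. So \<open>f\<close> is a power, and injectivity leaves only the
  exponents \<open>1\<close> and \<open>-1\<close>, as there are nontrivial roots of unity.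
\<close>

lemma rational_character:
  fixes f :: "'K::{alg_closed_field,field_char_0} \<Rightarrow> 'K"
  assumes mult: "\<And>x y. x \<noteq> 0 \<Longrightarrow> y \<noteq> 0 \<Longrightarrow> f (x * y) = f x * f y"
    and nz: "\<And>x. x \<noteq> 0 \<Longrightarrow> f x \<noteq> 0" and inj: "inj_on f {x. x \<noteq> 0}"
    and Q0: "Q0 \<noteq> 0" and rat: "\<And>x. x \<noteq> 0 \<Longrightarrow> poly Q0 x \<noteq> 0 \<Longrightarrow> f x * poly Q0 x = poly P0 x"
  shows "(\<forall>x. x \<noteq> 0 \<longrightarrow> f x = x) \<or> (\<forall>x. x \<noteq> 0 \<longrightarrow> f x = inverse x)"
proof -
  \<comment> \<open>the fraction may fail at finitely many points, so that differences of fractions are allowed\<close>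
  define bad where "bad P Q = {x. x \<noteq> 0 \<and> f x * poly Q x \<noteq> poly P x}" for P Q
  define E where "E = (\<lambda>(P, Q). Q \<noteq> 0 \<and> finite (bad P Q))"
  have "bad P0 Q0 \<subseteq> {x. poly Q0 x = 0}" using rat by (auto simp: bad_def)
  then have "E (P0, Q0)" using Q0 poly_roots_finite[OF Q0] finite_subset by (auto simp: E_def)
  then obtain P Q where PQ: "E (P, Q)" and min: "\<And>P' Q'. E (P', Q') \<Longrightarrow> degree Q \<le> degree Q'"
    using ex_has_least_nat[of E "(P0, Q0)" "\<lambda>(P, Q). degree Q"] by auto
  have Q: "Q \<noteq> 0" and fin: "finite (bad P Q)" using PQ by (auto simp: E_def)
  have fin_zero: "p = 0" if "finite {x. x \<noteq> 0 \<and> poly p x \<noteq> 0}" for p :: "'K poly"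
  proof (rule ccontr)
    assume "p \<noteq> 0"
    have "UNIV \<subseteq> insert 0 ({x. x \<noteq> 0 \<and> poly p x \<noteq> 0} \<union> {x. poly p x = 0})" by auto
    then have "finite (UNIV :: 'K set)"
      using that poly_roots_finite[OF \<open>p \<noteq> 0\<close>] by (meson finite_UnI finite_insert finite_subset)
    then show False using infinite_UNIV_char_0 by blast
  qed
  define n where "n = degree Q"
  have scaled: "y ^ n * poly.coeff P i = y ^ i * poly.coeff P i / f y" if y: "y \<noteq> 0" for y i
  proof -
    define S where "S = smult (y ^ n) Q - pcompose Q [:0, y:]"
    define R where "R = smult (y ^ n) P - smult (1 / f y) (pcompose P [:0, y:])"
    have "bad R S \<subseteq> bad P Q \<union> (\<lambda>x. x / y) ` bad P Q"
    proof
      fix x assume x: "x \<in> bad R S"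
      show "x \<in> bad P Q \<union> (\<lambda>x. x / y) ` bad P Q"
      proof (rule ccontr)
        assume neg: "x \<notin> bad P Q \<union> (\<lambda>x. x / y) ` bad P Q"
        have x0: "x \<noteq> 0" using x by (simp add: bad_def)
        have "f x * poly Q x = poly P x" using neg x0 by (auto simp: bad_def)
        moreover have "f (y * x) * poly Q (y * x) = poly P (y * x)"
        proof -
          have "y * x \<notin> bad P Q"
          proof
            assume "y * x \<in> bad P Q"
            then have "y * x / y \<in> (\<lambda>x. x / y) ` bad P Q" by (rule imageI)
            then show False using neg y by simp
          qed
          then show ?thesis using x0 y by (simp add: bad_def)
        qed
        then have "f x * poly Q (y * x) = poly P (y * x) / f y"
          using mult[OF y x0] nz[OF y] by (simp add: field_simps)
        ultimately have "f x * poly S x = poly R x"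
          by (simp add: S_def R_def poly_pcompose algebra_simps)
        then show False using x by (simp add: bad_def)
      qed
    qed
    then have fin_RS: "finite (bad R S)" using fin finite_subset by blast
    have "S = 0"
    proof (rule ccontr)
      assume "S \<noteq> 0"
      then have "E (R, S)" using fin_RS by (simp add: E_def)
      then have "n \<le> degree S" unfolding n_def by (rule min)
      moreover have "degree S \<le> n"
        unfolding S_def n_def
        by (intro degree_diff_le order.trans[OF degree_smult_le] order.trans[OF degree_pcompose_le]) auto
      moreover have "poly.coeff S n = 0"
        by (simp add: S_def n_def coeff_pcompose_linear)
      ultimately show False using \<open>S \<noteq> 0\<close> by (metis leading_coeff_0_iff le_antisym)
    qed
    have "R = 0"
      by (rule fin_zero) (use fin_RS in \<open>simp add: bad_def \<open>S = 0\<close> eq_commute[of 0]\<close>)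
    then have "poly.coeff R i = 0" by simp
    then show ?thesis by (simp add: R_def coeff_pcompose_linear)
  qed
  have "P \<noteq> 0"
  proof
    assume P: "P = 0"
    have "{x. x \<noteq> 0 \<and> poly Q x \<noteq> 0} \<subseteq> bad P Q" using nz by (auto simp: P bad_def)
    then have "Q = 0" using fin by (intro fin_zero) (rule finite_subset)
    then show False using Q by simp
  qed
  then obtain i where i: "poly.coeff P i \<noteq> 0" by (auto simp: poly_eq_iff)
  have f: "f y * y ^ n = y ^ i" if "y \<noteq> 0" for y
    using scaled[OF that, of i] i nz[OF that] by (simp add: field_simps)
  have small: "k = 1" if k: "\<And>x y. x \<noteq> 0 \<Longrightarrow> y \<noteq> 0 \<Longrightarrow> x ^ k = y ^ k \<Longrightarrow> f x = f y" for k :: nat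
  proof (rule ccontr)
    assume "k \<noteq> 1"
    then consider "k = 0" | "k \<ge> 2" by linarith
    then have "\<exists>r :: 'K. r \<noteq> 0 \<and> r \<noteq> 1 \<and> r ^ k = 1"
    proof cases
      case 1
      then show ?thesis by (intro exI[of _ 2]) auto
    qed (rule ex_nontrivial_root_of_unity)
    then obtain r :: 'K where r: "r \<noteq> 0" "r \<noteq> 1" "r ^ k = 1" by blast
    then have "f r = f 1" by (intro k) auto
    then have "r = 1" using inj r(1) by (auto dest: inj_onD)
    then show False using r(2) by simp
  qed
  show ?thesis
  proof (cases "n \<le> i")
    case True
    have f': "f y = y ^ (i - n)" if "y \<noteq> 0" for y
    proof -
      have "f y * y ^ n = y ^ (i - n) * y ^ n" using f[OF that] True by (simp flip: power_add)
      then show ?thesis using that by simp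
    qed
    then have "i - n = 1" by (intro small) simp
    then show ?thesis using f' by simp
  next
    case False
    have f': "f y * y ^ (n - i) = 1" if "y \<noteq> 0" for y
    proof -
      have "f y * y ^ (n - i) * y ^ i = 1 * y ^ i"
        using f[OF that] False by (simp add: mult.assoc flip: power_add)
      then show ?thesis using that by simp
    qed
    then have f'': "f y = inverse (y ^ (n - i))" if "y \<noteq> 0" for y
      using inverse_unique[of "y ^ (n - i)" "f y"] that by (simp add: mult.commute)
    then have "n - i = 1" by (intro small) simp
    then show ?thesis using f'' by simp
  qed
qed

text \<open>
  The composition of the inverse of \<open>\<phi>\<close> with the conjugate of \<open>\<phi>\<close> under \<open>\<sigma>\<close> is a multiplicative bijection
  \<open>f\<close>. Conjugating the coefficients of a fraction for \<open>\<phi>\<close> gives a fraction for its conjugate, so \<open>f\<close> is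
  rational near \<open>1\<close> and \<open>rational_character\<close> applies.
\<close>

lemma galois_twist_of_character:
  fixes A :: "('a, 'K::{alg_closed_field,field_char_0}, 'n::finite) atlas"
  assumes H: "algebraic_group F A H" and \<phi>: "\<phi> \<in> iso H Gm" "isomorphism UNIV A Gm_atlas \<phi>"
    and \<sigma>: "field_aut \<sigma>" and fix_F: "\<And>a. a \<in> F \<Longrightarrow> \<sigma> a = a" and s: "galois_lift \<sigma> A s"
  shows "(\<forall>h\<in>carrier H. \<phi> (s h) = \<sigma> (\<phi> h)) \<or> (\<forall>h\<in>carrier H. \<phi> (s h) = inverse (\<sigma> (\<phi> h)))"
proof -
  have var: "variety F A" and group: "group H" and carrier: "carrier H = points A"
    and mult_mor: "morphism F (prod_variety A A) A (\<lambda>(x, y). x \<otimes>\<^bsub>H\<^esub> y)"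
    using H by (auto simp: algebraic_group_def)
  interpret group H by fact
  note charts = variety_affine_charts[OF var]
  have mor: "morphism UNIV A Gm_atlas \<phi>" and mor_inv: "morphism UNIV Gm_atlas A (inv_into (points A) \<phi>)"
    and bij: "bij_betw \<phi> (points A) {x. x \<noteq> 0}"
    using \<phi>(2) by (auto simp: isomorphism_def)
  define \<psi> where "\<psi> = inv_into (points A) \<phi>"
  have \<psi>: "\<psi> x \<in> points A" "\<phi> (\<psi> x) = x" if "x \<noteq> 0" for x
    using bij_betw_inv_into_right[OF bij] bij_betwE[OF bij_betw_inv_into[OF bij]] that by (auto simp: \<psi>_def)
  have \<psi>_\<phi>: "\<psi> (\<phi> h) = h" if "h \<in> points A" for h
    using bij_betw_inv_into_left[OF bij that] by (simp add: \<psi>_def)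
  have \<phi>_nz: "\<phi> h \<noteq> 0" if "h \<in> points A" for h using bij_betwE[OF bij] that by blast
  have \<phi>_inj: "h = h'" if "\<phi> h = \<phi> h'" "h \<in> points A" "h' \<in> points A" for h h'
    using \<psi>_\<phi> that by metis
  have \<phi>_mult: "\<phi> (g \<otimes>\<^bsub>H\<^esub> h) = \<phi> g * \<phi> h" if "g \<in> points A" "h \<in> points A" for g h
    using \<phi>(1) that by (auto simp: iso_def hom_def Gm_def carrier)
  let ?i = "inv_into UNIV \<sigma>"
  have inv_fix: "?i a = a" if "a \<in> F" for a
    using field_autD(13)[OF \<sigma>, of a] fix_F[OF that] by simp
  obtain s' where s': "galois_lift ?i A s'"
    using ex_galois_lift[OF var field_aut_inv[OF \<sigma>] inv_fix] by blast
  have s'_s: "s' (s h) = h" "s (s' h) = h" if "h \<in> points A" for h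
  proof -
    have "?i \<circ> \<sigma> = id" "\<sigma> \<circ> ?i = id" by (auto simp: fun_eq_iff field_autD[OF \<sigma>])
    then have "galois_lift id A (s' \<circ> s)" "galois_lift id A (s \<circ> s')"
      using galois_lift_comp[OF s' s] galois_lift_comp[OF s s'] by simp_all
    then show "s' (s h) = h" "s (s' h) = h"
      using galois_lift_unique[OF charts _ galois_lift_id that] by fastforce+
  qed
  have s'_points: "s' h \<in> points A" if "h \<in> points A" for h
    using galois_lift_points[OF s' that] .
  have s'_mult: "s' (g \<otimes>\<^bsub>H\<^esub> h) = s' g \<otimes>\<^bsub>H\<^esub> s' h" if "g \<in> points A" "h \<in> points A" for g h
    using morphism_galois_equivariant[OF mult_mor field_aut_inv[OF \<sigma>] inv_fix
        affine_charts_prod[OF charts charts] galois_lift_prod[OF s' s'] charts s', of "(g, h)"] that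
    by (simp add: points_prod)
  define f where "f x = \<sigma> (\<phi> (s' (\<psi> x)))" for x
  have "(\<forall>x. x \<noteq> 0 \<longrightarrow> f x = x) \<or> (\<forall>x. x \<noteq> 0 \<longrightarrow> f x = inverse x)"
  proof -
    have f_mult: "f (x * y) = f x * f y" if "x \<noteq> 0" "y \<noteq> 0" for x y
    proof -
      have "\<psi> (x * y) = \<psi> x \<otimes>\<^bsub>H\<^esub> \<psi> y"
      proof (rule \<phi>_inj)
        show "\<psi> x \<otimes>\<^bsub>H\<^esub> \<psi> y \<in> points A" using \<psi>(1) that m_closed carrier by simp
      qed (use \<psi> that \<phi>_mult in auto)
      then show ?thesis
        using \<psi>(1) that by (simp add: f_def s'_mult \<phi>_mult s'_points field_autD[OF \<sigma>])
    qed
    have f_nz: "f x \<noteq> 0" if "x \<noteq> 0" for x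
      using \<phi>_nz[OF s'_points[OF \<psi>(1)[OF that]]] by (simp add: f_def field_autD[OF \<sigma>])
    have f_inj: "inj_on f {x. x \<noteq> 0}"
    proof (rule inj_onI)
      fix x y assume xy: "x \<in> {x. x \<noteq> 0}" "y \<in> {x. x \<noteq> 0}" "f x = f y"
      then have "\<phi> (s' (\<psi> x)) = \<phi> (s' (\<psi> y))" by (simp add: f_def field_autD[OF \<sigma>])
      then have "s' (\<psi> x) = s' (\<psi> y)" using xy \<psi>(1) s'_points by (intro \<phi>_inj) auto
      then have "\<psi> x = \<psi> y" using s'_s(2) \<psi>(1) xy by (metis mem_Collect_eq)
      then show "x = y" using \<psi>(2) xy by (metis mem_Collect_eq)
    qed
    define v :: "'K \<Rightarrow> 'K ^ 2" where "v x = vector [x, inverse x]" for x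
    have v1: "v x $ 1 = x" for x by (simp add: v_def)
    have v_inj: "inj v" by (rule injI) (metis v1)
    have Gm_mem: "({x. x \<noteq> 0}, v) \<in> Gm_atlas" by (simp add: Gm_atlas_def v_def[abs_def])
    have one: "\<one>\<^bsub>H\<^esub> \<in> points A" using carrier one_closed by simp
    then obtain U c where U: "(U, c) \<in> A" "\<one>\<^bsub>H\<^esub> \<in> U" by (rule in_pointsE)
    note c_inj = affine_chartsD(1)[OF charts U(1)]
    have U_points: "h \<in> points A" if "h \<in> U" for h using in_pointsI[OF U(1) that] .
    define D where "D = v ` {x \<in> {x. x \<noteq> 0}. \<psi> x \<in> U}"
    have reg_\<psi>: "regular_on UNIV D (\<lambda>y. c (\<psi> (y $ 1)) $ j)" for j
    proof -
      have "regular_on UNIV D (\<lambda>y. c (\<psi> (inv_into {x. x \<noteq> 0} v y)) $ j)"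
        unfolding D_def \<psi>_def by (rule morphismD(3)[OF mor_inv Gm_mem U(1)])
      moreover have "inv_into {x. x \<noteq> 0} v y = y $ 1" if "y \<in> D" for y
        using that inv_into_f_f[OF inj_on_subset[OF v_inj subset_UNIV]] by (auto simp: D_def v1)
      ultimately show ?thesis by (subst (asm) regular_on_cong) auto
    qed
    have reg_\<phi>: "regular_on UNIV (c ` U) (\<lambda>y. \<phi> (inv_into U c y))"
    proof -
      have "{x \<in> U. \<phi> x \<in> {x. x \<noteq> 0}} = U" using \<phi>_nz U_points by auto
      then show ?thesis using morphismD(3)[OF mor U(1) Gm_mem, of 1] by (simp add: v1)
    qed
    have "vec_map ?i y \<in> c ` U" if "y \<in> c ` U" for y
      using that galois_liftD[OF s' U(1)] by (metis image_iff)
    from regular_on_conjugate[OF reg_\<phi> \<sigma> this]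
    have reg_conj: "regular_on UNIV (c ` U) (\<lambda>y. \<sigma> (\<phi> (inv_into U c (vec_map ?i y))))" .
    have in_U: "c (\<psi> (y $ 1)) \<in> c ` U" if "y \<in> D" for y
      using that by (auto simp: D_def v1)
    have "regular_on UNIV D (\<lambda>y. \<sigma> (\<phi> (inv_into U c (vec_map ?i (c (\<psi> (y $ 1)))))))"
      by (rule regular_on_compose[where g = "\<lambda>y. c (\<psi> (y $ 1))", OF reg_\<psi> in_U reg_conj UNIV_I])
    moreover have "\<sigma> (\<phi> (inv_into U c (vec_map ?i (c (\<psi> (y $ 1)))))) = f (y $ 1)" if "y \<in> D" for y
    proof -
      have "\<psi> (y $ 1) \<in> U" using that by (auto simp: D_def v1)
      note sy = galois_liftD[OF s' U(1) this]
      show ?thesis unfolding sy(2)[symmetric] inv_into_f_f[OF c_inj sy(1)] f_def ..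
    qed
    ultimately have reg_f: "regular_on UNIV D (\<lambda>y. f (y $ 1))"
      by (subst (asm) regular_on_cong) auto
    have "\<phi> \<one>\<^bsub>H\<^esub> * \<phi> \<one>\<^bsub>H\<^esub> = \<phi> \<one>\<^bsub>H\<^esub>" using \<phi>_mult[OF one one] one_closed by simp
    then have "\<phi> \<one>\<^bsub>H\<^esub> = 1" using \<phi>_nz[OF one] by simp
    then have "\<psi> 1 = \<one>\<^bsub>H\<^esub>" using \<psi>_\<phi>[OF one] by simp
    then have v1_D: "v 1 \<in> D" using U(2) by (auto simp: D_def)
    obtain Z where Z: "zariski_closed UNIV Z" "D = v ` {x. x \<noteq> 0} - Z"
      using morphismD(2)[OF mor_inv Gm_mem U(1)] unfolding zariski_open_in_def D_def \<psi>_def by blast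
    obtain r where r: "r \<in> poly_fun UNIV" "\<And>y. y \<in> Z \<Longrightarrow> r y = 0" "r (v 1) \<noteq> 0"
      using Z v1_D unfolding zariski_closed_def by blast
    obtain p q where pq: "p \<in> poly_fun UNIV" "q \<in> poly_fun UNIV" "q (v 1) \<noteq> 0"
      "\<And>y. y \<in> D \<Longrightarrow> q y \<noteq> 0 \<Longrightarrow> f (y $ 1) = p y / q y"
      using reg_f v1_D unfolding regular_on_def by blast
    obtain N Q where Q: "\<And>x. x \<noteq> 0 \<Longrightarrow> x ^ N * (q (v x) * r (v x)) = poly Q x"
      using laurent_numerator[OF poly_fun.mult[OF pq(2) r(1)]] unfolding v_def by blast
    obtain M P where P: "\<And>x. x \<noteq> 0 \<Longrightarrow> x ^ M * (p (v x) * r (v x)) = poly P x"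
      using laurent_numerator[OF poly_fun.mult[OF pq(1) r(1)]] unfolding v_def by blast
    show ?thesis
    proof (rule rational_character[OF f_mult f_nz f_inj])
      have "poly (monom 1 M * Q) 1 \<noteq> 0" using Q[of 1] pq(3) r(3) by (simp add: poly_monom flip: Q)
      then show "monom 1 M * Q \<noteq> 0" by (metis poly_0)
      fix x :: 'K assume x: "x \<noteq> 0" "poly (monom 1 M * Q) x \<noteq> 0"
      then have nz: "q (v x) \<noteq> 0" "r (v x) \<noteq> 0" using Q[OF x(1)] by (auto simp: poly_monom)
      then have "v x \<in> D" using Z(2) r(2) x(1) by blast
      then have fx: "f x = p (v x) / q (v x)" using pq(4)[of "v x"] nz(1) by (simp add: v1)
      show "f x * poly (monom 1 M * Q) x = poly (monom 1 N * P) x"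
        using nz(1) by (simp add: fx poly_monom flip: Q[OF x(1)] P[OF x(1)])
    qed
  qed
  moreover have "f (\<phi> (s h)) = \<sigma> (\<phi> h)" "\<phi> (s h) \<noteq> 0" if "h \<in> carrier H" for h
    using that galois_lift_points[OF s] \<psi>_\<phi> s'_s(1) \<phi>_nz by (auto simp: f_def carrier)
  ultimately show ?thesis
  proof (elim disjE, goal_cases)
    case 1
    then show ?case by metis
  next
    case 2
    then have "\<phi> (s h) = inverse (\<sigma> (\<phi> h))" if "h \<in> carrier H" for h
      using that by (metis inverse_inverse_eq)
    then show ?case by blast
  qed
qed

text \<open>
  The automorphisms that fix \<open>\<phi>\<close> form a subgroup \<open>N\<close> of index at most 2. If its fixed field were that of \<open>G\<close>,
  then \<open>\<phi>\<close> and its inverse would descend, and \<open>H\<close> would be split. So there is an element \<open>z\<close> fixed by \<open>N\<close>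
  and moved by some \<open>\<tau>\<close>, and \<open>\<delta> = z - \<tau> z\<close> changes its sign under the automorphisms outside \<open>N\<close>.
\<close>

theorem anisotropic_character:
  fixes A :: "('a, 'K::{alg_closed_field,field_char_0}, 'n::finite) atlas"
  assumes G: "aut_group G" and H: "algebraic_group (fixed_field G) A H"
    and split: "algebraic_groups_isomorphic UNIV A H Gm_atlas Gm"
    and nonsplit: "\<not> algebraic_groups_isomorphic (fixed_field G) A H Gm_atlas Gm"
  obtains \<phi> and \<delta> and s where "\<phi> \<in> iso H Gm" "isomorphism UNIV A Gm_atlas \<phi>" "\<delta> \<noteq> 0"
    "\<And>\<sigma>. \<sigma> \<in> G \<Longrightarrow> galois_lift \<sigma> A (s \<sigma>)"
    "\<And>\<sigma>. \<sigma> \<in> G \<Longrightarrow> (\<sigma> \<delta> = \<delta> \<and> (\<forall>h\<in>carrier H. \<phi> (s \<sigma> h) = \<sigma> (\<phi> h))) \<or>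
       (\<sigma> \<delta> = - \<delta> \<and> (\<forall>h\<in>carrier H. \<phi> (s \<sigma> h) = inverse (\<sigma> (\<phi> h))))"
    "\<exists>\<sigma>\<in>G. \<sigma> \<delta> = - \<delta>"
proof -
  let ?F = "fixed_field G"
  have var: "variety ?F A" and carrier: "carrier H = points A"
    using H by (auto simp: algebraic_group_def)
  note charts = variety_affine_charts[OF var]
  obtain \<phi> where \<phi>: "\<phi> \<in> iso H Gm" "isomorphism UNIV A Gm_atlas \<phi>"
    using split by (auto simp: algebraic_groups_isomorphic_def)
  have mor: "morphism UNIV A Gm_atlas \<phi>" and mor_inv: "morphism UNIV Gm_atlas A (inv_into (points A) \<phi>)"
    and bij: "bij_betw \<phi> (points A) {x. x \<noteq> 0}"
    using \<phi>(2) by (auto simp: isomorphism_def)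
  have "\<exists>s. \<forall>\<sigma>\<in>G. galois_lift \<sigma> A (s \<sigma>)"
    by (intro bchoice ballI ex_galois_lift[OF var] aut_groupD[OF G] fixed_fieldD)
  then obtain s where s: "\<And>\<sigma>. \<sigma> \<in> G \<Longrightarrow> galois_lift \<sigma> A (s \<sigma>)" by blast
  have s_points: "s \<sigma> h \<in> points A" if "\<sigma> \<in> G" "h \<in> points A" for \<sigma> h
    using galois_lift_points[OF s] that by blast
  have s_comp: "s (\<sigma> \<circ> \<tau>) h = s \<sigma> (s \<tau> h)" if "\<sigma> \<in> G" "\<tau> \<in> G" "h \<in> points A" for \<sigma> \<tau> h
    using galois_lift_unique[OF charts s galois_lift_comp[OF s s]] that aut_groupD(4)[OF G] by force
  have s_id: "s id h = h" if "h \<in> points A" for h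
    using galois_lift_unique[OF charts s[OF aut_groupD(1)[OF G]] galois_lift_id that] by simp
  define pos where "pos \<sigma> \<longleftrightarrow> (\<forall>h\<in>points A. \<phi> (s \<sigma> h) = \<sigma> (\<phi> h))" for \<sigma>
  define neg where "neg \<sigma> \<longleftrightarrow> (\<forall>h\<in>points A. \<phi> (s \<sigma> h) = inverse (\<sigma> (\<phi> h)))" for \<sigma>
  have pos_neg: "pos \<sigma> \<or> neg \<sigma>" if "\<sigma> \<in> G" for \<sigma>
    unfolding pos_def neg_def
    using galois_twist_of_character[OF H \<phi> aut_groupD(2)[OF G that] fixed_fieldD[OF _ that] s[OF that]]
    by (simp add: carrier)
  have sign: "pos \<sigma> \<Longrightarrow> pos \<tau> \<Longrightarrow> pos (\<sigma> \<circ> \<tau>)" "neg \<sigma> \<Longrightarrow> neg \<tau> \<Longrightarrow> pos (\<sigma> \<circ> \<tau>)"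
    "pos \<sigma> \<Longrightarrow> neg \<tau> \<Longrightarrow> neg (\<sigma> \<circ> \<tau>)" if "\<sigma> \<in> G" "\<tau> \<in> G" for \<sigma> \<tau>
    using that s_comp s_points field_autD(7)[OF aut_groupD(2)[OF G that(1)]]
    by (simp_all add: pos_def neg_def)
  have inverse: "s \<sigma> (s (inv_into UNIV \<sigma>) h) = h" if "\<sigma> \<in> G" "h \<in> points A" for \<sigma> h
  proof -
    have "\<sigma> \<circ> inv_into UNIV \<sigma> = id"
      by (simp add: fun_eq_iff field_autD[OF aut_groupD(2)[OF G that(1)]])
    then show ?thesis
      using s_comp[OF that(1) aut_groupD(3)[OF G that(1)] that(2)] s_id[OF that(2)] by simp
  qed
  have pos_inv: "pos (inv_into UNIV \<sigma>)" if "\<sigma> \<in> G" "pos \<sigma>" for \<sigma>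
    unfolding pos_def
  proof
    fix h assume h: "h \<in> points A"
    have "\<phi> h = \<sigma> (\<phi> (s (inv_into UNIV \<sigma>) h))"
      using that(2) inverse[OF that(1) h] s_points[OF aut_groupD(3)[OF G that(1)] h] unfolding pos_def by metis
    then show "\<phi> (s (inv_into UNIV \<sigma>) h) = inv_into UNIV \<sigma> (\<phi> h)"
      by (simp add: field_autD[OF aut_groupD(2)[OF G that(1)]])
  qed
  have neg_inv: "neg (inv_into UNIV \<sigma>)" if "\<sigma> \<in> G" "neg \<sigma>" for \<sigma>
    unfolding neg_def
  proof
    fix h assume h: "h \<in> points A"
    note \<sigma> = field_autD[OF aut_groupD(2)[OF G that(1)]]
    have "\<phi> h = inverse (\<sigma> (\<phi> (s (inv_into UNIV \<sigma>) h)))"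
      using that(2) inverse[OF that(1) h] s_points[OF aut_groupD(3)[OF G that(1)] h] unfolding neg_def by metis
    also have "\<dots> = \<sigma> (inverse (\<phi> (s (inv_into UNIV \<sigma>) h)))" by (simp add: \<sigma>)
    finally have "inv_into UNIV \<sigma> (\<phi> h) = inverse (\<phi> (s (inv_into UNIV \<sigma>) h))" by (simp only: \<sigma>(13))
    then show "\<phi> (s (inv_into UNIV \<sigma>) h) = inverse (inv_into UNIV \<sigma> (\<phi> h))" by simp
  qed
  define N where "N = {\<sigma> \<in> G. pos \<sigma>}"
  have N: "aut_group N"
    unfolding aut_group_def
  proof (intro conjI ballI)
    show "id \<in> N" using aut_groupD(1)[OF G] s_id by (simp add: N_def pos_def)
  qed (use aut_groupD[OF G] pos_inv sign(1) in \<open>auto simp: N_def\<close>)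
  have "fixed_field N \<noteq> ?F"
  proof
    assume eq: "fixed_field N = ?F"
    have equiv: "\<phi> (s \<sigma> h) = \<sigma> (\<phi> h)" if "\<sigma> \<in> N" "h \<in> points A" for \<sigma> h
      using that by (simp add: N_def pos_def)
    have s_N: "galois_lift \<sigma> A (s \<sigma>)" if "\<sigma> \<in> N" for \<sigma> using that s by (simp add: N_def)
    have lift_Gm: "galois_lift \<sigma> Gm_atlas \<sigma>" if "\<sigma> \<in> N" for \<sigma> :: "'K \<Rightarrow> 'K"
      using galois_lift_Gm aut_groupD(2)[OF N that] by blast
    have "morphism ?F A Gm_atlas \<phi>"
      unfolding eq[symmetric]
    proof (rule morphism_descent[where s = s and t = "\<lambda>\<sigma>. \<sigma>", OF N mor charts])
      show "galois_lift \<sigma> A (s \<sigma>)" if "\<sigma> \<in> N" for \<sigma> using that by (rule s_N)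
      show "galois_lift \<sigma> Gm_atlas \<sigma>" if "\<sigma> \<in> N" for \<sigma> :: "'K \<Rightarrow> 'K" using that by (rule lift_Gm)
      show "\<phi> (s \<sigma> h) = \<sigma> (\<phi> h)" if "\<sigma> \<in> N" "h \<in> points A" for \<sigma> h using that by (rule equiv)
    qed
    moreover have "morphism ?F Gm_atlas A (inv_into (points A) \<phi>)"
      unfolding eq[symmetric]
    proof (rule morphism_descent[where s = "\<lambda>\<sigma>. \<sigma>" and t = s, OF N mor_inv affine_charts_Gm])
      show "galois_lift \<sigma> A (s \<sigma>)" if "\<sigma> \<in> N" for \<sigma> using that by (rule s_N)
      show "galois_lift \<sigma> Gm_atlas \<sigma>" if "\<sigma> \<in> N" for \<sigma> :: "'K \<Rightarrow> 'K" using that by (rule lift_Gm)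
      show "inv_into (points A) \<phi> (\<sigma> x) = s \<sigma> (inv_into (points A) \<phi> x)"
        if \<sigma>: "\<sigma> \<in> N" and x: "x \<in> points Gm_atlas" for \<sigma> x
      proof -
        have h: "inv_into (points A) \<phi> x \<in> points A" "\<phi> (inv_into (points A) \<phi> x) = x"
          using bij_betw_inv_into_right[OF bij] bij_betwE[OF bij_betw_inv_into[OF bij]] x by auto
        have "s \<sigma> (inv_into (points A) \<phi> x) \<in> points A"
          using galois_lift_points[OF s_N[OF \<sigma>] h(1)] .
        from bij_betw_inv_into_left[OF bij this] show ?thesis
          by (simp add: equiv[OF \<sigma> h(1)] h(2))
      qed
    qed
    ultimately have "algebraic_groups_isomorphic ?F A H Gm_atlas Gm"
      using \<phi>(1) bij by (auto simp: algebraic_groups_isomorphic_def isomorphism_def)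
    then show False using nonsplit by simp
  qed
  moreover have "?F \<subseteq> fixed_field N" by (auto simp: fixed_field_def N_def)
  ultimately obtain z where z: "z \<in> fixed_field N" "z \<notin> ?F" by blast
  then obtain \<tau> where \<tau>: "\<tau> \<in> G" "\<tau> z \<noteq> z" by (auto simp: fixed_field_def)
  have z_pos: "\<sigma> z = z" if "\<sigma> \<in> G" "pos \<sigma>" for \<sigma>
    using z(1) that by (auto simp: fixed_field_def N_def)
  have neg_\<tau>: "neg \<tau>" using pos_neg[OF \<tau>(1)] z_pos[OF \<tau>(1)] \<tau>(2) by blast
  note \<tau>_inv = aut_groupD(3)[OF G \<tau>(1)] neg_inv[OF \<tau>(1) neg_\<tau>]
  define \<delta> where "\<delta> = z - \<tau> z"
  have move: "\<sigma> (\<tau> z) = \<tau> z" if \<sigma>: "\<sigma> \<in> G" "pos \<sigma>" for \<sigma>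
  proof -
    \<comment> \<open>\<open>N\<close> is normal: \<open>\<tau>\<close> conjugates \<open>\<sigma>\<close> into \<open>N\<close>, which fixes \<open>z\<close>\<close>
    have mem: "\<sigma> \<circ> \<tau> \<in> G" "neg (\<sigma> \<circ> \<tau>)" using \<sigma> \<tau>(1) neg_\<tau> sign(3) aut_groupD(4)[OF G] by blast+
    have "inv_into UNIV \<tau> \<circ> (\<sigma> \<circ> \<tau>) \<in> G" "pos (inv_into UNIV \<tau> \<circ> (\<sigma> \<circ> \<tau>))"
      using mem \<tau>_inv sign(2) aut_groupD(4)[OF G] by blast+
    from z_pos[OF this] have "inv_into UNIV \<tau> (\<sigma> (\<tau> z)) = z" by simp
    then show ?thesis using field_autD(12)[OF aut_groupD(2)[OF G \<tau>(1)], of "\<sigma> (\<tau> z)"] by simp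
  qed
  have swap: "\<sigma> z = \<tau> z \<and> \<sigma> (\<tau> z) = z" if \<sigma>: "\<sigma> \<in> G" "neg \<sigma>" for \<sigma>
  proof -
    have "\<sigma> \<circ> \<tau> \<in> G" "pos (\<sigma> \<circ> \<tau>)" using \<sigma> \<tau>(1) neg_\<tau> sign(2) aut_groupD(4)[OF G] by blast+
    from z_pos[OF this] have "\<sigma> (\<tau> z) = z" by simp
    have "inv_into UNIV \<tau> \<circ> \<sigma> \<in> G" "pos (inv_into UNIV \<tau> \<circ> \<sigma>)"
      using \<sigma> \<tau>_inv sign(2) aut_groupD(4)[OF G] by blast+
    from z_pos[OF this] have "inv_into UNIV \<tau> (\<sigma> z) = z" by simp
    then have "\<sigma> z = \<tau> z" using field_autD(12)[OF aut_groupD(2)[OF G \<tau>(1)], of "\<sigma> z"] by simp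
    with \<open>\<sigma> (\<tau> z) = z\<close> show ?thesis by simp
  qed
  show ?thesis
  proof (rule that[OF \<phi> _ s])
    show "\<delta> \<noteq> 0" using \<tau>(2) by (simp add: \<delta>_def)
    show "(\<sigma> \<delta> = \<delta> \<and> (\<forall>h\<in>carrier H. \<phi> (s \<sigma> h) = \<sigma> (\<phi> h))) \<or>
       (\<sigma> \<delta> = - \<delta> \<and> (\<forall>h\<in>carrier H. \<phi> (s \<sigma> h) = inverse (\<sigma> (\<phi> h))))" if \<sigma>: "\<sigma> \<in> G" for \<sigma>
    proof -
      note \<sigma>_diff = field_autD(6)[OF aut_groupD(2)[OF G \<sigma>]]
      show ?thesis
      proof (cases "pos \<sigma>")
        case True
        then show ?thesis using z_pos[OF \<sigma>] move[OF \<sigma>] by (simp add: \<delta>_def \<sigma>_diff pos_def carrier)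
      next
        case False
        then have "neg \<sigma>" using pos_neg[OF \<sigma>] by blast
        then show ?thesis using swap[OF \<sigma>] by (simp add: \<delta>_def \<sigma>_diff neg_def carrier)
      qed
    qed
    show "\<exists>\<sigma>\<in>G. \<sigma> \<delta> = - \<delta>"
      using swap[OF \<tau>(1) neg_\<tau>] \<tau>(1) by (intro bexI[of _ \<tau>])
        (auto simp: \<delta>_def field_autD(6)[OF aut_groupD(2)[OF G \<tau>(1)]])
  qed
qed

section \<open>A twisted torus action on four-space\<close>

definition vec4 :: "'K \<Rightarrow> 'K \<Rightarrow> 'K \<Rightarrow> 'K \<Rightarrow> 'K ^ 4" where
  "vec4 a b u v = (\<chi> i. if i = 1 then a else if i = 2 then b else if i = 3 then u else v)"

lemma vec4_nth [simp]: "vec4 a b u v $ 1 = a" "vec4 a b u v $ 2 = b" "vec4 a b u v $ 3 = u" "vec4 a b u v $ 4 = v"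
  by (simp_all add: vec4_def)

lemma vec_eq_iff_4: "x = y \<longleftrightarrow> x $ 1 = y $ 1 \<and> x $ 2 = y $ 2 \<and> x $ 3 = y $ 3 \<and> x $ (4::4) = y $ 4"
  by (simp add: vec_eq_iff forall_4)

text \<open>
  The columns \<open>(frame11, frame21)\<close> and \<open>(frame12, frame22)\<close> are a basis of the polynomial vectors in two
  variables that is adapted to the involution in \<open>frame_swap\<close>, that is, to exchanging the variables and
  multiplying by the matrix of \<open>reflection\<close> on the coordinates \<open>u\<close> and \<open>v\<close>: the first column is invariant, the
  second one changes sign, and the determinant is constant. The two columns come from generators of the
  invariant vectors and of the anti-invariant ones, by division with remainder along the line \<open>a = b\<close>.
\<close>

definition frame11 :: "'K::field \<Rightarrow> 'K \<Rightarrow> 'K" where "frame11 a b = 1 + 2 * a - b + a * b + a * a * (a - b) * (a - b)"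
definition frame21 :: "'K::field \<Rightarrow> 'K \<Rightarrow> 'K" where "frame21 a b = 1 - a + 2 * b + b * (a - b) * (a - b)"
definition frame12 :: "'K::field \<Rightarrow> 'K \<Rightarrow> 'K" where
  "frame12 a b = 2 - (a + b) + a * (a + b) - (a + b - 1) * a * a * (a - b)"
definition frame22 :: "'K::field \<Rightarrow> 'K \<Rightarrow> 'K" where
  "frame22 a b = (a + b) - 2 - (a + b - 1) * b * (a - b)"

lemma frame_det: "frame11 a b * frame22 a b - frame12 a b * frame21 a b = - 4" for a b :: "'K::field_char_0"
  unfolding frame11_def frame22_def frame12_def frame21_def by (simp add: algebra_simps)

lemma frame_swap:
  fixes a b :: "'K::field_char_0"
  shows "frame11 a b = - (a ^ 3) * frame11 b a + (1 + a * b + (a * b) ^ 2) * frame21 b a"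
    "frame21 a b = (1 - a * b) * frame11 b a + b ^ 3 * frame21 b a"
    "- frame12 a b = - (a ^ 3) * frame12 b a + (1 + a * b + (a * b) ^ 2) * frame22 b a"
    "- frame22 a b = (1 - a * b) * frame12 b a + b ^ 3 * frame22 b a"
  unfolding frame11_def frame22_def frame12_def frame21_def power2_eq_square power3_eq_cube by (simp_all add: algebra_simps)

text \<open>
  The source carries the coordinates over the ground field and the target those in which the torus is
  diagonal. If \<open>\<sigma> \<delta> = - \<delta>\<close>, then conjugation by \<open>\<sigma>\<close> on the source corresponds on the target to conjugation
  followed by \<open>reflection\<close>; this is the reason for the factor \<open>\<delta>\<close> at the anti-invariant column.
\<close>

definition straighten :: "'K::field \<Rightarrow> 'K ^ 4 \<Rightarrow> 'K ^ 4" where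
  "straighten \<delta> x =
    (let a = x $ 1 + \<delta> * x $ 2; b = x $ 1 - \<delta> * x $ 2
     in vec4 a b (frame11 a b * x $ 3 + \<delta> * frame12 a b * x $ 4) (frame21 a b * x $ 3 + \<delta> * frame22 a b * x $ 4))"

definition unstraighten :: "'K::field \<Rightarrow> 'K ^ 4 \<Rightarrow> 'K ^ 4" where
  "unstraighten \<delta> y =
    (let a = y $ 1; b = y $ 2
     in vec4 ((a + b) / 2) ((a - b) / (2 * \<delta>))
          ((frame12 a b * y $ 4 - frame22 a b * y $ 3) / 4) ((frame21 a b * y $ 3 - frame11 a b * y $ 4) / (4 * \<delta>)))"

text \<open>
  The weights of the first two coordinates are even and those of the last two are odd, so the plane on
  which the last two vanish is the set of fixed points of \<open>-1\<close>.
\<close>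

definition weight_act :: "'K::field \<Rightarrow> 'K ^ 4 \<Rightarrow> 'K ^ 4" where
  "weight_act z y = vec4 (z * z * y $ 1) (inverse z * inverse z * y $ 2)
     (z * z * z * y $ 3) (inverse z * inverse z * inverse z * y $ 4)"

text \<open>
  Together with \<open>weight_act\<close>, this generates an action of the orthogonal group \<open>O_2\<close>. It is linear on the
  fibres of the projection to the first two coordinates. The matrix there has determinant \<open>-1\<close>, because
  \<open>(1 + t + t^2) (1 - t) = 1 - t^3\<close>.
\<close>

definition reflection :: "'K::field ^ 4 \<Rightarrow> 'K ^ 4" where
  "reflection y = (let a = y $ 1; b = y $ 2; t = a * b
     in vec4 b a (- (b ^ 3) * y $ 3 + (1 + t + t ^ 2) * y $ 4) ((1 - t) * y $ 3 + a ^ 3 * y $ 4))"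

lemma straighten_unstraighten:
  fixes \<delta> :: "'K::field_char_0"
  assumes "\<delta> \<noteq> 0" shows "straighten \<delta> (unstraighten \<delta> y) = y"
proof -
  define a b u v where "a = y $ 1" and "b = y $ 2" and "u = y $ 3" and "v = y $ 4"
  have ab: "(a + b) / 2 + \<delta> * ((a - b) / (2 * \<delta>)) = a" "(a + b) / 2 - \<delta> * ((a - b) / (2 * \<delta>)) = b"
    using assms by (simp_all add: field_simps)
  note det = frame_det[of a b]
  have 3: "frame11 a b * ((frame12 a b * v - frame22 a b * u) / 4) + \<delta> * frame12 a b * ((frame21 a b * u - frame11 a b * v) / (4 * \<delta>))
      = - (frame11 a b * frame22 a b - frame12 a b * frame21 a b) / 4 * u"
    using assms by (simp add: field_simps)
  have 4: "frame21 a b * ((frame12 a b * v - frame22 a b * u) / 4) + \<delta> * frame22 a b * ((frame21 a b * u - frame11 a b * v) / (4 * \<delta>))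
      = - (frame11 a b * frame22 a b - frame12 a b * frame21 a b) / 4 * v"
    using assms by (simp add: field_simps)
  show ?thesis
    unfolding vec_eq_iff_4 straighten_def unstraighten_def Let_def vec4_nth
    unfolding a_def[symmetric] b_def[symmetric] u_def[symmetric] v_def[symmetric] ab 3 4 det by simp
qed

lemma unstraighten_straighten:
  fixes \<delta> :: "'K::field_char_0"
  assumes "\<delta> \<noteq> 0" shows "unstraighten \<delta> (straighten \<delta> x) = x"
proof -
  define a b where "a = x $ 1 + \<delta> * x $ 2" and "b = x $ 1 - \<delta> * x $ 2"
  note det = frame_det[of a b]
  have 1: "(a + b) / 2 = x $ 1" by (simp add: a_def b_def)
  have 2: "(a - b) / (2 * \<delta>) = x $ 2" using assms by (simp add: a_def b_def)
  have 3: "(frame12 a b * (frame21 a b * r + \<delta> * frame22 a b * s) - frame22 a b * (frame11 a b * r + \<delta> * frame12 a b * s)) / 4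
      = - (frame11 a b * frame22 a b - frame12 a b * frame21 a b) / 4 * r" for r s
    by (simp add: field_simps)
  have 4: "(frame21 a b * (frame11 a b * r + \<delta> * frame12 a b * s) - frame11 a b * (frame21 a b * r + \<delta> * frame22 a b * s)) / (4 * \<delta>)
      = - (frame11 a b * frame22 a b - frame12 a b * frame21 a b) / 4 * s" for r s
    using assms by (simp add: field_simps)
  show ?thesis
    unfolding vec_eq_iff_4 straighten_def unstraighten_def Let_def vec4_nth
    unfolding a_def[symmetric] b_def[symmetric] 1 2 3 4 det by simp
qed

text \<open>
  Changing the sign of \<open>\<delta>\<close> exchanges \<open>a\<close> and \<open>b\<close>, so this is \<open>frame_swap\<close> in coordinates.
\<close>

lemma reflection_straighten:
  fixes \<delta> :: "'K::field_char_0"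
  shows "reflection (straighten (- \<delta>) x) = straighten \<delta> x"
proof -
  define a b where "a = x $ 1 + \<delta> * x $ 2" and "b = x $ 1 - \<delta> * x $ 2"
  have ab: "x $ 1 + - \<delta> * x $ 2 = b" "x $ 1 - - \<delta> * x $ 2 = a" by (simp_all add: a_def b_def)
  have 3: "- (a ^ 3) * (frame11 b a * r + - \<delta> * frame12 b a * s) + (1 + b * a + (b * a) ^ 2) * (frame21 b a * r + - \<delta> * frame22 b a * s)
      = frame11 a b * r + \<delta> * frame12 a b * s" for r s
  proof -
    have "frame11 a b * r + \<delta> * frame12 a b * s = frame11 a b * r - \<delta> * (- frame12 a b) * s" by simp
    then show ?thesis unfolding frame_swap(1,3)[of a b] by (simp add: algebra_simps)
  qed
  have 4: "(1 - b * a) * (frame11 b a * r + - \<delta> * frame12 b a * s) + b ^ 3 * (frame21 b a * r + - \<delta> * frame22 b a * s)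
      = frame21 a b * r + \<delta> * frame22 a b * s" for r s
  proof -
    have "frame21 a b * r + \<delta> * frame22 a b * s = frame21 a b * r - \<delta> * (- frame22 a b) * s" by simp
    then show ?thesis unfolding frame_swap(2,4)[of a b] by (simp add: algebra_simps)
  qed
  show ?thesis
    unfolding vec_eq_iff_4 straighten_def reflection_def Let_def vec4_nth
    unfolding ab a_def[symmetric] b_def[symmetric] 3 4 by simp
qed

lemma field_aut_numeral:
  assumes "field_aut \<sigma>" shows "\<sigma> (numeral k) = numeral k"
proof -
  have "\<sigma> (of_nat n) = of_nat n" for n by (induction n) (simp_all add: field_autD[OF assms])
  from this[of "numeral k"] show ?thesis by simp
qed

lemma vec_map_straighten:
  "field_aut \<sigma> \<Longrightarrow> vec_map \<sigma> (straighten \<delta> x) = straighten (\<sigma> \<delta>) (vec_map \<sigma> x)"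
  by (simp add: vec_eq_iff_4 straighten_def Let_def frame11_def frame12_def frame21_def frame22_def field_autD field_aut_numeral)

lemma vec_map_weight_act:
  "field_aut \<sigma> \<Longrightarrow> vec_map \<sigma> (weight_act z y) = weight_act (\<sigma> z) (vec_map \<sigma> y)"
  by (simp add: vec_eq_iff_4 weight_act_def field_autD)

lemma reflection_weight_act:
  "z \<noteq> 0 \<Longrightarrow> reflection (weight_act z y) = weight_act (inverse z) (reflection y)"
  by (simp add: vec_eq_iff_4 weight_act_def reflection_def Let_def field_simps power2_eq_square power3_eq_cube)

lemma weight_act_mult: "weight_act (z * w) y = weight_act z (weight_act w y)"
  by (simp add: vec_eq_iff_4 weight_act_def ac_simps)

lemma weight_act_1: "weight_act 1 y = y"
  by (simp add: vec_eq_iff_4 weight_act_def)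

text \<open>
  Like \<open>weight_act\<close>, but in the coordinates over the ground field.
\<close>

definition twisted_act :: "'K::field \<Rightarrow> 'K \<Rightarrow> 'K ^ 4 \<Rightarrow> 'K ^ 4" where
  "twisted_act \<delta> z x = unstraighten \<delta> (weight_act z (straighten \<delta> x))"

lemma straighten_galois:
  fixes \<delta> :: "'K::field_char_0"
  assumes "field_aut \<sigma>"
  shows "\<sigma> \<delta> = \<delta> \<Longrightarrow> straighten \<delta> (vec_map \<sigma> x) = vec_map \<sigma> (straighten \<delta> x)"
    and "\<sigma> \<delta> = - \<delta> \<Longrightarrow> straighten \<delta> (vec_map \<sigma> x) = reflection (vec_map \<sigma> (straighten \<delta> x))"
  by (simp_all add: vec_map_straighten[OF assms] reflection_straighten)

text \<open>
  An automorphism that inverts the character also applies \<open>reflection\<close> to the diagonal coordinates, and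
  \<open>reflection\<close> inverts the torus.
\<close>

lemma twisted_act_galois:
  fixes \<delta> :: "'K::field_char_0"
  assumes \<sigma>: "field_aut \<sigma>" and \<delta>: "\<delta> \<noteq> 0" and z: "z \<noteq> 0"
    and cases: "(\<sigma> \<delta> = \<delta> \<and> w = \<sigma> z) \<or> (\<sigma> \<delta> = - \<delta> \<and> w = inverse (\<sigma> z))"
  shows "twisted_act \<delta> w (vec_map \<sigma> x) = vec_map \<sigma> (twisted_act \<delta> z x)"
proof -
  have "weight_act w (straighten \<delta> (vec_map \<sigma> x)) = straighten \<delta> (vec_map \<sigma> (twisted_act \<delta> z x))"
    using cases
  proof
    assume *: "\<sigma> \<delta> = \<delta> \<and> w = \<sigma> z"
    then show ?thesis
      by (simp add: straighten_galois(1)[OF \<sigma>] twisted_act_def straighten_unstraighten[OF \<delta>] vec_map_weight_act[OF \<sigma>])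
  next
    assume *: "\<sigma> \<delta> = - \<delta> \<and> w = inverse (\<sigma> z)"
    then show ?thesis
      using reflection_weight_act[of "\<sigma> z"] z
      by (simp add: straighten_galois(2)[OF \<sigma>] twisted_act_def straighten_unstraighten[OF \<delta>]
          vec_map_weight_act[OF \<sigma>] field_autD[OF \<sigma>])
  qed
  then show ?thesis
    by (simp add: twisted_act_def[of \<delta> w] unstraighten_straighten[OF \<delta>])
qed

lemma poly_fun_straighten: "(\<lambda>x. straighten \<delta> x $ j) \<in> poly_fun UNIV"
proof -
  have "\<forall>j. (\<lambda>x. straighten \<delta> x $ j) \<in> poly_fun UNIV"
    unfolding forall_4 straighten_def Let_def vec4_nth frame11_def frame12_def frame21_def frame22_def
    by (intro conjI poly_fun.add poly_fun.mult poly_fun_diff poly_fun.const poly_fun.coord UNIV_I)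
  then show ?thesis by blast
qed

lemma poly_fun_unstraighten: "(\<lambda>x. unstraighten \<delta> x $ j) \<in> poly_fun UNIV"
proof -
  have "\<forall>j. (\<lambda>x. unstraighten \<delta> x $ j) \<in> poly_fun UNIV"
    unfolding forall_4 unstraighten_def Let_def vec4_nth frame11_def frame12_def frame21_def frame22_def divide_inverse
    by (intro conjI poly_fun.add poly_fun.mult poly_fun_diff poly_fun.const poly_fun.coord UNIV_I)
  then show ?thesis by blast
qed

lemma zariski_closed_empty: "1 \<in> F \<Longrightarrow> zariski_closed F {}"
  unfolding zariski_closed_def by (intro exI[of _ "{\<lambda>_. 1}"]) (auto intro: poly_fun.const)

lemma morphism_twisted_act:
  fixes A :: "('a, 'K::field_char_0, 'n::finite) atlas"
  assumes A: "affine_charts A" and \<phi>: "morphism UNIV A Gm_atlas \<phi>"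
  shows "morphism UNIV (prod_variety A affine_space) affine_space (\<lambda>(g, x). twisted_act \<delta> (\<phi> g) x)"
proof -
  define f where "f = (\<lambda>(g, x). twisted_act \<delta> (\<phi> g) x)"
  have \<phi>_nz: "\<phi> h \<noteq> 0" if "h \<in> points A" for h using morphismD(1)[OF \<phi> that] by simp
  have "zariski_open_in UNIV (b ` V) (b ` {x \<in> V. f x \<in> UNIV}) \<and>
      regular_map_on UNIV (b ` {x \<in> V. f x \<in> UNIV}) (id \<circ> f \<circ> inv_into V b)"
    if Vb: "(V, b) \<in> prod_variety A affine_space" for V b
  proof
    show "zariski_open_in UNIV (b ` V) (b ` {x \<in> V. f x \<in> UNIV})"
      unfolding zariski_open_in_def by (intro exI[of _ "{}"]) (simp add: zariski_closed_empty)
    have Vb_inj: "inj_on b V"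
      by (rule affine_chartsD(1)[OF affine_charts_prod[OF A affine_charts_affine_space] Vb])
    obtain U c where U: "(U, c) \<in> A" and V: "V = U \<times> UNIV" and b: "b = (\<lambda>(x, y). vec_pair (c x) y)"
      using Vb unfolding in_prod_variety_iff affine_space_def by auto
    define D where "D = b ` V"
    have D: "\<exists>g\<in>U. \<exists>x. y = vec_pair (c g) x \<and> inv_into V b y = (g, x)" if y: "y \<in> D" for y
    proof -
      obtain g x where gx: "g \<in> U" "y = b (g, x)" using y by (auto simp: D_def V)
      then have "inv_into V b y = (g, x)" using inv_into_f_f[OF Vb_inj, of "(g, x)"] by (simp add: V)
      then show ?thesis using gx by (auto simp: b)
    qed
    have U_points: "h \<in> points A" if "h \<in> U" for h using in_pointsI[OF U that] .
    have reg_\<phi>: "regular_on UNIV D (\<lambda>y. \<phi> (fst (inv_into V b y)))"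
    proof -
      have "{x \<in> U. \<phi> x \<in> {x. x \<noteq> 0}} = U" using \<phi>_nz U_points by auto
      then have "regular_on UNIV (c ` U) (\<lambda>y. \<phi> (inv_into U c y))"
        using morphismD(3)[OF \<phi> U, of "{x. x \<noteq> 0}" "\<lambda>x. vector [x, inverse x]" 1] by (simp add: Gm_atlas_def)
      moreover have "regular_on UNIV D (\<lambda>y. (\<chi> i. y $ Inl i) $ j)" for j :: 'n
        by (rule regular_on_poly_fun) (simp_all add: poly_fun.coord)
      moreover have "(\<chi> i. y $ Inl i) \<in> c ` U" if "y \<in> D" for y
        using D[OF that] by (auto simp: image_iff)
      ultimately have "regular_on UNIV D (\<lambda>y. \<phi> (inv_into U c (\<chi> i. y $ Inl i)))"
        by (intro regular_on_compose[where f = "\<lambda>y. \<phi> (inv_into U c y)" and g = "\<lambda>y. \<chi> i. y $ Inl i" and E = "c ` U"]) auto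
      moreover have "\<phi> (inv_into U c (\<chi> i. y $ Inl i)) = \<phi> (fst (inv_into V b y))" if "y \<in> D" for y
        using D[OF that] inv_into_f_f[OF affine_chartsD(1)[OF A U]] by auto
      ultimately show ?thesis by (subst (asm) regular_on_cong) auto
    qed
    have reg_inv: "regular_on UNIV D (\<lambda>y. inverse (\<phi> (fst (inv_into V b y))))"
    proof (rule regular_on_inverse[OF reg_\<phi>])
      show "\<phi> (fst (inv_into V b y)) \<noteq> 0" if "y \<in> D" for y
        using D[OF that] \<phi>_nz U_points by auto
    qed
    have reg_x: "regular_on UNIV D (\<lambda>y. snd (inv_into V b y) $ j)" for j
    proof -
      have "regular_on UNIV D (\<lambda>y. y $ Inr j)" by (rule regular_on_poly_fun) (simp_all add: poly_fun.coord)
      moreover have "y $ Inr j = snd (inv_into V b y) $ j" if "y \<in> D" for y using D[OF that] by auto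
      ultimately show ?thesis by (subst (asm) regular_on_cong) auto
    qed
    have reg_str: "regular_on UNIV D (\<lambda>y. straighten \<delta> (snd (inv_into V b y)) $ j)" for j
      by (rule regular_on_poly_fun_compose[OF poly_fun_straighten UNIV_I reg_x])
    have "\<forall>j. regular_on UNIV D (\<lambda>y. weight_act (\<phi> (fst (inv_into V b y))) (straighten \<delta> (snd (inv_into V b y))) $ j)"
      unfolding forall_4 weight_act_def vec4_nth
      by (intro conjI regular_on_mult reg_\<phi> reg_inv reg_str)
    then have "regular_on UNIV D (\<lambda>y. unstraighten \<delta> (weight_act (\<phi> (fst (inv_into V b y))) (straighten \<delta> (snd (inv_into V b y)))) $ j)" for j
      by (intro regular_on_poly_fun_compose[OF poly_fun_unstraighten UNIV_I]) blast
    then show "regular_map_on UNIV (b ` {x \<in> V. f x \<in> UNIV}) (id \<circ> f \<circ> inv_into V b)"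
      unfolding regular_map_on_def by (simp add: D_def f_def case_prod_unfold twisted_act_def)
  qed
  then show ?thesis unfolding morphism_def f_def[symmetric] by (auto simp: affine_space_def[where 'n = 4] points_def)
qed

theorem algebraic_action_twisted:
  fixes A :: "('a, 'K::{alg_closed_field,field_char_0}, 'n::finite) atlas"
  assumes G: "aut_group G" and H: "algebraic_group (fixed_field G) A H"
    and \<phi>: "\<phi> \<in> iso H Gm" "morphism UNIV A Gm_atlas \<phi>" and \<delta>: "\<delta> \<noteq> 0"
    and s: "\<And>\<sigma>. \<sigma> \<in> G \<Longrightarrow> galois_lift \<sigma> A (s \<sigma>)"
    and sign: "\<And>\<sigma>. \<sigma> \<in> G \<Longrightarrow> (\<sigma> \<delta> = \<delta> \<and> (\<forall>h\<in>carrier H. \<phi> (s \<sigma> h) = \<sigma> (\<phi> h))) \<or>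
       (\<sigma> \<delta> = - \<delta> \<and> (\<forall>h\<in>carrier H. \<phi> (s \<sigma> h) = inverse (\<sigma> (\<phi> h))))"
  shows "algebraic_action (fixed_field G) A H affine_space (\<lambda>g. twisted_act \<delta> (\<phi> g))"
proof -
  have var: "variety (fixed_field G) A" and group: "group H" and carrier: "carrier H = points A"
    using H by (auto simp: algebraic_group_def)
  interpret H: group H by (rule group)
  have \<phi>_nz: "\<phi> h \<noteq> 0" if "h \<in> points A" for h using morphismD(1)[OF \<phi>(2) that] by simp
  have \<phi>_mult: "\<phi> (g \<otimes>\<^bsub>H\<^esub> h) = \<phi> g * \<phi> h" if "g \<in> carrier H" "h \<in> carrier H" for g h
    using \<phi>(1) that by (auto simp: iso_def hom_def Gm_def)
  have act_mult: "twisted_act \<delta> (z * w) x = twisted_act \<delta> z (twisted_act \<delta> w x)" for z w x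
    by (simp add: twisted_act_def straighten_unstraighten[OF \<delta>] weight_act_mult)
  have act_1: "twisted_act \<delta> 1 x = x" for x
    by (simp add: twisted_act_def weight_act_1 unstraighten_straighten[OF \<delta>])
  have bij: "bij (twisted_act \<delta> z)" if "z \<noteq> 0" for z
  proof (rule bij_betw_byWitness[where f' = "twisted_act \<delta> (inverse z)"])
    show "\<forall>x\<in>UNIV. twisted_act \<delta> (inverse z) (twisted_act \<delta> z x) = x"
      "\<forall>x\<in>UNIV. twisted_act \<delta> z (twisted_act \<delta> (inverse z) x) = x"
      using that by (simp_all flip: act_mult add: act_1)
  qed auto
  have "group_action H UNIV (\<lambda>g. twisted_act \<delta> (\<phi> g))"
    unfolding group_action_def group_hom_def group_hom_axioms_def
  proof (intro conjI group group_BijGroup homI)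
    fix g assume g: "g \<in> carrier H"
    then show "twisted_act \<delta> (\<phi> g) \<in> carrier (BijGroup UNIV)"
      using bij[OF \<phi>_nz] by (simp add: BijGroup_def Bij_def carrier)
    fix h assume h: "h \<in> carrier H"
    have "twisted_act \<delta> (\<phi> g) \<in> Bij UNIV" "twisted_act \<delta> (\<phi> h) \<in> Bij UNIV"
      using bij[OF \<phi>_nz] g h by (simp_all add: Bij_def carrier)
    then show "twisted_act \<delta> (\<phi> (g \<otimes>\<^bsub>H\<^esub> h)) = twisted_act \<delta> (\<phi> g) \<otimes>\<^bsub>BijGroup UNIV\<^esub> twisted_act \<delta> (\<phi> h)"
      by (simp add: BijGroup_def \<phi>_mult[OF g h] compose_def fun_eq_iff act_mult)
  qed
  moreover have "morphism (fixed_field G) (prod_variety A affine_space) affine_space (\<lambda>(g, x). twisted_act \<delta> (\<phi> g) x)"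
  proof (rule morphism_descent[where s = "\<lambda>\<sigma>. map_prod (s \<sigma>) (vec_map \<sigma>)" and t = vec_map, OF G])
    show "morphism UNIV (prod_variety A affine_space) affine_space (\<lambda>(g, x). twisted_act \<delta> (\<phi> g) x)"
      by (rule morphism_twisted_act[OF variety_affine_charts[OF var] \<phi>(2)])
    show "affine_charts (prod_variety A affine_space)"
      by (rule affine_charts_prod[OF variety_affine_charts[OF var] affine_charts_affine_space])
    show "galois_lift \<sigma> (prod_variety A affine_space) (map_prod (s \<sigma>) (vec_map \<sigma>))" if "\<sigma> \<in> G" for \<sigma>
      by (rule galois_lift_prod[OF s[OF that] galois_lift_affine_space])
    show "galois_lift \<sigma> affine_space (vec_map \<sigma>)" for \<sigma> :: "'K \<Rightarrow> 'K" by (rule galois_lift_affine_space)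
    fix \<sigma> and gx :: "'a \<times> ('K ^ 4)" assume \<sigma>: "\<sigma> \<in> G" and gx: "gx \<in> points (prod_variety A affine_space)"
    obtain g x where g: "gx = (g, x)" "g \<in> points A" using gx by (auto simp: points_prod)
    have "twisted_act \<delta> (\<phi> (s \<sigma> g)) (vec_map \<sigma> x) = vec_map \<sigma> (twisted_act \<delta> (\<phi> g) x)"
      using sign[OF \<sigma>] g(2)
      by (intro twisted_act_galois[OF aut_groupD(2)[OF G \<sigma>] \<delta> \<phi>_nz]) (auto simp: carrier)
    then show "(\<lambda>(g, x). twisted_act \<delta> (\<phi> g) x) (map_prod (s \<sigma>) (vec_map \<sigma>) gx) =
        vec_map \<sigma> ((\<lambda>(g, x). twisted_act \<delta> (\<phi> g) x) gx)"
      by (simp add: g(1))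
  qed
  ultimately show ?thesis by (simp add: algebraic_action_def)
qed

section \<open>Derivatives of polynomial maps\<close>

text \<open>
  The coefficient of \<open>t\<close> in the polynomial \<open>p (x + t h)\<close>, which is the derivative of \<open>p\<close> at \<open>x\<close> in direction
  \<open>h\<close>. The polynomial is unique because the field is infinite.
\<close>

definition dir_deriv :: "('K::field_char_0 ^ 'n \<Rightarrow> 'K) \<Rightarrow> 'K ^ 'n \<Rightarrow> 'K ^ 'n \<Rightarrow> 'K" where
  "dir_deriv p x h = poly.coeff (THE P. \<forall>t. p (x + t *s h) = poly P t) 1"

lemma dir_deriv_eqI:
  assumes "\<And>t. p (x + t *s h) = poly P t"
  shows "dir_deriv p x h = poly.coeff P 1"
proof -
  have "(THE P. \<forall>t. p (x + t *s h) = poly P t) = P"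
  proof (rule the_equality)
    fix Q assume "\<forall>t. p (x + t *s h) = poly Q t"
    then have "poly Q = poly P" using assms by (simp add: fun_eq_iff)
    then show "Q = P" by (simp add: poly_eq_poly_eq_iff)
  qed (use assms in simp)
  then show ?thesis by (simp add: dir_deriv_def)
qed

lemma dir_deriv_const: "dir_deriv (\<lambda>_. c) x h = 0"
  by (subst dir_deriv_eqI[of _ _ _ "[:c:]"]) auto

lemma dir_deriv_coord: "dir_deriv (\<lambda>x. x $ i) x h = h $ i"
  by (subst dir_deriv_eqI[of _ _ _ "[:x $ i, h $ i:]"]) auto

lemma dir_deriv_add:
  assumes "p \<in> poly_fun UNIV" "q \<in> poly_fun UNIV"
  shows "dir_deriv (\<lambda>x. p x + q x) x h = dir_deriv p x h + dir_deriv q x h"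
proof -
  obtain P Q where P: "\<And>t. p (x + t *s h) = poly P t" and Q: "\<And>t. q (x + t *s h) = poly Q t"
    using poly_fun_line[OF assms(1)] poly_fun_line[OF assms(2)] by metis
  have "dir_deriv (\<lambda>x. p x + q x) x h = poly.coeff (P + Q) 1" by (rule dir_deriv_eqI) (simp add: P Q)
  then show ?thesis by (simp add: dir_deriv_eqI[OF P] dir_deriv_eqI[OF Q])
qed

lemma dir_deriv_mult:
  assumes "p \<in> poly_fun UNIV" "q \<in> poly_fun UNIV"
  shows "dir_deriv (\<lambda>x. p x * q x) x h = p x * dir_deriv q x h + dir_deriv p x h * q x"
proof -
  obtain P Q where P: "\<And>t. p (x + t *s h) = poly P t" and Q: "\<And>t. q (x + t *s h) = poly Q t"
    using poly_fun_line[OF assms(1)] poly_fun_line[OF assms(2)] by metis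
  have "dir_deriv (\<lambda>x. p x * q x) x h = poly.coeff (P * Q) 1" by (rule dir_deriv_eqI) (simp add: P Q)
  also have "\<dots> = poly.coeff P 0 * poly.coeff Q 1 + poly.coeff P 1 * poly.coeff Q 0"
    by (simp add: coeff_mult)
  finally have "dir_deriv (\<lambda>x. p x * q x) x h = poly.coeff P 0 * poly.coeff Q 1 + poly.coeff P 1 * poly.coeff Q 0" .
  moreover have "poly.coeff P 0 = p x" "poly.coeff Q 0 = q x"
    using P[of 0] Q[of 0] by (simp_all add: poly_0_coeff_0)
  ultimately show ?thesis by (simp add: dir_deriv_eqI[OF P] dir_deriv_eqI[OF Q])
qed

lemma dir_deriv_linear:
  assumes "p \<in> poly_fun UNIV"
  shows "dir_deriv p x (h + k) = dir_deriv p x h + dir_deriv p x k" "dir_deriv p x (c *s h) = c * dir_deriv p x h"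
  using assms
proof (induction rule: poly_fun.induct)
  case (add p q)
  {
    case 1
    show ?case using add.IH(1,3) by (simp add: dir_deriv_add[OF add.hyps])
  next
    case 2
    show ?case using add.IH(2,4) by (simp add: dir_deriv_add[OF add.hyps] algebra_simps)
  }
next
  case (mult p q)
  {
    case 1
    show ?case using mult.IH(1,3) by (simp add: dir_deriv_mult[OF mult.hyps] algebra_simps)
  next
    case 2
    show ?case using mult.IH(2,4) by (simp add: dir_deriv_mult[OF mult.hyps] algebra_simps)
  }
qed (simp_all add: dir_deriv_const dir_deriv_coord)

lemma poly_fun_dir_deriv:
  assumes "p \<in> poly_fun UNIV"
  shows "(\<lambda>x. dir_deriv p x h) \<in> poly_fun UNIV" "(\<lambda>h. dir_deriv p x h) \<in> poly_fun UNIV"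
proof -
  have "(\<lambda>x. dir_deriv p x h) \<in> poly_fun UNIV \<and> (\<lambda>h. dir_deriv p x h) \<in> poly_fun UNIV"
    using assms
  proof (induction rule: poly_fun.induct)
    case (add p q)
    then show ?case by (simp add: dir_deriv_add[OF add.hyps] poly_fun.add)
  next
    case (mult p q)
    then show ?case
      by (simp add: dir_deriv_mult[OF mult.hyps] poly_fun.add poly_fun.mult poly_fun.const)
  qed (simp_all add: dir_deriv_const dir_deriv_coord poly_fun.const poly_fun.coord)
  then show "(\<lambda>x. dir_deriv p x h) \<in> poly_fun UNIV" "(\<lambda>h. dir_deriv p x h) \<in> poly_fun UNIV" by auto
qed

definition jacobian :: "('K::field_char_0 ^ 'n \<Rightarrow> 'K ^ 'm) \<Rightarrow> 'K ^ 'n \<Rightarrow> 'K ^ 'n \<Rightarrow> 'K ^ 'm" where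
  "jacobian f x h = (\<chi> j. dir_deriv (\<lambda>x. f x $ j) x h)"

definition poly_map :: "('K::field ^ 'n \<Rightarrow> 'K ^ 'm) \<Rightarrow> bool" where
  "poly_map f \<longleftrightarrow> (\<forall>j. (\<lambda>x. f x $ j) \<in> poly_fun UNIV)"

lemma poly_mapD: "poly_map f \<Longrightarrow> (\<lambda>x. f x $ j) \<in> poly_fun UNIV"
  by (simp add: poly_map_def)

lemma poly_map_compose: "poly_map f \<Longrightarrow> poly_map g \<Longrightarrow> poly_map (\<lambda>x. f (g x))"
  unfolding poly_map_def using poly_fun_compose by blast

lemma dir_deriv_chain:
  assumes "p \<in> poly_fun UNIV" and f: "poly_map f"
  shows "dir_deriv (\<lambda>x. p (f x)) x h = dir_deriv p (f x) (jacobian f x h)"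
  using assms(1)
proof induction
  case (add p q)
  have "(\<lambda>x. p (f x)) \<in> poly_fun UNIV" "(\<lambda>x. q (f x)) \<in> poly_fun UNIV"
    by (rule poly_fun_compose; fact add.hyps poly_mapD[OF f])+
  then show ?case using add.IH by (simp add: dir_deriv_add add.hyps)
next
  case (mult p q)
  have "(\<lambda>x. p (f x)) \<in> poly_fun UNIV" "(\<lambda>x. q (f x)) \<in> poly_fun UNIV"
    by (rule poly_fun_compose; fact mult.hyps poly_mapD[OF f])+
  then show ?case using mult.IH by (simp add: dir_deriv_mult mult.hyps)
qed (simp_all add: dir_deriv_const dir_deriv_coord jacobian_def)

lemma jacobian_chain:
  assumes "poly_map g" "poly_map f"
  shows "jacobian (\<lambda>x. g (f x)) x h = jacobian g (f x) (jacobian f x h)"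
  by (simp add: vec_eq_iff jacobian_def[of "\<lambda>x. g (f x)"] jacobian_def[of g]
      dir_deriv_chain[OF poly_mapD[OF assms(1)] assms(2)])

lemma jacobian_add: "poly_map f \<Longrightarrow> jacobian f x (h + k) = jacobian f x h + jacobian f x k"
  and jacobian_scale: "poly_map f \<Longrightarrow> jacobian f x (c *s h) = c *s jacobian f x h"
  by (simp_all add: jacobian_def vec_eq_iff dir_deriv_linear poly_mapD)

lemma poly_map_jacobian: "poly_map f \<Longrightarrow> poly_map (jacobian f x)" "poly_map f \<Longrightarrow> poly_map (\<lambda>x. jacobian f x h)"
  by (simp_all add: poly_map_def jacobian_def poly_fun_dir_deriv)

lemma jacobian_of_linear:
  assumes "\<And>h k. L (h + k) = L h + L k" "\<And>c h. L (c *s h) = c *s L h"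
  shows "jacobian L x h = L h"
  unfolding jacobian_def vec_eq_iff
proof
  fix j
  have "dir_deriv (\<lambda>x. L x $ j) x h = poly.coeff [:L x $ j, L h $ j:] 1"
    by (rule dir_deriv_eqI) (simp add: assms)
  then show "(\<chi> j. dir_deriv (\<lambda>x. L x $ j) x h) $ j = L h $ j" by simp
qed

lemma jacobian_line_cong:
  assumes "\<And>t. f (x + t *s h) = g (y + t *s k)"
  shows "jacobian f x h = jacobian g y k"
  by (simp add: jacobian_def dir_deriv_def assms)

text \<open>
  If \<open>g\<close> on one line is the conjugate of \<open>f\<close> on another, with the parameter conjugated too, then so are the
  coefficients of the two polynomials on these lines.
\<close>

lemma jacobian_galois:
  assumes \<sigma>: "field_aut \<sigma>" and f: "poly_map f" and g: "\<And>t. g (y + \<sigma> t *s k) = vec_map \<sigma> (f (x + t *s h))"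
  shows "jacobian g y k = vec_map \<sigma> (jacobian f x h)"
  unfolding vec_eq_iff
proof
  fix j
  obtain P where P: "\<And>t. f (x + t *s h) $ j = poly P t" using poly_fun_line[OF poly_mapD[OF f]] by blast
  have map: "poly (map_poly \<sigma> P) (\<sigma> t) = \<sigma> (poly P t)" for t
    by (induction P) (simp_all add: field_autD[OF \<sigma>] map_poly_pCons)
  have "g (y + t *s k) $ j = poly (map_poly \<sigma> P) t" for t
    using g[of "inv_into UNIV \<sigma> t"] map[of "inv_into UNIV \<sigma> t"] by (simp add: field_autD[OF \<sigma>] P)
  then have "dir_deriv (\<lambda>x. g x $ j) y k = \<sigma> (poly.coeff P 1)"
    by (subst dir_deriv_eqI) (auto simp: coeff_map_poly field_autD[OF \<sigma>])
  then show "jacobian g y k $ j = vec_map \<sigma> (jacobian f x h) $ j"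
    by (simp add: jacobian_def dir_deriv_eqI[OF P])
qed

section \<open>The twisted action is not linearizable\<close>

text \<open>
  The derivative of \<open>reflection\<close> at the origin, see \<open>jacobian_reflection_0\<close>.
\<close>

definition swap_pairs :: "'K ^ 4 \<Rightarrow> 'K ^ 4" where
  "swap_pairs y = vec4 (y $ 2) (y $ 1) (y $ 4) (y $ 3)"

lemma swap_pairs_invol [simp]: "swap_pairs (swap_pairs y) = y"
  by (simp add: swap_pairs_def vec_eq_iff_4)

lemma weight_act_linear:
  "weight_act z (h + k) = weight_act z h + weight_act z k" "weight_act z (c *s h) = c *s weight_act z h"
  by (simp_all add: weight_act_def vec_eq_iff_4 algebra_simps)

lemma poly_map_reflection: "poly_map (reflection :: 'K::field ^ 4 \<Rightarrow> 'K ^ 4)"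
proof -
  have "\<forall>j. (\<lambda>x. (reflection x :: 'K ^ 4) $ j) \<in> poly_fun UNIV"
    unfolding forall_4 reflection_def Let_def vec4_nth
    by (intro conjI poly_fun_uminus poly_fun.add poly_fun.mult poly_fun_diff poly_fun.const poly_fun.coord UNIV_I poly_fun_power)
  then show ?thesis by (simp add: poly_map_def)
qed

lemma jacobian_reflection_0: "jacobian reflection 0 h = swap_pairs h"
proof -
  have 1: "dir_deriv (\<lambda>x. reflection x $ 1) 0 h = h $ 2"
    by (subst dir_deriv_eqI[of _ _ _ "[:0, h $ 2:]"]) (auto simp: reflection_def Let_def)
  have 2: "dir_deriv (\<lambda>x. reflection x $ 2) 0 h = h $ 1"
    by (subst dir_deriv_eqI[of _ _ _ "[:0, h $ 1:]"]) (auto simp: reflection_def Let_def)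
  define a b u v where "a = h $ 1" and "b = h $ 2" and "u = h $ 3" and "v = h $ 4"
  have 3: "dir_deriv (\<lambda>x. reflection x $ 3) 0 h = v"
    by (subst dir_deriv_eqI[of _ _ _ "[:0, v, 0, a * b * v, - (b ^ 3) * u, (a * b) ^ 2 * v:]"])
      (auto simp: reflection_def Let_def a_def b_def u_def v_def algebra_simps power2_eq_square power3_eq_cube)
  have 4: "dir_deriv (\<lambda>x. reflection x $ 4) 0 h = u"
    by (subst dir_deriv_eqI[of _ _ _ "[:0, u, 0, - (a * b * u), a ^ 3 * v:]"])
      (auto simp: reflection_def Let_def a_def b_def u_def v_def algebra_simps power2_eq_square power3_eq_cube)
  show ?thesis using 1 2 3 4 by (simp add: vec_eq_iff_4 jacobian_def swap_pairs_def u_def v_def)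
qed

text \<open>
  The degrees of the two products on the left have different parity, so their leading terms do not cancel.
  The degree of the difference is then even if \<open>\<gamma> = 0\<close> and at least 3 otherwise, but never 1.
\<close>

lemma norm_identity_impossible:
  fixes \<alpha> \<gamma> :: "'K::field_char_0 poly"
  assumes \<sigma>: "field_aut \<sigma>" and c: "c \<noteq> 0"
    and eq: "\<alpha> * map_poly \<sigma> \<alpha> - monom 1 3 * \<gamma> * map_poly \<sigma> \<gamma> = smult c [:1, - 1:]"
  shows False
proof -
  have deg: "degree (map_poly \<sigma> p) = degree p" "map_poly \<sigma> p = 0 \<longleftrightarrow> p = 0" for p
  proof -
    show zero: "map_poly \<sigma> p = 0 \<longleftrightarrow> p = 0"
      by (simp add: poly_eq_iff coeff_map_poly field_autD[OF \<sigma>])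
    show "degree (map_poly \<sigma> p) = degree p"
      by (cases "p = 0") (auto intro!: map_poly_degree_eq simp: field_autD[OF \<sigma>])
  qed
  have rhs: "degree (smult c [:1, - 1:]) = 1" using c by simp
  have da: "degree (\<alpha> * map_poly \<sigma> \<alpha>) = 2 * degree \<alpha>"
    by (cases "\<alpha> = 0") (simp_all add: degree_mult_eq deg)
  have dg: "degree (monom 1 3 * \<gamma> * map_poly \<sigma> \<gamma>) = 3 + 2 * degree \<gamma>" if "\<gamma> \<noteq> 0"
    using that by (simp add: degree_mult_eq deg degree_monom_eq)
  show False
  proof (cases "\<gamma> = 0")
    case True
    then have "2 * degree \<alpha> = 1" using da rhs eq by simp
    then show False by presburger
  next
    case False
    have "2 * degree \<alpha> \<noteq> 3 + 2 * degree \<gamma>" by presburger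
    then consider "2 * degree \<alpha> < 3 + 2 * degree \<gamma>" | "3 + 2 * degree \<gamma> < 2 * degree \<alpha>" by linarith
    then have "degree (\<alpha> * map_poly \<sigma> \<alpha> - monom 1 3 * \<gamma> * map_poly \<sigma> \<gamma>) \<ge> 3"
    proof cases
      case 1
      then show ?thesis using degree_add_eq_right[of "\<alpha> * map_poly \<sigma> \<alpha>" "- (monom 1 3 * \<gamma> * map_poly \<sigma> \<gamma>)"] da dg[OF False] by simp
    next
      case 2
      then show ?thesis using degree_add_eq_left[of "- (monom 1 3 * \<gamma> * map_poly \<sigma> \<gamma>)" "\<alpha> * map_poly \<sigma> \<alpha>"] da dg[OF False] by simp
    qed
    then show False using eq rhs by simp
  qed
qed

text \<open>
  The derivatives \<open>U\<close> and \<open>V\<close> of \<open>\<eta>\<close> in the two normal directions are considered at the points \<open>(1, t)\<close> and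
  \<open>(t, 1)\<close> of the fixed plane of \<open>-1\<close>. They are normal to the plane again, the torus relates the two points,
  and \<open>reflection\<close> exchanges them up to conjugation. The determinant \<open>\<kappa>\<close> of the normal derivative is a
  polynomial without zeros, hence constant. Eliminating \<open>\<beta>\<close> and \<open>\<epsilon>\<close> from the relations, by means of this
  determinant, leaves the identity that \<open>norm_identity_impossible\<close> excludes.
\<close>

lemma no_equivariant_trivialization:
  fixes \<eta> :: "'K::{alg_closed_field,field_char_0} ^ 4 \<Rightarrow> 'K ^ 4"
  assumes \<sigma>: "field_aut \<sigma>" and \<eta>: "poly_map \<eta>"
    and inj: "\<And>x h. jacobian \<eta> x h = 0 \<Longrightarrow> h = 0"
    and weight: "\<And>z y. z \<noteq> 0 \<Longrightarrow> \<eta> (weight_act z y) = weight_act z (\<eta> y)"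
    and refl: "\<And>y. \<eta> (reflection (vec_map \<sigma> y)) = swap_pairs (vec_map \<sigma> (\<eta> y))"
  shows False
proof -
  define w where "w a b = vec4 a b 0 (0 :: 'K)" for a b
  define u v where "u = vec4 0 0 1 (0 :: 'K)" and "v = vec4 0 0 0 (1 :: 'K)"
  have weight_jac: "jacobian \<eta> (weight_act z x) (weight_act z h) = weight_act z (jacobian \<eta> x h)" if "z \<noteq> 0" for z x h
  proof -
    have "jacobian \<eta> (weight_act z x) (weight_act z h) = jacobian (\<lambda>y. \<eta> (weight_act z y)) x h"
      by (rule jacobian_line_cong) (simp add: weight_act_linear)
    also have "\<dots> = jacobian (\<lambda>y. weight_act z (\<eta> y)) x h" by (simp add: weight[OF that])
    also have "\<dots> = jacobian (weight_act z) (\<eta> x) (jacobian \<eta> x h)"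
    proof (rule jacobian_chain[OF _ \<eta>])
      have "\<forall>j. (\<lambda>x. (weight_act z x :: 'K ^ 4) $ j) \<in> poly_fun UNIV"
        unfolding forall_4 weight_act_def vec4_nth
        by (intro conjI poly_fun.mult poly_fun.const poly_fun.coord UNIV_I)
      then show "poly_map (weight_act z)" by (simp add: poly_map_def)
    qed
    also have "\<dots> = weight_act z (jacobian \<eta> x h)" by (intro jacobian_of_linear weight_act_linear)
    finally show ?thesis .
  qed
  define U V where "U a b = jacobian \<eta> (w a b) u" and "V a b = jacobian \<eta> (w a b) v" for a b
  have base_zero: "U a b $ 1 = 0" "U a b $ 2 = 0" "V a b $ 1 = 0" "V a b $ 2 = 0" for a b
  proof -
    \<comment> \<open>\<open>-1\<close> fixes the base point and negates the normal directions, but acts trivially on the first two coordinates\<close>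
    have "weight_act (- 1) (w a b) = w a b" by (simp add: weight_act_def w_def vec_eq_iff_4)
    moreover have "weight_act (- 1) u = (- 1) *s u" "weight_act (- 1) v = (- 1) *s v"
      by (simp_all add: weight_act_def u_def v_def vec_eq_iff_4)
    ultimately have "(- 1) *s U a b = weight_act (- 1) (U a b)" "(- 1) *s V a b = weight_act (- 1) (V a b)"
      using weight_jac[of "- 1" "w a b" u] weight_jac[of "- 1" "w a b" v]
      by (simp_all only: U_def V_def jacobian_scale[OF \<eta>])  simp_all
    then show "U a b $ 1 = 0" "U a b $ 2 = 0" "V a b $ 1 = 0" "V a b $ 2 = 0"
      by (simp_all add: vec_eq_iff_4 weight_act_def)
  qed
  have scale: "U t 1 $ 3 = U 1 t $ 3" "U 1 t $ 4 = t ^ 3 * U t 1 $ 4"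
    "V t 1 $ 3 = t ^ 3 * V 1 t $ 3" "V t 1 $ 4 = V 1 t $ 4" if t: "t \<noteq> 0" for t
  proof -
    \<comment> \<open>a square root of \<open>t\<close>, as a torus element, moves \<open>(1, t)\<close> to \<open>(t, 1)\<close>\<close>
    obtain z where z: "z ^ 2 = t"
    proof -
      have "\<exists>z. poly [:- t, 0, 1:] z = 0" by (rule alg_closed_imp_poly_has_root) simp
      then show ?thesis using that by (auto simp: power2_eq_square)
    qed
    have z0: "z \<noteq> 0" using z t by auto
    have "inverse z * inverse z * (z * z) = 1" using z0 by (simp add: field_simps)
    then have "weight_act z (w 1 t) = w t 1" "weight_act z u = (z * z * z) *s u"
      "weight_act z v = (inverse z * inverse z * inverse z) *s v"
      using z0 by (auto simp: weight_act_def w_def u_def v_def vec_eq_iff_4 power2_eq_square simp flip: z)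
    then have "(z * z * z) *s U t 1 = weight_act z (U 1 t)"
      "(inverse z * inverse z * inverse z) *s V t 1 = weight_act z (V 1 t)"
      using weight_jac[OF z0, of "w 1 t" u] weight_jac[OF z0, of "w 1 t" v]
      by (simp_all add: U_def V_def jacobian_scale[OF \<eta>])
    then have *: "(z * z * z) * U t 1 $ 3 = (z * z * z) * U 1 t $ 3"
      "(z * z * z) * U t 1 $ 4 = inverse z * inverse z * inverse z * U 1 t $ 4"
      "inverse z * inverse z * inverse z * V t 1 $ 3 = z * z * z * V 1 t $ 3"
      "inverse z * inverse z * inverse z * V t 1 $ 4 = inverse z * inverse z * inverse z * V 1 t $ 4"
      by (simp_all add: vec_eq_iff_4 weight_act_def)
    show "U t 1 $ 3 = U 1 t $ 3" "V t 1 $ 4 = V 1 t $ 4" using *(1,4) z0 by simp_all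
    have z6: "t ^ 3 = (z * z * z) * (z * z * z)" by (simp add: power2_eq_square power3_eq_cube ac_simps flip: z)
    have "(z * z * z) * ((z * z * z) * U t 1 $ 4) = U 1 t $ 4" unfolding *(2) using z0 by (simp add: field_simps)
    then show "U 1 t $ 4 = t ^ 3 * U t 1 $ 4" by (simp add: z6 mult.assoc)
    have "V t 1 $ 3 = (z * z * z) * (inverse z * inverse z * inverse z * V t 1 $ 3)" using z0 by (simp add: field_simps)
    then show "V t 1 $ 3 = t ^ 3 * V 1 t $ 3" unfolding *(3) by (simp add: z6 mult.assoc)
  qed
  have curve: "\<exists>P. \<forall>t. U 1 t $ j = poly P t" "\<exists>P. \<forall>t. V 1 t $ j = poly P t" "\<exists>P. \<forall>t. U t 1 $ j = poly P t" for j
  proof -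
    have line1: "\<exists>P. \<forall>t. w 1 t $ i = poly P t" for i
      using exhaust_4[of i] by (auto simp: w_def intro: exI[of _ "[:1:]"] exI[of _ "[:0, 1:]"] exI[of _ 0])
    have line2: "\<exists>P. \<forall>t. w t 1 $ i = poly P t" for i
      using exhaust_4[of i] by (auto simp: w_def intro: exI[of _ "[:1:]"] exI[of _ "[:0, 1:]"] exI[of _ 0])
    show "\<exists>P. \<forall>t. U 1 t $ j = poly P t" "\<exists>P. \<forall>t. V 1 t $ j = poly P t" "\<exists>P. \<forall>t. U t 1 $ j = poly P t"
      unfolding U_def V_def
      by (rule poly_fun_curve[OF poly_mapD[OF poly_map_jacobian(2)[OF \<eta>]]]; fact line1 line2)+
  qed
  obtain \<alpha> where \<alpha>: "\<And>t. U 1 t $ 3 = poly \<alpha> t" using curve(1) by blast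
  obtain \<beta> where \<beta>: "\<And>t. V 1 t $ 3 = poly \<beta> t" using curve(2) by blast
  obtain \<gamma>' where \<gamma>': "\<And>t. U 1 t $ 4 = poly \<gamma>' t" using curve(1) by blast
  obtain \<epsilon> where \<epsilon>: "\<And>t. V 1 t $ 4 = poly \<epsilon> t" using curve(2) by blast
  obtain \<gamma> where \<gamma>: "\<And>t. U t 1 $ 4 = poly \<gamma> t" using curve(3) by blast
  have nonzero_eq: "p = q" if "\<And>t. t \<noteq> 0 \<Longrightarrow> poly p t = poly q t" for p q :: "'K poly"
  proof -
    have "poly ([:0, 1:] * p) t = poly ([:0, 1:] * q) t" for t using that[of t] by (cases "t = 0") auto
    then have "poly ([:0, 1:] * p) = poly ([:0, 1:] * q)" by (rule ext)
    then have "[:0, 1:] * p = [:0, 1:] * q" by (simp only: poly_eq_poly_eq_iff)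
    then show ?thesis using mult_left_cancel[of "[:0, 1:]" p q] by simp
  qed
  have \<gamma>'_eq: "\<gamma>' = monom 1 3 * \<gamma>"
    by (rule nonzero_eq) (simp add: poly_monom scale(2) flip: \<gamma> \<gamma>')
  define \<kappa> where "\<kappa> = \<alpha> * \<epsilon> - \<beta> * \<gamma>'"
  have \<kappa>_nz: "poly \<kappa> t \<noteq> 0" for t
  proof
    assume "poly \<kappa> t = 0"
    then have det: "U 1 t $ 3 * V 1 t $ 4 = V 1 t $ 3 * U 1 t $ 4"
      by (simp add: \<kappa>_def \<alpha> \<beta> \<gamma>' \<epsilon>)
    have kernel: "a = 0 \<and> b = 0"
      if "a * U 1 t $ 3 + b * V 1 t $ 3 = 0" "a * U 1 t $ 4 + b * V 1 t $ 4 = 0" for a b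
    proof -
      have "jacobian \<eta> (w 1 t) (a *s u + b *s v) = a *s U 1 t + b *s V 1 t"
        by (simp add: U_def V_def jacobian_add[OF \<eta>] jacobian_scale[OF \<eta>])
      also have "\<dots> = 0" using that by (simp add: vec_eq_iff_4 base_zero)
      finally have "a *s u + b *s v = 0" by (rule inj)
      then show ?thesis by (simp add: vec_eq_iff_4 u_def v_def)
    qed
    \<comment> \<open>the columns of the adjugate matrix are in the kernel\<close>
    have 1: "V 1 t $ 4 = 0 \<and> - U 1 t $ 4 = 0" by (rule kernel) (use det in \<open>simp_all add: algebra_simps\<close>)
    have 2: "V 1 t $ 3 = 0 \<and> - U 1 t $ 3 = 0" by (rule kernel) (use det in \<open>simp_all add: algebra_simps\<close>)
    have "(1 :: 'K) = 0 \<and> (0 :: 'K) = 0" by (rule kernel) (use 1 2 in simp_all)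
    then show False by simp
  qed
  have "degree \<kappa> = 0" using alg_closed_imp_poly_has_root[of \<kappa>] \<kappa>_nz by blast
  then obtain c where c: "\<kappa> = [:c:]" by (rule degree_eq_zeroE)
  have "c \<noteq> 0" using \<kappa>_nz[of 0] by (simp add: c)
  have fibre: "- (\<sigma> t ^ 3) * U (\<sigma> t) 1 $ 3 + (1 - \<sigma> t) * V (\<sigma> t) 1 $ 3 = \<sigma> (U 1 t $ 4)"
    "- (\<sigma> t ^ 3) * U (\<sigma> t) 1 $ 4 + (1 - \<sigma> t) * V (\<sigma> t) 1 $ 4 = \<sigma> (U 1 t $ 3)" for t
  proof -
    \<comment> \<open>the image of the direction \<open>u\<close> at \<open>(1, t)\<close> under conjugation and \<open>reflection\<close>\<close>
    define k where "k = (- (\<sigma> t ^ 3)) *s u + (1 - \<sigma> t) *s v"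
    have "reflection (vec_map \<sigma> (w 1 t + s *s u)) = w (\<sigma> t) 1 + \<sigma> s *s k" for s
      by (simp add: vec_eq_iff_4 reflection_def Let_def w_def u_def v_def k_def field_autD[OF \<sigma>] algebra_simps)
    then have "swap_pairs (\<eta> (w (\<sigma> t) 1 + \<sigma> s *s k)) = vec_map \<sigma> (\<eta> (w 1 t + s *s u))" for s
      using refl[of "w 1 t + s *s u"] by simp
    then have "jacobian (\<lambda>y. swap_pairs (\<eta> y)) (w (\<sigma> t) 1) k = vec_map \<sigma> (U 1 t)"
      unfolding U_def by (rule jacobian_galois[OF \<sigma> \<eta>])
    moreover have "jacobian (\<lambda>y. swap_pairs (\<eta> y)) (w (\<sigma> t) 1) k = swap_pairs (jacobian \<eta> (w (\<sigma> t) 1) k)"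
      by (simp add: jacobian_def swap_pairs_def vec_eq_iff_4)
    moreover have "jacobian \<eta> (w (\<sigma> t) 1) k = (- (\<sigma> t ^ 3)) *s U (\<sigma> t) 1 + (1 - \<sigma> t) *s V (\<sigma> t) 1"
      unfolding k_def U_def V_def jacobian_add[OF \<eta>] jacobian_scale[OF \<eta>] ..
    ultimately have "swap_pairs ((- (\<sigma> t ^ 3)) *s U (\<sigma> t) 1 + (1 - \<sigma> t) *s V (\<sigma> t) 1) = vec_map \<sigma> (U 1 t)" by simp
    then show "- (\<sigma> t ^ 3) * U (\<sigma> t) 1 $ 3 + (1 - \<sigma> t) * V (\<sigma> t) 1 $ 3 = \<sigma> (U 1 t $ 4)"
      "- (\<sigma> t ^ 3) * U (\<sigma> t) 1 $ 4 + (1 - \<sigma> t) * V (\<sigma> t) 1 $ 4 = \<sigma> (U 1 t $ 3)"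
      by (simp_all add: vec_eq_iff_4 swap_pairs_def)
  qed
  have map: "poly (map_poly \<sigma> P) (\<sigma> t) = \<sigma> (poly P t)" for P t
    by (induction P) (simp_all add: field_autD[OF \<sigma>] map_poly_pCons)
  have "\<alpha> * map_poly \<sigma> \<alpha> - monom 1 3 * \<gamma> * map_poly \<sigma> \<gamma> = smult c [:1, - 1:]"
  proof (rule nonzero_eq)
    fix r :: 'K assume r: "r \<noteq> 0"
    define t where "t = inv_into UNIV \<sigma> r"
    have \<sigma>t: "\<sigma> t = r" by (simp add: t_def field_autD[OF \<sigma>])
    have i: "- (r ^ 3) * poly \<alpha> r + (1 - r) * (r ^ 3 * poly \<beta> r) = r ^ 3 * poly (map_poly \<sigma> \<gamma>) r"
    proof -
      have "\<sigma> (poly \<gamma>' t) = r ^ 3 * poly (map_poly \<sigma> \<gamma>) r"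
        using map[of \<gamma> t] by (simp add: \<gamma>'_eq poly_monom field_autD[OF \<sigma>] \<sigma>t)
      then show ?thesis using fibre(1)[of t] by (simp add: \<sigma>t scale[OF r] \<alpha> \<beta> \<gamma>')
    qed
    have ii: "- (r ^ 3) * poly \<gamma> r + (1 - r) * poly \<epsilon> r = poly (map_poly \<sigma> \<alpha>) r"
      using fibre(2)[of t] map[of \<alpha> t] by (simp add: \<sigma>t scale(4)[OF r] \<alpha> \<gamma> \<epsilon>)
    have iii: "poly \<alpha> r * poly \<epsilon> r - poly \<beta> r * (r ^ 3 * poly \<gamma> r) = c"
      using arg_cong[OF c, of "\<lambda>p. poly p r"] by (simp add: \<kappa>_def \<gamma>'_eq poly_monom)
    have "poly (\<alpha> * map_poly \<sigma> \<alpha> - monom 1 3 * \<gamma> * map_poly \<sigma> \<gamma>) r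
        = poly \<alpha> r * poly (map_poly \<sigma> \<alpha>) r - poly \<gamma> r * (r ^ 3 * poly (map_poly \<sigma> \<gamma>) r)"
      by (simp add: poly_monom algebra_simps)
    also have "\<dots> = (1 - r) * (poly \<alpha> r * poly \<epsilon> r - poly \<beta> r * (r ^ 3 * poly \<gamma> r))"
      unfolding i[symmetric] ii[symmetric] by (simp add: algebra_simps)
    also have "\<dots> = poly (smult c [:1, - 1:]) r" unfolding iii by (simp add: algebra_simps)
    finally show "poly (\<alpha> * map_poly \<sigma> \<alpha> - monom 1 3 * \<gamma> * map_poly \<sigma> \<gamma>) r = poly (smult c [:1, - 1:]) r" .
  qed
  then show False by (rule norm_identity_impossible[OF \<sigma> \<open>c \<noteq> 0\<close>])
qed

text \<open>
  The derivative \<open>M\<close> of \<open>\<psi>\<close> at the origin intertwines the weights with the given linear maps and \<open>swap_pairs\<close>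
  with the identity, up to conjugation. Its inverse \<open>N\<close> is the derivative of \<open>\<psi>'\<close> at the image of the
  origin, so \<open>N \<circ> \<psi>\<close> is a map as in \<open>no_equivariant_trivialization\<close>.
\<close>

lemma no_linearization_of_reflected_weights:
  fixes \<psi> :: "'K::{alg_closed_field,field_char_0} ^ 4 \<Rightarrow> 'K ^ 4"
  assumes \<sigma>: "field_aut \<sigma>" and \<psi>: "poly_map \<psi>" and \<psi>': "poly_map \<psi>'"
    and inverse: "\<And>y. \<psi>' (\<psi> y) = y" "\<And>y. \<psi> (\<psi>' y) = y"
    and linear: "\<And>z. z \<noteq> 0 \<Longrightarrow> \<exists>L. Vector_Spaces.linear (*s) (*s) L \<and> (\<forall>y. \<psi> (weight_act z y) = L (\<psi> y))"
    and refl: "\<And>y. \<psi> (reflection (vec_map \<sigma> y)) = vec_map \<sigma> (\<psi> y)"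
  shows False
proof -
  define M N where "M = jacobian \<psi> 0" and "N = jacobian \<psi>' (\<psi> 0)"
  have jac_inverse: "jacobian \<psi>' (\<psi> x) (jacobian \<psi> x h) = h" "jacobian \<psi> (\<psi>' x) (jacobian \<psi>' x h) = h" for x h
    using jacobian_of_linear[of "\<lambda>y. y" x h]
    by (simp_all add: inverse flip: jacobian_chain[OF \<psi>' \<psi>] jacobian_chain[OF \<psi> \<psi>'])
  have NM: "N (M h) = h" and MN: "M (N h) = h" for h
    using jac_inverse(1)[of 0 h] jac_inverse(2)[of "\<psi> 0" h] by (simp_all add: M_def N_def inverse)
  have N_lin: "N (h + k) = N h + N k" "N (a *s h) = a *s N h" for h k a
    by (simp_all add: N_def jacobian_add[OF \<psi>'] jacobian_scale[OF \<psi>'])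
  have N_poly: "poly_map N" unfolding N_def by (rule poly_map_jacobian(1)[OF \<psi>'])
  define \<eta> where "\<eta> y = N (\<psi> y)" for y
  have jac_\<eta>: "jacobian \<eta> x h = N (jacobian \<psi> x h)" for x h
    unfolding \<eta>_def[abs_def] jacobian_chain[OF N_poly \<psi>] by (rule jacobian_of_linear[OF N_lin])
  show False
  proof (rule no_equivariant_trivialization[OF \<sigma>])
    show "poly_map \<eta>" unfolding \<eta>_def[abs_def] by (rule poly_map_compose[OF N_poly \<psi>])
    show "h = 0" if "jacobian \<eta> x h = 0" for x h
    proof -
      have "jacobian \<psi> x h = M 0" using MN[of "jacobian \<psi> x h"] that by (simp add: jac_\<eta>)
      also have "M 0 = 0" using jacobian_scale[OF \<psi>, of 0 0 0] by (simp add: M_def)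
      finally have "jacobian \<psi>' (\<psi> x) (0 *s 0) = h" using jac_inverse(1)[of x h] by simp
      then show "h = 0" unfolding jacobian_scale[OF \<psi>'] by simp
    qed
    show "\<eta> (weight_act z y) = weight_act z (\<eta> y)" if z: "z \<noteq> 0" for z y
    proof -
      obtain L where L: "Vector_Spaces.linear (*s) (*s) L" "\<And>y. \<psi> (weight_act z y) = L (\<psi> y)"
        using linear[OF z] by blast
      interpret L: Vector_Spaces.linear "(*s)" "(*s)" L by (rule L(1))
      have L_poly: "poly_map L"
        unfolding poly_map_def
      proof
        fix j
        have "L x $ j = (\<Sum>i\<in>UNIV. matrix L $ j $ i * x $ i)" for x
          using matrix_works[OF L(1), of x] by (simp add: matrix_vector_mult_def flip: matrix_works[OF L(1)])
        then show "(\<lambda>x. L x $ j) \<in> poly_fun UNIV"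
          by (simp add: poly_fun_sum poly_fun.mult poly_fun.const poly_fun.coord)
      qed
      have LM: "M (weight_act z h) = L (M h)" for h
      proof -
        have "M (weight_act z h) = jacobian (\<lambda>y. L (\<psi> y)) 0 h"
          unfolding M_def
        proof (rule jacobian_line_cong)
          fix t
          have "weight_act z (0 + t *s h) = 0 + t *s weight_act z h"
            by (simp add: weight_act_linear)
          then show "\<psi> (0 + t *s weight_act z h) = L (\<psi> (0 + t *s h))"
            using L(2)[of "0 + t *s h"] by simp
        qed
        also have "\<dots> = L (M h)"
          unfolding M_def jacobian_chain[OF L_poly \<psi>] by (rule jacobian_of_linear) (simp_all add: L.add L.scale)
        finally show ?thesis .
      qed
      have "\<eta> (weight_act z y) = N (L (M (N (\<psi> y))))" by (simp add: \<eta>_def L(2) MN)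
      also have "\<dots> = weight_act z (\<eta> y)" by (simp add: \<eta>_def NM flip: LM)
      finally show ?thesis .
    qed
    show "\<eta> (reflection (vec_map \<sigma> y)) = swap_pairs (vec_map \<sigma> (\<eta> y))" for y
    proof -
      have MP: "M (swap_pairs (vec_map \<sigma> h)) = vec_map \<sigma> (M h)" for h
      proof -
        have "jacobian (\<lambda>y. \<psi> (reflection y)) 0 (vec_map \<sigma> h) = vec_map \<sigma> (jacobian \<psi> 0 h)"
        proof (rule jacobian_galois[OF \<sigma> \<psi>])
          fix t
          have "0 + \<sigma> t *s vec_map \<sigma> h = vec_map \<sigma> (0 + t *s h)"
            by (simp add: vec_eq_iff field_autD[OF \<sigma>])
          then show "\<psi> (reflection (0 + \<sigma> t *s vec_map \<sigma> h)) = vec_map \<sigma> (\<psi> (0 + t *s h))"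
            by (simp only: refl)
        qed
        moreover have "reflection (0 :: 'K ^ 4) = 0" by (simp add: reflection_def Let_def vec_eq_iff_4)
        ultimately show ?thesis
          by (simp add: M_def jacobian_chain[OF \<psi> poly_map_reflection] jacobian_reflection_0)
      qed
      have "\<eta> (reflection (vec_map \<sigma> y)) = N (vec_map \<sigma> (M (N (\<psi> y))))" by (simp add: \<eta>_def refl MN)
      also have "\<dots> = swap_pairs (vec_map \<sigma> (\<eta> y))" by (simp add: \<eta>_def NM flip: MP)
      finally show ?thesis .
    qed
  qed
qed

lemma morphism_affine_poly_map:
  fixes f :: "'K::{alg_closed_field,field_char_0} ^ 'n::finite \<Rightarrow> 'K ^ 'm::finite"
  assumes "morphism F affine_space affine_space f"
  shows "poly_map f"
  unfolding poly_map_def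
proof
  fix j
  have "regular_on F ((id :: 'K ^ 'n \<Rightarrow> _) ` {x \<in> UNIV. f x \<in> UNIV}) (\<lambda>y. id (f (inv_into UNIV id y)) $ j)"
    using morphismD(3)[OF assms, of UNIV id UNIV id j] by (simp add: affine_space_def)
  moreover have "inv_into UNIV id y = y" for y :: "'K ^ 'n" using inv_into_f_f[of id UNIV y] by simp
  ultimately have "regular_on F UNIV (\<lambda>y. f y $ j)" by simp
  then show "(\<lambda>x. f x $ j) \<in> poly_fun UNIV"
    by (rule regular_on_UNIV_imp_poly_fun[OF regular_on_mono_field[OF _ subset_UNIV]])
qed

text \<open>
  A linearization over \<open>F\<close> commutes with \<open>\<sigma>\<close>. Composed with \<open>unstraighten\<close>, it becomes a map on the diagonal
  coordinates that turns \<open>reflection\<close> after conjugation into conjugation alone.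
\<close>

theorem not_linearizable_twisted:
  fixes \<phi> :: "'a \<Rightarrow> 'K::{alg_closed_field,field_char_0}"
  assumes \<sigma>: "field_aut \<sigma>" and fix_F: "\<And>a. a \<in> F \<Longrightarrow> \<sigma> a = a" and \<delta>: "\<delta> \<noteq> 0" "\<sigma> \<delta> = - \<delta>"
    and surj: "\<And>z. z \<noteq> 0 \<Longrightarrow> \<exists>g\<in>carrier H. \<phi> g = z"
  shows "\<not> linearizable F H (\<lambda>g. twisted_act \<delta> (\<phi> g))"
proof
  assume "linearizable F H (\<lambda>g. twisted_act \<delta> (\<phi> g))"
  then obtain \<Phi> :: "'K ^ 4 \<Rightarrow> 'K ^ 4" where iso: "isomorphism F affine_space affine_space \<Phi>"
    and lin: "\<And>g. g \<in> carrier H \<Longrightarrow>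
      Vector_Spaces.linear (*s) (*s) (\<lambda>v. \<Phi> (twisted_act \<delta> (\<phi> g) (inv_into UNIV \<Phi> v)))"
    unfolding linearizable_def by blast
  have mor: "morphism F affine_space affine_space \<Phi>" "morphism F affine_space affine_space (inv_into UNIV \<Phi>)"
    and bij: "bij \<Phi>" using iso by (simp_all add: isomorphism_def)
  have inv: "inv_into UNIV \<Phi> (\<Phi> x) = x" "\<Phi> (inv_into UNIV \<Phi> x) = x" for x
    using bij by (simp_all add: bij_is_inj bij_is_surj surj_f_inv_f)
  show False
  proof (rule no_linearization_of_reflected_weights[OF \<sigma>, where \<psi> = "\<lambda>y. \<Phi> (unstraighten \<delta> y)" and \<psi>' = "\<lambda>x. straighten \<delta> (inv_into UNIV \<Phi> x)"])
    have "poly_map (straighten \<delta>)" "poly_map (unstraighten \<delta>)"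
      by (simp_all add: poly_map_def poly_fun_straighten poly_fun_unstraighten)
    then show "poly_map (\<lambda>y. \<Phi> (unstraighten \<delta> y))" "poly_map (\<lambda>x. straighten \<delta> (inv_into UNIV \<Phi> x))"
      using morphism_affine_poly_map[OF mor(1)] morphism_affine_poly_map[OF mor(2)] by (simp_all add: poly_map_compose)
    show "straighten \<delta> (inv_into UNIV \<Phi> (\<Phi> (unstraighten \<delta> y))) = y" for y
      by (simp add: inv straighten_unstraighten[OF \<delta>(1)])
    show "\<Phi> (unstraighten \<delta> (straighten \<delta> (inv_into UNIV \<Phi> x))) = x" for x
      by (simp add: inv unstraighten_straighten[OF \<delta>(1)])
    show "\<exists>L. Vector_Spaces.linear (*s) (*s) L \<and> (\<forall>y. \<Phi> (unstraighten \<delta> (weight_act z y)) = L (\<Phi> (unstraighten \<delta> y)))"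
      if z: "z \<noteq> 0" for z
    proof -
      obtain g where g: "g \<in> carrier H" "\<phi> g = z" using surj[OF z] by blast
      show ?thesis
        by (rule exI, rule conjI, rule lin[OF g(1)])
          (simp add: inv g(2) twisted_act_def straighten_unstraighten[OF \<delta>(1)])
    qed
    show "\<Phi> (unstraighten \<delta> (reflection (vec_map \<sigma> y))) = vec_map \<sigma> (\<Phi> (unstraighten \<delta> y))" for y
    proof -
      have "reflection (vec_map \<sigma> y) = straighten \<delta> (vec_map \<sigma> (unstraighten \<delta> y))"
        using straighten_galois(2)[OF \<sigma> \<delta>(2), of "unstraighten \<delta> y"] by (simp add: straighten_unstraighten[OF \<delta>(1)])
      then have "unstraighten \<delta> (reflection (vec_map \<sigma> y)) = vec_map \<sigma> (unstraighten \<delta> y)"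
        by (simp add: unstraighten_straighten[OF \<delta>(1)])
      moreover have "\<Phi> (vec_map \<sigma> x) = vec_map \<sigma> (\<Phi> x)" for x
        by (rule morphism_galois_equivariant[OF mor(1) \<sigma> fix_F affine_charts_affine_space galois_lift_affine_space
              affine_charts_affine_space galois_lift_affine_space]) simp_all
      ultimately show ?thesis by simp
    qed
  qed
qed

section \<open>Forms of the multiplicative group\<close>

theorem theorem1:
  fixes A :: "('a, 'k::field_char_0 alg_closure, 'n::finite) atlas"
    and H :: "'a monoid"
  assumes "algebraic_group ground_field A H"
    and "algebraic_groups_isomorphic UNIV A H Gm_atlas Gm"
    and "\<not> algebraic_groups_isomorphic ground_field A H Gm_atlas Gm"
  shows "\<exists>\<rho> :: 'a \<Rightarrow> 'k alg_closure ^ 4 \<Rightarrow> 'k alg_closure ^ 4.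
           algebraic_action ground_field A H affine_space \<rho> \<and>
           \<not> linearizable ground_field H \<rho>"
proof -
  define G :: "('k alg_closure \<Rightarrow> 'k alg_closure) set"
    where "G = {\<sigma>. field_aut \<sigma> \<and> (\<forall>a\<in>ground_field. \<sigma> a = a)}"
  have G: "aut_group G"
    unfolding aut_group_def
  proof (intro conjI ballI)
    show "id \<in> G" by (simp add: G_def field_aut_def)
    show "field_aut \<sigma>" if "\<sigma> \<in> G" for \<sigma> using that by (simp add: G_def)
    show "\<sigma> \<circ> \<tau> \<in> G" if "\<sigma> \<in> G" "\<tau> \<in> G" for \<sigma> \<tau>
      using that by (simp add: G_def field_aut_comp)
    show "inv_into UNIV \<sigma> \<in> G" if "\<sigma> \<in> G" for \<sigma>
    proof -
      have \<sigma>: "field_aut \<sigma>" "\<And>a. a \<in> ground_field \<Longrightarrow> \<sigma> a = a" using that by (auto simp: G_def)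
      have "inv_into UNIV \<sigma> a = a" if "a \<in> ground_field" for a
        using field_autD(13)[OF \<sigma>(1), of a] \<sigma>(2)[OF that] by simp
      then show ?thesis by (simp add: G_def field_aut_inv[OF \<sigma>(1)])
    qed
  qed
  have fixed: "fixed_field G = ground_field"
  proof
    show "fixed_field G \<subseteq> ground_field"
    proof
      fix x assume x: "x \<in> fixed_field G"
      show "x \<in> ground_field"
        using ex_field_aut_moving[OF is_subfield_ground_field algebraic_over_ground_field, of x]
          fixed_fieldD[OF x] unfolding G_def by blast
    qed
  qed (auto simp: fixed_field_def G_def)
  obtain \<phi> \<delta> s where \<phi>: "\<phi> \<in> iso H Gm" "isomorphism UNIV A Gm_atlas \<phi>" and \<delta>: "\<delta> \<noteq> 0"
    and s: "\<And>\<sigma>. \<sigma> \<in> G \<Longrightarrow> galois_lift \<sigma> A (s \<sigma>)"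
    and sign: "\<And>\<sigma>. \<sigma> \<in> G \<Longrightarrow> (\<sigma> \<delta> = \<delta> \<and> (\<forall>h\<in>carrier H. \<phi> (s \<sigma> h) = \<sigma> (\<phi> h))) \<or>
       (\<sigma> \<delta> = - \<delta> \<and> (\<forall>h\<in>carrier H. \<phi> (s \<sigma> h) = inverse (\<sigma> (\<phi> h))))"
    and neg: "\<exists>\<sigma>\<in>G. \<sigma> \<delta> = - \<delta>"
  proof (rule anisotropic_character[OF G, unfolded fixed, OF assms], goal_cases)
    case (1 \<phi> \<delta> s)
    show ?thesis by (rule that[OF 1(2-)])
  qed
  obtain \<sigma> where \<sigma>: "\<sigma> \<in> G" "\<sigma> \<delta> = - \<delta>" using neg by blast
  have "algebraic_action ground_field A H affine_space (\<lambda>g. twisted_act \<delta> (\<phi> g))"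
  proof (rule algebraic_action_twisted[where s = s, OF G, unfolded fixed])
    show "morphism UNIV A Gm_atlas \<phi>" using \<phi>(2) by (simp add: isomorphism_def)
  qed (fact assms(1) \<phi>(1) \<delta> | rule s sign, assumption)+
  moreover have "\<not> linearizable ground_field H (\<lambda>g. twisted_act \<delta> (\<phi> g))"
  proof (rule not_linearizable_twisted[where \<sigma> = \<sigma>])
    show "\<delta> \<noteq> 0" "\<sigma> \<delta> = - \<delta>" by (fact \<delta>) (fact \<sigma>(2))
    show "field_aut \<sigma>" using \<sigma>(1) by (simp add: G_def)
    show "\<sigma> a = a" if "a \<in> ground_field" for a using \<sigma>(1) that unfolding G_def by blast
    show "\<exists>g\<in>carrier H. \<phi> g = z" if "z \<noteq> 0" for z
    proof -
      have "\<phi> ` carrier H = {x. x \<noteq> 0}"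
        using \<phi>(1) by (auto simp: iso_def Gm_def bij_betw_def)
      then show ?thesis using that by (metis (mono_tags) imageE mem_Collect_eq)
    qed
  qed
  ultimately show ?thesis by blast
qed

end
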